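(* Let $s\in(0,1)$ and $N>2s$. Assume that $V$ satisfies (V1) and (V2), and that $f$ satisfies (f1), (f2), (f3), (f4). Then problem $$(-\Delta)^s u + V(x)u = f(x,u)\ \text{ in } \mathbb{R}^N,\qquad u\in H^s(\mathbb{R}^N),$$ has a nontrivial ground state solution, i.e. there exists $u\in H^s(\mathbb{R}^N)\setminus\{0\}$ with $\mathcal{J}'(u)=0$ and $$\mathcal{J}(u)=m:=\inf\{\mathcal{J}(v): v\in H^s(\mathbb{R}^N)\setminus\{0\},\ \mathcal{J}'(v)=0\}.$$
   Context: Let $s\in(0,1)$, $N>2s$, $2^*_s=\frac{2N}{N-2s}$. $H^s(\mathbb{R}^N)$ is the space of $u\in L^2(\mathbb{R}^N)$ with Gagliardo seminorm $[u]^2=\iint_{\mathbb{R}^{2N}}\frac{|u(x)-u(y)|^2}{|x-y|^{N+2s}}\,dx\,dy<\infty$. Hypotheses: (V1) $V\in C(\mathbb{R}^N)$ and $0<\alpha\le V(x)\le\beta$ for all $x$, for constants $\alpha,\beta$. (V2) $V$ is $1$-periodic in each coordinate (i.e. $V(x+k)=V(x)$ for all $k\in\mathbb{Z}^N$). (f1) $f\in C(\mathbb{R}^N\times\mathbb{R})$, $f$ is $1$-periodic in $x$ (i.e. $f(x+k,t)=f(x,t)$ for $k\in\mathbb{Z}^N$), and $\lim_{|t|\to\infty} f(x,t)/|t|^{2^*_s-1}=0$ uniformly in $x\in\mathbb{R}^N$. (f2) $f(x,t)=o(t)$ as $|t|\to0$ uniformly in $x$. (f3) $\lim_{|t|\to\infty}F(x,t)/|t|^2=+\infty$,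 where $F(x,t)=\int_0^t f(x,\tau)d\tau$. (f4) there is $\lambda\ge1$ with $G(x,\theta t)\le\lambda G(x,t)$ for all $(x,t)\in\mathbb{R}^N\times\mathbb{R}$ and $\theta\in[0,1]$, where $G(x,t)=f(x,t)t-2F(x,t)$. The norm on $H^s(\mathbb{R}^N)$ is $\|u\|^2=[u]^2+\int_{\mathbb{R}^N}V(x)u^2\,dx$ (equivalent to the standard one by (V1)), and $\mathcal{J}(u)=\frac12\|u\|^2-\int_{\mathbb{R}^N}F(x,u)\,dx$, a $C^1$ functional whose critical points are the weak solutions of the problem. *)

theory Defs
  imports "HOL-Analysis.Analysis"
begin

text \<open>Dimension N = DIM('a) of the Euclidean space 'a (playing the role of R^N).\<close>

definition crit_exp :: "real \<Rightarrow> nat \<Rightarrow> real" where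
  "crit_exp s N = 2 * real N / (real N - 2 * s)"

definition gagliardo :: "real \<Rightarrow> ('a::euclidean_space \<Rightarrow> real) \<Rightarrow> ennreal" where
  "gagliardo s u = (\<integral>\<^sup>+ p. ennreal ((u (fst p) - u (snd p))\<^sup>2
        / norm (fst p - snd p) powr (real DIM('a) + 2 * s)) \<partial>(lborel \<Otimes>\<^sub>M lborel))"

text \<open>The fractional Sobolev space H^s(R^N) (as a set of measurable representatives).\<close>
definition Hs :: "real \<Rightarrow> ('a::euclidean_space \<Rightarrow> real) set" where
  "Hs s = {u. u \<in> borel_measurable lborel \<and> integrable lborel (\<lambda>x. (u x)\<^sup>2)
              \<and> gagliardo s u < \<infinity>}"

definition gform :: "real \<Rightarrow> ('a::euclidean_space \<Rightarrow> real) \<Rightarrow> ('a \<Rightarrow> real) \<Rightarrow> real" where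
  "gform s u v = (\<integral> p. (u (fst p) - u (snd p)) * (v (fst p) - v (snd p))
        / norm (fst p - snd p) powr (real DIM('a) + 2 * s) \<partial>(lborel \<Otimes>\<^sub>M lborel))"

definition primF :: "('a \<Rightarrow> real \<Rightarrow> real) \<Rightarrow> 'a \<Rightarrow> real \<Rightarrow> real" where
  "primF f x t = (LBINT \<tau>=0..t. f x \<tau>)"

definition energy :: "real \<Rightarrow> ('a::euclidean_space \<Rightarrow> real) \<Rightarrow> ('a \<Rightarrow> real \<Rightarrow> real)
     \<Rightarrow> ('a \<Rightarrow> real) \<Rightarrow> real" where
  "energy s V f u = 1/2 * (enn2real (gagliardo s u) + (\<integral> x. V x * (u x)\<^sup>2 \<partial>lborel))
        - (\<integral> x. primF f x (u x) \<partial>lborel)"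

definition energy_deriv :: "real \<Rightarrow> ('a::euclidean_space \<Rightarrow> real) \<Rightarrow> ('a \<Rightarrow> real \<Rightarrow> real)
     \<Rightarrow> ('a \<Rightarrow> real) \<Rightarrow> ('a \<Rightarrow> real) \<Rightarrow> real" where
  "energy_deriv s V f u v = gform s u v + (\<integral> x. V x * u x * v x \<partial>lborel)
        - (\<integral> x. f x (u x) * v x \<partial>lborel)"

definition crit_point :: "real \<Rightarrow> ('a::euclidean_space \<Rightarrow> real) \<Rightarrow> ('a \<Rightarrow> real \<Rightarrow> real)
     \<Rightarrow> ('a \<Rightarrow> real) \<Rightarrow> bool" where
  "crit_point s V f u \<longleftrightarrow> u \<in> Hs s \<and> (\<forall>v\<in>Hs s. energy_deriv s V f u v = 0)"

definition nontrivial :: "('a::euclidean_space \<Rightarrow> real) \<Rightarrow> bool" where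
  "nontrivial u \<longleftrightarrow> \<not> (AE x in lborel. u x = 0)"

definition int_lattice :: "'a::euclidean_space set" where
  "int_lattice = {k. \<forall>b\<in>Basis. k \<bullet> b \<in> \<int>}"

end

theory Submission
  imports Defs "HOL-Library.Function_Algebras" "HOL-Library.Diagonal_Subsequence"
begin

text \<open>
  The ground state is a limit of translates of critical points. A critical point \<open>v\<close> satisfies
  \<open>2 J(v) = \<integral> G(x, v) \<ge> 0\<close>, so a minimising sequence of nontrivial critical points can be passed to the limit
  with Fatou's lemma, provided it is bounded and does not vanish; the same compactness argument
  applied to a Cerami sequence at mountain pass level shows that nontrivial critical points exist.

  Every convergence is deduced from almost everywhere convergence. A bounded sequence in
  \<open>H\<^sup>s\<close> has a subsequence converging almost everywhere (Rellich), and almost everywhere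
  convergence with a uniform bound already gives convergence of all integrals tested against a fixed
  function, by Young's inequality. The Sobolev embedding into the critical space and Lions' vanishing lemma both
  come from one pointwise inequality: if \<open>|u|\<close> exceeds \<open>|u(x)| / 2\<close> on at most half of a ball around
  \<open>x\<close>, then the Gagliardo density at \<open>x\<close> is bounded below. Boundedness of Cerami sequences is
  the usual dichotomy: vanishing of the normalised sequence contradicts (f4) at the maximum of \<open>J\<close>
  along the ray, nonvanishing contradicts (f3).

  Since \<open>f\<close> is periodic and strictly subcritical at infinity, \<open>J'\<close> is uniformly continuous on bounded sets.
  Hence finitely many Euler steps replace the gradient flow in the mountain pass theorem.
\<close>

subsection \<open>Fractional Sobolev inequality\<close>

text \<open>No Ambrosetti-Rabinowitz condition is assumed, and this shapes the proof: bounded energy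
  and a small derivative in the dual norm are not known to bound a sequence, so
  \<open>J'(u) u\<close> has to be controlled as well. This is the Cerami condition; it forces a
  radial term into the deformation field. Second, \<open>f\<close> is merely continuous and its
  growth is critical up to a vanishing factor. Neither a Lipschitz field nor a subcritical power
  bound is at hand, so every estimate on \<open>f\<close> has an \<epsilon>-part of critical growth
  and a constant times a harmless part. Third, (f3) holds only pointwise in x and enters through
  Fatou's lemma; the sign \<open>F \<ge> 0\<close> that this requires comes from (f4). Periodicity
  acts twice: it makes estimates on \<open>f\<close> uniform in x by compactness of the unit cube,
  and it lets lattice translations bring escaping mass back. Since \<open>Hs s\<close> consists of
  representatives, the form \<open>B\<close> is only positive semidefinite.\<close>

definition gag_density :: "real \<Rightarrow> ('a::euclidean_space \<Rightarrow> real) \<Rightarrow> 'a \<Rightarrow> ennreal" where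
  "gag_density s u x = (\<integral>\<^sup>+ y. ennreal ((u x - u y)\<^sup>2
        / norm (x - y) powr (real DIM('a) + 2 * s)) \<partial>lborel)"

lemma gag_density_measurable [measurable]:
  assumes [measurable]: "u \<in> borel_measurable lborel"
  shows "gag_density s u \<in> borel_measurable lborel"
  unfolding gag_density_def by measurable

lemma gagliardo_eq_density:
  fixes u :: "'a::euclidean_space \<Rightarrow> real"
  assumes [measurable]: "u \<in> borel_measurable lborel"
  shows "gagliardo s u = (\<integral>\<^sup>+ x. gag_density s u x \<partial>lborel)"
proof -
  have [measurable]: "u \<in> borel_measurable borel" using assms by simp
  show ?thesis unfolding gagliardo_def gag_density_def
    by (subst lborel.nn_integral_fst [symmetric]) (auto)
qed

text \<open>On the other half of the ball the numerator is at least \<open>(u x)^2 / 4\<close> and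
  the distance is less than \<open>r\<close>; the factor 1/8 is 1/4 times one half of the
  volume.\<close>

lemma gag_density_lower_bound:
  fixes u :: "'a::euclidean_space \<Rightarrow> real"
  assumes [measurable]: "u \<in> borel_measurable lborel"
    and s: "0 < s" and r: "0 < r" and ux: "u x \<noteq> 0"
    and half: "emeasure lborel {y \<in> ball x r. \<bar>u y\<bar> > \<bar>u x\<bar> / 2}
        \<le> ennreal (unit_ball_vol (real DIM('a)) * r ^ DIM('a) / 2)"
  shows "ennreal (unit_ball_vol (real DIM('a)) / 8 * (u x)\<^sup>2 * r powr (- 2 * s)) \<le> gag_density s u x"
proof -
  define w where "w = unit_ball_vol (real DIM('a))"
  have w: "w > 0" by (simp add: w_def)
  define A where "A = {y \<in> ball x r. \<bar>u y\<bar> \<le> \<bar>u x\<bar> / 2}"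
  define B where "B = {y \<in> ball x r. \<bar>u y\<bar> > \<bar>u x\<bar> / 2}"
  have [measurable]: "u \<in> borel_measurable borel" using assms by simp
  have mA [measurable]: "A \<in> sets lborel" and mB [measurable]: "B \<in> sets lborel" unfolding A_def B_def by measurable
  have AB: "A \<union> B = ball x r" "A \<inter> B = {}" by (auto simp: A_def B_def)
  have sum: "emeasure lborel A + emeasure lborel B = ennreal (w * r ^ DIM('a))"
    using plus_emeasure[OF mA mB AB(2)] r by (simp add: AB(1) emeasure_ball w_def)
  have fin: "emeasure lborel A < top" "emeasure lborel B < top"
    using sum by (metis ennreal_less_top ennreal_add_eq_top top.not_eq_extremum)+
  obtain a where a: "emeasure lborel A = ennreal a" "a \<ge> 0" using fin(1) by (metis ennreal_cases order_less_irrefl infinity_ennreal_def)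
  obtain b where b: "emeasure lborel B = ennreal b" "b \<ge> 0" using fin(2) by (metis ennreal_cases order_less_irrefl infinity_ennreal_def)
  have pw: "w * r ^ DIM('a) > 0" using w r by simp
  have "a + b = w * r ^ DIM('a)" using sum a b pw by (simp flip: ennreal_plus)
  moreover have "b \<le> w * r ^ DIM('a) / 2"
    using half pw b unfolding B_def[symmetric] w_def[symmetric] by (simp add: ennreal_le_iff)
  ultimately have a2: "a \<ge> w * r ^ DIM('a) / 2" by simp
  define c where "c = (u x)\<^sup>2 / 4 / r powr (real DIM('a) + 2 * s)"
  have c0: "c \<ge> 0" by (simp add: c_def)
  have "ennreal (w / 8 * (u x)\<^sup>2 * r powr (- 2 * s)) \<le> ennreal (c * a)"
  proof (rule ennreal_leI)
    have e: "r powr (real DIM('a) + 2 * s) = r ^ DIM('a) * r powr (2 * s)"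
      using r by (simp add: powr_add powr_realpow)
    have "w / 8 * (u x)\<^sup>2 * r powr (- 2 * s) = c * (w * r ^ DIM('a) / 2)"
      unfolding c_def e using r by (simp add: powr_minus field_simps)
    also have "\<dots> \<le> c * a" using a2 c0 by (rule mult_left_mono)
    finally show "w / 8 * (u x)\<^sup>2 * r powr (- 2 * s) \<le> c * a" .
  qed
  also have "\<dots> = (\<integral>\<^sup>+ y. ennreal c * indicator A y \<partial>lborel)"
    using c0 a by (subst nn_integral_cmult_indicator[OF mA]) (auto simp: ennreal_mult)
  also have "\<dots> \<le> gag_density s u x" unfolding gag_density_def
  proof (rule nn_integral_mono)
    fix y
    show "ennreal c * indicator A y \<le> ennreal ((u x - u y)\<^sup>2 / norm (x - y) powr (real DIM('a) + 2 * s))"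
    proof (cases "y \<in> A")
      case True
      have y: "norm (x - y) < r" "\<bar>u y\<bar> \<le> \<bar>u x\<bar> / 2" using True by (auto simp: A_def dist_norm)
      have "y \<noteq> x" using y(2) ux by auto
      have "\<bar>u x\<bar> / 2 \<le> \<bar>u x - u y\<bar>" using y(2) by linarith
      hence "(\<bar>u x\<bar> / 2)\<^sup>2 \<le> \<bar>u x - u y\<bar>\<^sup>2" by (rule power_mono) simp
      hence sq: "(u x)\<^sup>2 / 4 \<le> (u x - u y)\<^sup>2" by (simp add: power_divide)
      have "norm (x - y) powr (real DIM('a) + 2 * s) \<le> r powr (real DIM('a) + 2 * s)"
        using y(1) s by (intro powr_mono2) auto
      moreover have "0 < norm (x - y) powr (real DIM('a) + 2 * s)" using \<open>y \<noteq> x\<close> by simp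
      ultimately have "c \<le> (u x - u y)\<^sup>2 / norm (x - y) powr (real DIM('a) + 2 * s)"
        unfolding c_def by (intro frac_le sq) auto
      thus ?thesis using True by (simp add: ennreal_leI)
    qed simp
  qed
  finally show ?thesis by (simp add: w_def)
qed

text \<open>The radius solves \<open>w * r^N * (|u x| / 2) powr m = 2 * S\<close>: by Markov's
  inequality an integral of at most \<open>S\<close> then forces \<open>|u| > |u x| / 2\<close> on
  at most half of the ball. Inserted into the lower bound, \<open>r powr (-2s)\<close> becomes the
  extra power \<open>2sm/N\<close> of \<open>|u x|\<close>. Only the integral over
  \<open>ball x r\<close> enters, so \<open>S\<close> may be a global integral (Sobolev) or a local
  mass (vanishing).\<close>

lemma powr_le_gag_density:
  fixes u :: "'a::euclidean_space \<Rightarrow> real"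
  defines "w \<equiv> unit_ball_vol (real DIM('a))" and "N \<equiv> real DIM('a)"
  assumes [measurable]: "u \<in> borel_measurable lborel"
    and s: "0 < s" and m: "0 < m" and S: "0 < S" and ux: "u x \<noteq> 0"
    and r: "r = (2 powr (m + 1) * S / (w * \<bar>u x\<bar> powr m)) powr (1 / N)"
    and le: "(\<integral>\<^sup>+ y. ennreal (\<bar>u y\<bar> powr m) * indicator (ball x r) y \<partial>lborel) \<le> ennreal S"
  shows "ennreal (\<bar>u x\<bar> powr (2 + 2 * s * m / N))
     \<le> ennreal (8 / w * (2 powr (m + 1) / w) powr (2 * s / N) * S powr (2 * s / N)) * gag_density s u x"
proof -
  have w: "w > 0" by (simp add: w_def)
  have N: "N > 0" by (simp add: N_def)
  have [measurable]: "u \<in> borel_measurable borel" using assms by simp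
  define z where "z = \<bar>u x\<bar>"
  have z: "z > 0" using ux by (simp add: z_def)
  define X where "X = 2 powr (m + 1) * S / (w * z powr m)"
  have X: "X > 0" unfolding X_def using w S z by simp
  have rX: "r = X powr (1 / N)" unfolding r X_def z_def ..
  have r0: "r > 0" unfolding rX using X by simp
  have rN: "r ^ DIM('a) = X"
    unfolding rX using X by (simp add: powr_realpow[symmetric] powr_powr N_def)
  have half: "emeasure lborel {y \<in> ball x r. \<bar>u y\<bar> > \<bar>u x\<bar> / 2} \<le> ennreal (w * r ^ DIM('a) / 2)"
  proof -
    let ?c = "ennreal ((2 / z) powr m)"
    have [measurable]: "ball x r \<in> sets borel" by simp
    have "emeasure lborel {y \<in> ball x r. \<bar>u y\<bar> > \<bar>u x\<bar> / 2}
       \<le> emeasure lborel {y \<in> ball x r. 1 \<le> ?c * ennreal (\<bar>u y\<bar> powr m)}"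
    proof (rule emeasure_mono)
      show "{y \<in> ball x r. \<bar>u x\<bar> / 2 < \<bar>u y\<bar>} \<subseteq> {y \<in> ball x r. 1 \<le> ?c * ennreal (\<bar>u y\<bar> powr m)}"
      proof safe
        fix y assume "\<bar>u x\<bar> / 2 < \<bar>u y\<bar>"
        hence "1 \<le> 2 / z * \<bar>u y\<bar>" using z by (simp add: z_def field_simps)
        hence "1 powr m \<le> (2 / z * \<bar>u y\<bar>) powr m" using m by (intro powr_mono2) auto
        moreover have "(2 / z * \<bar>u y\<bar>) powr m = (2 / z) powr m * \<bar>u y\<bar> powr m"
          by (rule powr_mult)
        ultimately have "1 \<le> (2 / z) powr m * \<bar>u y\<bar> powr m" by simp
        thus "1 \<le> ?c * ennreal (\<bar>u y\<bar> powr m)"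
          by (metis ennreal_1 ennreal_leI ennreal_mult powr_ge_zero)
      qed
    qed measurable
    also have "\<dots> \<le> ?c * (\<integral>\<^sup>+ y. ennreal (\<bar>u y\<bar> powr m) * indicator (ball x r) y \<partial>lborel)"
      by (rule nn_integral_Markov_inequality) measurable
    also have "\<dots> \<le> ?c * ennreal S" using le by (rule mult_left_mono) simp
    also have "\<dots> = ennreal (w * r ^ DIM('a) / 2)"
      unfolding rN X_def using w z S by (simp add: ennreal_mult[symmetric] powr_divide powr_add field_simps)
    finally show ?thesis .
  qed
  have lb: "ennreal (w / 8 * z\<^sup>2 * r powr (- 2 * s)) \<le> gag_density s u x"
    using gag_density_lower_bound[of u s r x] s r0 ux half by (simp add: w_def z_def)
  let ?C = "8 / w * (2 powr (m + 1) / w) powr (2 * s / N) * S powr (2 * s / N)"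
  have eq: "z powr (2 + 2 * s * m / N) = ?C * (w / 8 * z\<^sup>2 * r powr (- 2 * s))"
  proof -
    have "r powr (- 2 * s) = X powr (- (2 * s / N))" unfolding rX by (simp add: powr_powr)
    also have "\<dots> = 1 / X powr (2 * s / N)" by (simp add: powr_minus divide_inverse)
    also have "X powr (2 * s / N) = ((2 powr (m + 1) / w) * S / z powr m) powr (2 * s / N)"
      unfolding X_def by (simp add: field_simps)
    also have "\<dots> = (2 powr (m + 1) / w) powr (2 * s / N) * S powr (2 * s / N) / z powr (2 * s * m / N)"
      using w S z by (simp add: powr_mult powr_divide powr_powr mult_ac)
    finally have "r powr (- 2 * s) = z powr (2 * s * m / N) / ((2 powr (m + 1) / w) powr (2 * s / N) * S powr (2 * s / N))"
      by simp
    moreover have "z powr (2 + 2 * s * m / N) = z\<^sup>2 * z powr (2 * s * m / N)"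
      using z by (simp add: powr_add)
    moreover have "(2 powr (m + 1) / w) powr (2 * s / N) \<noteq> 0" "S powr (2 * s / N) \<noteq> 0" using w S by auto
    ultimately show ?thesis using w by (simp add: field_simps)
  qed
  have "ennreal (z powr (2 + 2 * s * m / N)) = ennreal ?C * ennreal (w / 8 * z\<^sup>2 * r powr (- 2 * s))"
    unfolding eq using w by (intro ennreal_mult) auto
  also have "\<dots> \<le> ennreal ?C * gag_density s u x" using lb by (rule mult_left_mono) simp
  finally show ?thesis by (simp add: z_def)
qed

lemma gagliardo_contraction:
  assumes "\<And>x y. \<bar>v x - v y\<bar> \<le> \<bar>u x - u y\<bar>"
  shows "gagliardo s v \<le> gagliardo s u"
  unfolding gagliardo_def
  by (intro nn_integral_mono ennreal_leI divide_right_mono)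
     (use assms in \<open>simp_all add: abs_le_square_iff[symmetric]\<close>)

text \<open>\<open>powr_le_gag_density\<close> acts on exponents by m -> 2 + 2sm/N. The critical
  exponent \<open>q\<close> is the fixed point of this map, and \<open>p\<close> is its value at m =
  2.\<close>

locale frac_exponents =
  fixes s N q p :: real
  assumes s: "0 < s" "s < 1" and N: "2 * s < N"
    and q_def: "q = 2 * N / (N - 2 * s)" and p_def: "p = 2 + 4 * s / N"
begin

lemma N_pos: "N > 0" using s N by simp

lemma q_gt_2: "q > 2" using N s by (simp add: q_def field_simps)

lemma p_gt_2: "p > 2" using N_pos s by (simp add: p_def)

lemma p_less_q: "p < q"
proof -
  have "q - 2 = 4 * s / (N - 2 * s)" using N by (simp add: q_def field_simps)
  also have "\<dots> > 4 * s / N" using s N N_pos by (intro divide_strict_left_mono) auto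
  finally show ?thesis by (simp add: p_def)
qed

lemma q_exponent_eq: "2 + 2 * s * q / N = q"
  using N N_pos by (simp add: q_def field_simps)

end

text \<open>With S equal to a, the integral of \<open>|u| powr q\<close> itself, integrating the
  pointwise inequality gives \<open>a \<le> C * a powr (2s/N) * g\<close>, and the power of a is
  absorbed on the left. Absorption needs a finite, which is all that the bound \<open>K\<close> is
  for: it does not enter the final constant.\<close>

lemma sobolev_bounded:
  fixes u :: "'a::euclidean_space \<Rightarrow> real"
  assumes "frac_exponents s (real DIM('a)) q p"
  defines "w \<equiv> unit_ball_vol (real DIM('a))" and "N \<equiv> real DIM('a)"
  defines "C \<equiv> 8 / w * (2 powr (q + 1) / w) powr (2 * s / N)"
  assumes [measurable]: "u \<in> borel_measurable lborel"
    and bd: "\<And>x. \<bar>u x\<bar> \<le> K" and L2: "integrable lborel (\<lambda>x. (u x)\<^sup>2)" and g: "gagliardo s u \<le> ennreal g" "g \<ge> 0"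
  shows "(\<integral>\<^sup>+ x. ennreal (\<bar>u x\<bar> powr q) \<partial>lborel) \<le> ennreal ((C * g) powr (q / 2))"
proof -
  interpret frac_exponents s N q p using assms(1) unfolding N_def .
  define A where "A = (\<integral>\<^sup>+ x. ennreal (\<bar>u x\<bar> powr q) \<partial>lborel)"
  have "w > 0" by (simp add: w_def)
  hence C: "C > 0" unfolding C_def by simp
  have "A \<le> (\<integral>\<^sup>+ x. ennreal (\<bar>K\<bar> powr (q - 2)) * ennreal ((u x)\<^sup>2) \<partial>lborel)"
    unfolding A_def
  proof (rule nn_integral_mono)
    fix x
    have "\<bar>u x\<bar> powr q = \<bar>u x\<bar> powr (q - 2) * \<bar>u x\<bar> powr 2" by (simp flip: powr_add del: powr_numeral)
    also have "\<bar>u x\<bar> powr 2 = (u x)\<^sup>2" by (cases "u x = 0") (simp_all)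
    also have "\<bar>u x\<bar> powr (q - 2) * (u x)\<^sup>2 \<le> \<bar>K\<bar> powr (q - 2) * (u x)\<^sup>2"
      using bd[of x] q_gt_2 by (intro mult_right_mono powr_mono2) auto
    finally have "\<bar>u x\<bar> powr q \<le> \<bar>K\<bar> powr (q - 2) * (u x)\<^sup>2" .
    thus "ennreal (\<bar>u x\<bar> powr q) \<le> ennreal (\<bar>K\<bar> powr (q - 2)) * ennreal ((u x)\<^sup>2)"
      by (simp add: ennreal_mult[symmetric] ennreal_leI)
  qed
  also have "\<dots> = ennreal (\<bar>K\<bar> powr (q - 2)) * (\<integral>\<^sup>+ x. ennreal ((u x)\<^sup>2) \<partial>lborel)"
    by (rule nn_integral_cmult) simp
  also have "\<dots> < top" using L2 by (simp add: nn_integral_eq_integral ennreal_mult_less_top)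
  finally have "A < top" .
  then obtain a where a: "A = ennreal a" "a \<ge> 0" by (metis ennreal_cases order_less_irrefl infinity_ennreal_def)
  show ?thesis
  proof (cases "a = 0")
    case True
    thus ?thesis using a unfolding A_def by simp
  next
    case False
    hence a0: "a > 0" using a by simp
    have "A \<le> (\<integral>\<^sup>+ x. ennreal (C * a powr (2 * s / N)) * gag_density s u x \<partial>lborel)"
      unfolding A_def
    proof (rule nn_integral_mono)
      fix x
      show "ennreal (\<bar>u x\<bar> powr q) \<le> ennreal (C * a powr (2 * s / N)) * gag_density s u x"
      proof (cases "u x = 0")
        case False
        let ?r = "(2 powr (q + 1) * a / (w * \<bar>u x\<bar> powr q)) powr (1 / N)"
        have "(\<integral>\<^sup>+ y. ennreal (\<bar>u y\<bar> powr q) * indicator (ball x ?r) y \<partial>lborel) \<le> A"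
          unfolding A_def by (intro nn_integral_mono) (simp add: indicator_def)
        hence "ennreal (\<bar>u x\<bar> powr (2 + 2 * s * q / N)) \<le> ennreal (C * a powr (2 * s / N)) * gag_density s u x"
          unfolding C_def w_def N_def using a a0 s q_gt_2 False
          by (intro powr_le_gag_density[OF _ _ _ _ _ refl]) (auto simp: w_def N_def)
        thus ?thesis by (simp add: q_exponent_eq)
      qed simp
    qed
    also have "\<dots> = ennreal (C * a powr (2 * s / N)) * gagliardo s u"
      by (simp add: gagliardo_eq_density nn_integral_cmult)
    also have "\<dots> \<le> ennreal (C * a powr (2 * s / N)) * ennreal g"
      by (intro mult_left_mono g) simp
    finally have "ennreal a \<le> ennreal (C * a powr (2 * s / N) * g)" using a g C by (simp add: ennreal_mult)
    hence "a \<le> C * a powr (2 * s / N) * g" using g C by (subst (asm) ennreal_le_iff) auto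
    moreover have "a = a powr (1 - 2 * s / N) * a powr (2 * s / N)" using a0 by (simp flip: powr_add)
    ultimately have "a powr (1 - 2 * s / N) * a powr (2 * s / N) \<le> (C * g) * a powr (2 * s / N)"
      by (simp add: mult_ac)
    hence "a powr (1 - 2 * s / N) \<le> C * g" using a0 by (simp add: mult_le_cancel_right)
    hence "(a powr (1 - 2 * s / N)) powr (q / 2) \<le> (C * g) powr (q / 2)"
      using q_gt_2 by (intro powr_mono2) auto
    moreover have "(1 - 2 * s / N) * (q / 2) = 1" using N N_pos by (simp add: q_def field_simps)
    ultimately have "a \<le> (C * g) powr (q / 2)" using a0 by (simp add: powr_powr)
    thus ?thesis using a unfolding A_def by (simp add: ennreal_leI)
  qed
qed

text \<open>Truncation at height n does not increase the Gagliardo seminorm, so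
  \<open>sobolev_bounded\<close> bounds all truncations alike; Fatou's lemma removes the
  truncation.\<close>

lemma sobolev_inequality:
  assumes "frac_exponents s (real DIM('a::euclidean_space)) q p"
  obtains C where "C > 0" "\<And>u::'a\<Rightarrow>real. u \<in> Hs s \<Longrightarrow> integrable lborel (\<lambda>x. \<bar>u x\<bar> powr q) \<and>
     (\<integral>x. \<bar>u x\<bar> powr q \<partial>lborel) \<le> C * enn2real (gagliardo s u) powr (q / 2)"
proof -
  interpret frac_exponents s "real DIM('a)" q p by fact
  define w where "w = unit_ball_vol (real DIM('a))"
  define C where "C = 8 / w * (2 powr (q + 1) / w) powr (2 * s / real DIM('a))"
  have "w > 0" by (simp add: w_def)
  hence C0: "C > 0" unfolding C_def by simp
  have main: "integrable lborel (\<lambda>x. \<bar>u x\<bar> powr q) \<and>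
     (\<integral>x. \<bar>u x\<bar> powr q \<partial>lborel) \<le> C powr (q/2) * enn2real (gagliardo s u) powr (q / 2)"
    if u: "u \<in> Hs s" for u :: "'a \<Rightarrow> real"
  proof -
    have [measurable]: "u \<in> borel_measurable lborel" and L2: "integrable lborel (\<lambda>x. (u x)\<^sup>2)"
      and g: "gagliardo s u < \<infinity>" using u by (auto simp: Hs_def)
    define G where "G = enn2real (gagliardo s u)"
    have gG: "gagliardo s u = ennreal G" "G \<ge> 0" using g by (simp_all add: G_def)
    define t where "t = (\<lambda>(n::nat) x. max (- real n) (min (real n) (u x)))"
    have tm [measurable]: "t n \<in> borel_measurable lborel" for n unfolding t_def by measurable
    have tle: "\<bar>t n x\<bar> \<le> \<bar>u x\<bar>" for n x unfolding t_def by auto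
    have tb: "(\<integral>\<^sup>+ x. ennreal (\<bar>t n x\<bar> powr q) \<partial>lborel) \<le> ennreal ((C * G) powr (q / 2))" for n
    proof (unfold C_def w_def, rule sobolev_bounded[OF assms])
      show "\<bar>t n x\<bar> \<le> real n" for x unfolding t_def by auto
      show "integrable lborel (\<lambda>x. (t n x)\<^sup>2)"
        by (rule Bochner_Integration.integrable_bound[OF L2]) (use tle in \<open>auto simp: abs_le_square_iff[symmetric]\<close>)
      have "gagliardo s (t n) \<le> gagliardo s u"
        by (rule gagliardo_contraction) (auto simp: t_def)
      thus "gagliardo s (t n) \<le> ennreal G" using gG by simp
    qed (use gG in auto)
    have lim: "(\<lambda>n. ennreal (\<bar>t n x\<bar> powr q)) \<longlonglongrightarrow> ennreal (\<bar>u x\<bar> powr q)" for x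
    proof (rule tendsto_eventually)
      obtain n0 :: nat where n0: "\<bar>u x\<bar> \<le> real n0" using real_arch_simple by blast
      show "eventually (\<lambda>n. ennreal (\<bar>t n x\<bar> powr q) = ennreal (\<bar>u x\<bar> powr q)) sequentially"
        using eventually_ge_at_top[of n0]
      proof eventually_elim
        case (elim n)
        hence "\<bar>u x\<bar> \<le> real n" using n0 by (meson of_nat_le_iff order_trans)
        hence "t n x = u x" unfolding t_def by auto
        thus ?case by simp
      qed
    qed
    have "(\<integral>\<^sup>+ x. ennreal (\<bar>u x\<bar> powr q) \<partial>lborel) = (\<integral>\<^sup>+ x. liminf (\<lambda>n. ennreal (\<bar>t n x\<bar> powr q)) \<partial>lborel)"
      by (intro nn_integral_cong lim_imp_Liminf[symmetric] lim) simp
    also have "\<dots> \<le> liminf (\<lambda>n. \<integral>\<^sup>+ x. ennreal (\<bar>t n x\<bar> powr q) \<partial>lborel)"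
      by (rule nn_integral_liminf) simp
    also have "\<dots> \<le> ennreal ((C * G) powr (q / 2))"
      using tb Liminf_le[of sequentially "\<lambda>n. \<integral>\<^sup>+ x. ennreal (\<bar>t n x\<bar> powr q) \<partial>lborel"]
      by (intro Liminf_le) (auto intro!: always_eventually)
    finally have le: "(\<integral>\<^sup>+ x. ennreal (\<bar>u x\<bar> powr q) \<partial>lborel) \<le> ennreal ((C * G) powr (q / 2))" .
    have i: "integrable lborel (\<lambda>x. \<bar>u x\<bar> powr q)"
      by (rule integrableI_bounded) (use le in \<open>auto intro: le_less_trans simp: ennreal_less_top\<close>)
    have "ennreal (\<integral>x. \<bar>u x\<bar> powr q \<partial>lborel) \<le> ennreal ((C * G) powr (q / 2))"
      using le i by (simp add: nn_integral_eq_integral)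
    hence "(\<integral>x. \<bar>u x\<bar> powr q \<partial>lborel) \<le> (C * G) powr (q / 2)" by (subst (asm) ennreal_le_iff) auto
    also have "\<dots> = C powr (q / 2) * G powr (q/2)" using C0 gG by (simp add: powr_mult)
    finally show ?thesis using i by (simp add: G_def)
  qed
  show ?thesis by (rule that[of "C powr (q / 2)"]) (use C0 main in auto)
qed

lemma abs_powr_two: "\<bar>t::real\<bar> powr 2 = t\<^sup>2"
  by (cases "t = 0") simp_all

text \<open>Lions' vanishing lemma: the argument of the Sobolev inequality, with the mass of \<open>u\<close> in unit
  balls in place of its global norm, wherever \<open>u\<close> is not small.\<close>

lemma vanishing_inequality:
  assumes "frac_exponents s (real DIM('a::euclidean_space)) q p"
  obtains C where "C > 0" "\<And>(u::'a\<Rightarrow>real) \<mu>. u \<in> Hs s \<Longrightarrow> \<mu> > 0 \<Longrightarrow>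
     (\<And>x. (\<integral>y. (u y)\<^sup>2 * indicator (ball x 1) y \<partial>lborel) \<le> \<mu>) \<Longrightarrow> integrable lborel (\<lambda>x. \<bar>u x\<bar> powr p) \<and>
     (\<integral>x. \<bar>u x\<bar> powr p \<partial>lborel) \<le> C * \<mu> powr (2 * s / real DIM('a)) * (enn2real (gagliardo s u) + (\<integral>x. (u x)\<^sup>2 \<partial>lborel))"
proof -
  interpret frac_exponents s "real DIM('a)" q p by fact
  define N where "N = real DIM('a)"
  define w where "w = unit_ball_vol (real DIM('a))"
  have w: "w > 0" by (simp add: w_def)
  have N0: "N > 0" by (simp add: N_def)
  define C1 where "C1 = 8 / w * (2 powr (2 + 1) / w) powr (2 * s / N)"
  define C2 where "C2 = (8 / w) powr (2 * s / N)"
  have C0: "C1 > 0" "C2 > 0" unfolding C1_def C2_def using w by auto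
  have main: "integrable lborel (\<lambda>x. \<bar>u x\<bar> powr p) \<and>
     (\<integral>x. \<bar>u x\<bar> powr p \<partial>lborel) \<le> (C1 + C2) * \<mu> powr (2 * s / N) * (enn2real (gagliardo s u) + (\<integral>x. (u x)\<^sup>2 \<partial>lborel))"
    if u: "u \<in> Hs s" and mu: "\<mu> > 0" and le: "\<And>x. (\<integral>y. (u y)\<^sup>2 * indicator (ball x 1) y \<partial>lborel) \<le> \<mu>" for u :: "'a \<Rightarrow> real" and \<mu>
  proof -
    have [measurable]: "u \<in> borel_measurable lborel" and L2: "integrable lborel (\<lambda>x. (u x)\<^sup>2)"
      and g: "gagliardo s u < \<infinity>" using u by (auto simp: Hs_def)
    have [measurable]: "u \<in> borel_measurable borel" by simp
    define G where "G = enn2real (gagliardo s u)"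
    have gG: "gagliardo s u = ennreal G" "G \<ge> 0" using g by (simp_all add: G_def)
    define E where "E = \<mu> powr (2 * s / N)"
    have E: "E > 0" using mu by (simp add: E_def)
    \<comment> \<open>Above the threshold \<open>8 * \<mu> / w\<close> for \<open>(u x)^2\<close>,
      the radius of \<open>powr_le_gag_density\<close> with m = 2 and S = \<mu> is at most 1, so the
      mass in the unit ball suffices. Below it, the excess power \<open>4s/N\<close> of
      \<open>|u x|\<close> is itself small.\<close>
    have pt: "ennreal (\<bar>u x\<bar> powr p) \<le> ennreal (C1 * E) * gag_density s u x + ennreal (C2 * E) * ennreal ((u x)\<^sup>2)" for x
    proof (cases "(u x)\<^sup>2 \<le> 8 * \<mu> / w")
      case True
      have "\<bar>u x\<bar> powr p = \<bar>u x\<bar> powr 2 * \<bar>u x\<bar> powr (4 * s / N)"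
        by (simp add: p_def N_def powr_add del: powr_numeral)
      also have "\<bar>u x\<bar> powr (4 * s / N) = (\<bar>u x\<bar> powr 2) powr (2 * s / N)" by (simp add: powr_powr del: powr_numeral)
      also have "\<bar>u x\<bar> powr 2 = (u x)\<^sup>2" by (rule abs_powr_two)
      finally have "\<bar>u x\<bar> powr p = (u x)\<^sup>2 * ((u x)\<^sup>2) powr (2 * s / N)" .
      moreover have "((u x)\<^sup>2) powr (2 * s / N) \<le> (8 * \<mu> / w) powr (2 * s / N)"
        using True s N0 by (intro powr_mono2) auto
      moreover have "\<dots> = C2 * E" using w mu unfolding C2_def E_def by (simp flip: powr_mult)
      ultimately have "\<bar>u x\<bar> powr p \<le> C2 * E * (u x)\<^sup>2" by (metis mult.commute mult_left_mono zero_le_power2)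
      hence "ennreal (\<bar>u x\<bar> powr p) \<le> ennreal (C2 * E) * ennreal ((u x)\<^sup>2)"
        using C0 E by (simp add: ennreal_leI flip: ennreal_mult)
      thus ?thesis by (rule order_trans) simp
    next
      case False
      hence ux: "u x \<noteq> 0" using w mu by auto
      let ?r = "(2 powr (2 + 1) * \<mu> / (w * \<bar>u x\<bar> powr 2)) powr (1 / N)"
      have "2 powr (2 + 1) = (8::real)" by simp
      hence "2 powr (2 + 1) * \<mu> / (w * \<bar>u x\<bar> powr 2) \<le> 1"
        using False ux w by (simp add: abs_powr_two field_simps)
      hence r1: "?r \<le> 1 powr (1 / N)" using N0 mu w by (intro powr_mono2) auto
      have "(\<integral>\<^sup>+ y. ennreal (\<bar>u y\<bar> powr 2) * indicator (ball x ?r) y \<partial>lborel)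
          \<le> (\<integral>\<^sup>+ y. ennreal ((u y)\<^sup>2 * indicator (ball x 1) y) \<partial>lborel)"
        using r1 by (intro nn_integral_mono) (auto simp: indicator_def abs_powr_two)
      also have "\<dots> = ennreal (\<integral>y. (u y)\<^sup>2 * indicator (ball x 1) y \<partial>lborel)"
        by (intro nn_integral_eq_integral Bochner_Integration.integrable_bound[OF L2]) (auto simp: indicator_def)
      also have "\<dots> \<le> ennreal \<mu>" using le by (intro ennreal_leI)
      finally have "ennreal (\<bar>u x\<bar> powr (2 + 2 * s * 2 / N)) \<le> ennreal (C1 * \<mu> powr (2 * s / N)) * gag_density s u x"
        unfolding C1_def w_def N_def using s mu ux
        by (intro powr_le_gag_density[OF _ _ _ _ _ refl]) (auto)
      hence "ennreal (\<bar>u x\<bar> powr p) \<le> ennreal (C1 * E) * gag_density s u x" by (simp add: p_def E_def N_def)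
      thus ?thesis by (rule order_trans) simp
    qed
    have "(\<integral>\<^sup>+ x. ennreal (\<bar>u x\<bar> powr p) \<partial>lborel)
        \<le> (\<integral>\<^sup>+ x. ennreal (C1 * E) * gag_density s u x + ennreal (C2 * E) * ennreal ((u x)\<^sup>2) \<partial>lborel)"
      by (intro nn_integral_mono pt)
    also have "\<dots> = ennreal (C1 * E) * ennreal G + ennreal (C2 * E) * ennreal (\<integral>x. (u x)\<^sup>2 \<partial>lborel)"
      using L2 gG by (simp add: nn_integral_add nn_integral_cmult gagliardo_eq_density nn_integral_eq_integral)
    also have "\<dots> = ennreal (C1 * E * G + C2 * E * (\<integral>x. (u x)\<^sup>2 \<partial>lborel))"
      using C0 E gG by (simp add: ennreal_mult ennreal_plus)
    finally have nn: "(\<integral>\<^sup>+ x. ennreal (\<bar>u x\<bar> powr p) \<partial>lborel) \<le> ennreal (C1 * E * G + C2 * E * (\<integral>x. (u x)\<^sup>2 \<partial>lborel))" .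
    have i: "integrable lborel (\<lambda>x. \<bar>u x\<bar> powr p)"
      by (rule integrableI_bounded) (use nn in \<open>auto intro: le_less_trans simp: ennreal_less_top\<close>)
    have "ennreal (\<integral>x. \<bar>u x\<bar> powr p \<partial>lborel) \<le> ennreal (C1 * E * G + C2 * E * (\<integral>x. (u x)\<^sup>2 \<partial>lborel))"
      using nn i by (simp add: nn_integral_eq_integral)
    hence "(\<integral>x. \<bar>u x\<bar> powr p \<partial>lborel) \<le> C1 * E * G + C2 * E * (\<integral>x. (u x)\<^sup>2 \<partial>lborel)"
      using C0 E gG by (subst (asm) ennreal_le_iff) auto
    also have "\<dots> \<le> (C1 + C2) * E * (G + (\<integral>x. (u x)\<^sup>2 \<partial>lborel))"
      using C0 E gG by (simp add: algebra_simps)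
    finally show ?thesis using i by (simp add: G_def E_def)
  qed
  show ?thesis by (rule that[of "C1 + C2"]) (use C0 main in \<open>auto simp: N_def\<close>)
qed

subsection \<open>Mountain pass in semi-inner product spaces\<close>

text \<open>A Hilbert space up to null vectors: \<open>B\<close> need not be definite and limits
  need not be unique, as is the case for functions that are not identified almost
  everywhere.\<close>

locale semi_hilbert =
  fixes H :: "'v::real_vector set" and B :: "'v \<Rightarrow> 'v \<Rightarrow> real"
  assumes sub: "subspace H"
    and sym: "u \<in> H \<Longrightarrow> v \<in> H \<Longrightarrow> B u v = B v u"
    and add_left: "u \<in> H \<Longrightarrow> v \<in> H \<Longrightarrow> w \<in> H \<Longrightarrow> B (u + v) w = B u w + B v w"
    and scale_left: "u \<in> H \<Longrightarrow> w \<in> H \<Longrightarrow> B (c *\<^sub>R u) w = c * B u w"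
    and pos: "u \<in> H \<Longrightarrow> 0 \<le> B u u"
    and complete: "(\<And>n::nat. X n \<in> H) \<Longrightarrow>
        (\<And>e. e > 0 \<Longrightarrow> \<exists>M. \<forall>m\<ge>M. \<forall>n\<ge>M. B (X m - X n) (X m - X n) < e) \<Longrightarrow>
        \<exists>u\<in>H. (\<lambda>n. B (X n - u) (X n - u)) \<longlonglongrightarrow> 0"
begin

section \<open>Seminorm calculus and Riesz representation\<close>

definition nrm :: "'v \<Rightarrow> real" where "nrm u = sqrt (B u u)"

lemma mem [simp, intro]: "u \<in> H \<Longrightarrow> v \<in> H \<Longrightarrow> u + v \<in> H" "u \<in> H \<Longrightarrow> c *\<^sub>R u \<in> H"
    "u \<in> H \<Longrightarrow> v \<in> H \<Longrightarrow> u - v \<in> H" "0 \<in> H" "u \<in> H \<Longrightarrow> - u \<in> H"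
  using sub by (auto intro: subspace_add subspace_scale subspace_diff subspace_0 subspace_neg)

lemma add_right: "u \<in> H \<Longrightarrow> v \<in> H \<Longrightarrow> w \<in> H \<Longrightarrow> B w (u + v) = B w u + B w v"
  using add_left[of u v w] sym by auto

lemma scale_right: "u \<in> H \<Longrightarrow> w \<in> H \<Longrightarrow> B w (c *\<^sub>R u) = c * B w u"
  using scale_left[of u w c] sym by auto

lemma minus_left: "u \<in> H \<Longrightarrow> w \<in> H \<Longrightarrow> B (- u) w = - B u w"
  using scale_left[of u w "-1"] by simp

lemma minus_right: "u \<in> H \<Longrightarrow> w \<in> H \<Longrightarrow> B w (- u) = - B w u"
  using scale_right[of u w "-1"] by simp

lemma diff_left: "u \<in> H \<Longrightarrow> v \<in> H \<Longrightarrow> w \<in> H \<Longrightarrow> B (u - v) w = B u w - B v w"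
  using add_left[of u "-v" w] by (simp add: minus_left)

lemma diff_right: "u \<in> H \<Longrightarrow> v \<in> H \<Longrightarrow> w \<in> H \<Longrightarrow> B w (u - v) = B w u - B w v"
  using add_right[of u "-v" w] by (simp add: minus_right)

lemmas bilin = add_left add_right scale_left scale_right diff_left diff_right minus_left minus_right

lemma zero_right [simp]: "w \<in> H \<Longrightarrow> B w 0 = 0"
  using scale_right[of 0 w 0] by simp

lemma nrm_ge_0 [simp]: "u \<in> H \<Longrightarrow> 0 \<le> nrm u" by (simp add: nrm_def pos)

lemma nrm_sq: "u \<in> H \<Longrightarrow> (nrm u)\<^sup>2 = B u u" by (simp add: nrm_def pos)

lemma nrm_scale: "u \<in> H \<Longrightarrow> nrm (c *\<^sub>R u) = \<bar>c\<bar> * nrm u"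
  by (simp add: nrm_def bilin real_sqrt_mult flip: mult.assoc)

lemma nrm_minus: "u \<in> H \<Longrightarrow> nrm (- u) = nrm u"
  using nrm_scale[of u "-1"] by simp

lemma nrm_0 [simp]: "nrm 0 = 0"
  using nrm_scale[of 0 0] by simp

lemma cauchy_schwarz:
  assumes "u \<in> H" "v \<in> H" shows "\<bar>B u v\<bar> \<le> nrm u * nrm v"
proof -
  have t: "0 \<le> B u u + 2 * t * B u v + t\<^sup>2 * B v v" for t
    using pos[of "u + t *\<^sub>R v"] assms sym[of u v] by (simp add: bilin algebra_simps power2_eq_square)
  have "(B u v)\<^sup>2 \<le> B u u * B v v"
  proof (cases "B v v = 0")
    case True
    have "B u v = 0"
    proof (rule ccontr)
      assume "B u v \<noteq> 0"
      \<comment> \<open>For a null vector \<open>v\<close> the quadratic in \<open>t\<close> is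
        affine; at this \<open>t\<close> it would equal -1.\<close>
      thus False using t[of "- (B u u + 1) / (2 * B u v)"] True by (simp add: field_simps)
    qed
    thus ?thesis using True by simp
  next
    case False
    hence "B v v > 0" using pos[of v] assms by simp
    thus ?thesis using t[of "- B u v / B v v"] by (simp add: field_simps power2_eq_square)
  qed
  hence "sqrt ((B u v)\<^sup>2) \<le> sqrt (B u u * B v v)" by (rule real_sqrt_le_mono)
  thus ?thesis by (simp add: nrm_def real_sqrt_mult)
qed

lemma nrm_triangle:
  assumes "u \<in> H" "v \<in> H" shows "nrm (u + v) \<le> nrm u + nrm v"
proof (rule power2_le_imp_le)
  have "(nrm (u + v))\<^sup>2 = (nrm u)\<^sup>2 + 2 * B u v + (nrm v)\<^sup>2"
    using assms sym[of u v] by (simp add: nrm_sq bilin)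
  also have "\<dots> \<le> (nrm u + nrm v)\<^sup>2"
    using cauchy_schwarz[OF assms] by (simp add: power2_sum)
  finally show "(nrm (u + v))\<^sup>2 \<le> (nrm u + nrm v)\<^sup>2" .
qed (use assms in simp)

text \<open>The functional \<open>B v v - 2 * L v\<close> is bounded below, its minimising sequences
  are Cauchy by the parallelogram identity, and the first variation at a limit is the claim. No
  quotient by null vectors and no orthogonal complement is formed.\<close>

lemma riesz:
  assumes L_add: "\<And>u v. u \<in> H \<Longrightarrow> v \<in> H \<Longrightarrow> L (u + v) = L u + L v"
    and L_scale: "\<And>c u. u \<in> H \<Longrightarrow> L (c *\<^sub>R u) = c * L u"
    and L_bd: "\<And>u. u \<in> H \<Longrightarrow> \<bar>L u\<bar> \<le> C * nrm u"
  shows "\<exists>w\<in>H. \<forall>v\<in>H. L v = B w v"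
proof -
  define \<phi> where "\<phi> v = B v v - 2 * L v" for v
  have lb: "- C\<^sup>2 \<le> \<phi> v" if "v \<in> H" for v
  proof -
    have "0 \<le> (nrm v - C)\<^sup>2" by simp
    thus ?thesis using L_bd[OF that] nrm_sq[OF that] unfolding \<phi>_def
      by (simp add: power2_diff abs_le_iff mult.commute)
  qed
  define m where "m = Inf (\<phi> ` H)"
  have ne: "\<phi> ` H \<noteq> {}" using mem(4) by blast
  have bdd: "bdd_below (\<phi> ` H)" using lb by (auto intro!: bdd_belowI)
  have m: "m \<le> \<phi> v" if "v \<in> H" for v unfolding m_def using bdd that by (auto intro: cInf_lower)
  have "\<exists>v\<in>H. \<phi> v < m + 1 / real (Suc n)" for n
  proof -
    have "Inf (\<phi> ` H) < m + 1 / real (Suc n)" by (simp add: m_def)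
    thus ?thesis using cInf_lessD[OF ne] by blast
  qed
  then obtain X where X: "\<And>n. X n \<in> H" "\<And>n. \<phi> (X n) < m + 1 / real (Suc n)" by metis
  have par: "B (x - y) (x - y) \<le> 2 * (\<phi> x - m) + 2 * (\<phi> y - m)" if "x \<in> H" "y \<in> H" for x y
  proof -
    have "4 * \<phi> ((1/2) *\<^sub>R (x + y)) = B (x + y) (x + y) - 4 * L (x + y)"
    proof -
      have z: "x + y \<in> H" using that by simp
      show ?thesis unfolding \<phi>_def scale_left[OF z mem(2)[OF z]] scale_right[OF z z] L_scale[OF z] by simp
    qed
    moreover have "B (x - y) (x - y) = 2 * B x x + 2 * B y y - B (x + y) (x + y)"
      using that by (simp add: bilin)
    moreover have "4 * m \<le> 4 * \<phi> ((1/2) *\<^sub>R (x + y))" using m[of "(1/2) *\<^sub>R (x + y)"] that by simp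
    ultimately show ?thesis using that unfolding \<phi>_def by (simp add: L_add)
  qed
  have "\<exists>w\<in>H. (\<lambda>n. B (X n - w) (X n - w)) \<longlonglongrightarrow> 0"
  proof (rule complete[OF X(1)])
    fix e :: real assume "e > 0"
    hence "e / 4 > 0" by simp
    from reals_Archimedean[OF this] obtain M where "inverse (real (Suc M)) < e / 4" by blast
    hence M: "4 / real (Suc M) < e" by (simp add: field_simps)
    show "\<exists>M. \<forall>m\<ge>M. \<forall>n\<ge>M. B (X m - X n) (X m - X n) < e"
    proof (intro exI allI impI)
      fix i j assume ij: "i \<ge> M" "j \<ge> M"
      define c where "c = 1 / real (Suc M)"
      have "\<phi> (X k) < m + c" if "k \<ge> M" for k
      proof -
        have "1 / real (Suc k) \<le> c" unfolding c_def using that by (auto simp: field_simps)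
        thus ?thesis using X(2)[of k] by (meson add_left_mono less_le_trans)
      qed
      hence "B (X i - X j) (X i - X j) < 4 * c"
        using par[OF X(1) X(1), of i j] ij by (smt (verit))
      thus "B (X i - X j) (X i - X j) < e" using M by (simp add: c_def)
    qed
  qed
  then obtain w where w: "w \<in> H" "(\<lambda>n. B (X n - w) (X n - w)) \<longlonglongrightarrow> 0" by blast
  have "L v = B w v" if v: "v \<in> H" for v
  proof -
    have "(\<lambda>n. nrm (X n - w) * nrm v) \<longlonglongrightarrow> 0"
      using tendsto_mult_right[OF tendsto_real_sqrt[OF w(2)], of "nrm v"] by (simp add: nrm_def)
    hence "(\<lambda>n. B (X n - w) v) \<longlonglongrightarrow> 0"
      by (rule Lim_null_comparison[rotated]) (use cauchy_schwarz X w v in auto)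
    hence lim: "(\<lambda>n. B (X n) v) \<longlonglongrightarrow> B w v"
      using X w v by (simp add: bilin LIM_zero_iff)
    \<comment> \<open>Minimality is used along the sequence:
      \<open>\<phi> (X n + t *\<^sub>R v) \<ge> m\<close> and
      \<open>\<phi> (X n) < m + 1 / (n + 1)\<close>. The limit then involves only
      \<open>B (X n) v\<close>, so \<open>\<phi> w\<close> need not be computed.\<close>
    have q: "0 \<le> 2 * t * (B w v - L v) + t\<^sup>2 * B v v" for t
    proof (rule LIMSEQ_le)
      show "(\<lambda>n. 0 - 1 / real (Suc n)) \<longlonglongrightarrow> 0"
        using tendsto_diff[OF tendsto_const LIMSEQ_inverse_real_of_nat, of 0] by (simp add: divide_inverse)
      show "(\<lambda>n. 2 * t * (B (X n) v - L v) + t\<^sup>2 * B v v) \<longlonglongrightarrow> 2 * t * (B w v - L v) + t\<^sup>2 * B v v"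
        by (intro tendsto_intros lim)
      have "0 - 1 / real (Suc n) \<le> 2 * t * (B (X n) v - L v) + t\<^sup>2 * B v v" for n
      proof -
        have "\<phi> (X n + t *\<^sub>R v) = \<phi> (X n) + 2 * t * (B (X n) v - L v) + t\<^sup>2 * B v v"
          unfolding \<phi>_def using X v sym[of v "X n"] by (simp add: L_add L_scale bilin algebra_simps power2_eq_square)
        moreover have "m \<le> \<phi> (X n + t *\<^sub>R v)" using X v by (intro m) auto
        ultimately show ?thesis using X(2)[of n] by (smt (verit))
      qed
      thus "\<exists>N. \<forall>n\<ge>N. 0 - 1 / real (Suc n) \<le> 2 * t * (B (X n) v - L v) + t\<^sup>2 * B v v" by blast
    qed
    define d where "d = B w v - L v"
    \<comment> \<open>A step length for the variation t = - d k: k times \<open>B v v\<close> is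
      below 2, which makes the quadratic negative unless d = 0. The summand 1 covers null vectors
      \<open>v\<close>.\<close>
    define k where "k = 1 / (1 + B v v)"
    have k: "k > 0" "k * B v v \<le> 1" using pos[OF v] by (simp_all add: k_def field_simps)
    have "0 \<le> d * d * (k * (k * B v v - 2))"
      using q[of "- d * k"] unfolding d_def[symmetric] by (simp add: algebra_simps power2_eq_square)
    moreover have "k * (k * B v v - 2) < 0" using k by (intro mult_pos_neg) auto
    ultimately have "d * d \<le> 0" by (metis mult_pos_neg not_le)
    hence "d = 0" by (auto simp: mult_le_0_iff)
    thus ?thesis by (simp add: d_def)
  qed
  thus ?thesis using w by blast
qed

section \<open>Curves continuous for the seminorm\<close>

definition path_cont :: "(real \<Rightarrow> 'v) \<Rightarrow> bool" where
  "path_cont \<gamma> \<longleftrightarrow> (\<forall>t. \<gamma> t \<in> H) \<and> (\<forall>t. ((\<lambda>t'. nrm (\<gamma> t' - \<gamma> t)) \<longlongrightarrow> 0) (at t))"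

lemma path_cont_inner:
  assumes "path_cont \<gamma>" "path_cont \<eta>"
  shows "continuous_on UNIV (\<lambda>t. B (\<gamma> t) (\<eta> t))"
  unfolding continuous_on_def
proof safe
  fix t :: real
  have H: "\<gamma> t \<in> H" "\<eta> t \<in> H" for t using assms by (auto simp: path_cont_def)
  define a where "a = (\<lambda>t'. nrm (\<gamma> t' - \<gamma> t))"
  define b where "b = (\<lambda>t'. nrm (\<eta> t' - \<eta> t))"
  have lim: "(a \<longlongrightarrow> 0) (at t)" "(b \<longlongrightarrow> 0) (at t)" using assms by (auto simp: path_cont_def a_def b_def)
  have L: "((\<lambda>t'. a t' * (b t' + nrm (\<eta> t)) + nrm (\<gamma> t) * b t') \<longlongrightarrow> 0 * (0 + nrm (\<eta> t)) + nrm (\<gamma> t) * 0) (at t)"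
    by (intro tendsto_intros lim)
  have "((\<lambda>t'. B (\<gamma> t') (\<eta> t') - B (\<gamma> t) (\<eta> t)) \<longlongrightarrow> 0) (at t)"
  proof (rule Lim_null_comparison)
    have "\<bar>B (\<gamma> t') (\<eta> t') - B (\<gamma> t) (\<eta> t)\<bar> \<le> a t' * (b t' + nrm (\<eta> t)) + nrm (\<gamma> t) * b t'" for t'
    proof -
      have "B (\<gamma> t') (\<eta> t') - B (\<gamma> t) (\<eta> t) = B (\<gamma> t' - \<gamma> t) ((\<eta> t' - \<eta> t) + \<eta> t) + B (\<gamma> t) (\<eta> t' - \<eta> t)"
        using H by (simp add: bilin)
      moreover have "\<bar>B (\<gamma> t' - \<gamma> t) ((\<eta> t' - \<eta> t) + \<eta> t)\<bar> \<le> a t' * nrm ((\<eta> t' - \<eta> t) + \<eta> t)"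
        unfolding a_def using H by (intro cauchy_schwarz) auto
      moreover have "a t' * nrm ((\<eta> t' - \<eta> t) + \<eta> t) \<le> a t' * (b t' + nrm (\<eta> t))"
        unfolding a_def b_def using H by (intro mult_left_mono nrm_triangle) auto
      moreover have "\<bar>B (\<gamma> t) (\<eta> t' - \<eta> t)\<bar> \<le> nrm (\<gamma> t) * b t'"
        unfolding b_def using H by (intro cauchy_schwarz) auto
      ultimately show ?thesis by linarith
    qed
    thus "\<forall>\<^sub>F t' in at t. norm (B (\<gamma> t') (\<eta> t') - B (\<gamma> t) (\<eta> t)) \<le> a t' * (b t' + nrm (\<eta> t)) + nrm (\<gamma> t) * b t'"
      by simp
  qed (use L in simp)
  thus "((\<lambda>t. B (\<gamma> t) (\<eta> t)) \<longlongrightarrow> B (\<gamma> t) (\<eta> t)) (at t)" by (simp add: LIM_zero_iff)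
qed

lemma path_cont_nrm: "path_cont \<gamma> \<Longrightarrow> continuous_on UNIV (\<lambda>t. nrm (\<gamma> t))"
  unfolding nrm_def by (intro continuous_on_real_sqrt path_cont_inner)

lemma path_cont_add:
  assumes "path_cont \<gamma>" "path_cont \<eta>" shows "path_cont (\<lambda>t. \<gamma> t + \<eta> t)"
  unfolding path_cont_def
proof safe
  have H: "\<gamma> t \<in> H" "\<eta> t \<in> H" for t using assms by (auto simp: path_cont_def)
  thus "\<gamma> t + \<eta> t \<in> H" for t by simp
  fix t
  have L: "((\<lambda>t'. nrm (\<gamma> t' - \<gamma> t) + nrm (\<eta> t' - \<eta> t)) \<longlongrightarrow> 0 + 0) (at t)"
    using assms by (intro tendsto_add) (auto simp: path_cont_def)
  show "((\<lambda>t'. nrm (\<gamma> t' + \<eta> t' - (\<gamma> t + \<eta> t))) \<longlongrightarrow> 0) (at t)"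
  proof (rule Lim_null_comparison)
    have "nrm (\<gamma> t' + \<eta> t' - (\<gamma> t + \<eta> t)) \<le> nrm (\<gamma> t' - \<gamma> t) + nrm (\<eta> t' - \<eta> t)" for t'
      using nrm_triangle[of "\<gamma> t' - \<gamma> t" "\<eta> t' - \<eta> t"] H by (simp add: algebra_simps)
    thus "\<forall>\<^sub>F t' in at t. norm (nrm (\<gamma> t' + \<eta> t' - (\<gamma> t + \<eta> t))) \<le> nrm (\<gamma> t' - \<gamma> t) + nrm (\<eta> t' - \<eta> t)"
      using H by simp
  qed (use L in simp)
qed

lemma path_cont_scale:
  assumes "path_cont \<gamma>" "continuous_on UNIV \<phi>" shows "path_cont (\<lambda>t. \<phi> t *\<^sub>R \<gamma> t)"
  unfolding path_cont_def
proof safe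
  have H: "\<gamma> t \<in> H" for t using assms by (auto simp: path_cont_def)
  thus "\<phi> t *\<^sub>R \<gamma> t \<in> H" for t by simp
  fix t
  have "(\<phi> \<longlongrightarrow> \<phi> t) (at t)" using assms(2) by (auto simp: continuous_on_def)
  hence L: "((\<lambda>t'. \<bar>\<phi> t'\<bar> * nrm (\<gamma> t' - \<gamma> t) + \<bar>\<phi> t' - \<phi> t\<bar> * nrm (\<gamma> t)) \<longlongrightarrow> \<bar>\<phi> t\<bar> * 0 + \<bar>\<phi> t - \<phi> t\<bar> * nrm (\<gamma> t)) (at t)"
    using assms(1) by (intro tendsto_intros) (auto simp: path_cont_def)
  show "((\<lambda>t'. nrm (\<phi> t' *\<^sub>R \<gamma> t' - \<phi> t *\<^sub>R \<gamma> t)) \<longlongrightarrow> 0) (at t)"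
  proof (rule Lim_null_comparison)
    have "nrm (\<phi> t' *\<^sub>R \<gamma> t' - \<phi> t *\<^sub>R \<gamma> t) \<le> \<bar>\<phi> t'\<bar> * nrm (\<gamma> t' - \<gamma> t) + \<bar>\<phi> t' - \<phi> t\<bar> * nrm (\<gamma> t)" for t'
    proof -
      have "\<phi> t' *\<^sub>R \<gamma> t' - \<phi> t *\<^sub>R \<gamma> t = \<phi> t' *\<^sub>R (\<gamma> t' - \<gamma> t) + (\<phi> t' - \<phi> t) *\<^sub>R \<gamma> t"
        by (simp add: algebra_simps)
      thus ?thesis using nrm_triangle[of "\<phi> t' *\<^sub>R (\<gamma> t' - \<gamma> t)" "(\<phi> t' - \<phi> t) *\<^sub>R \<gamma> t"] H
        by (simp add: nrm_scale)
    qed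
    thus "\<forall>\<^sub>F t' in at t. norm (nrm (\<phi> t' *\<^sub>R \<gamma> t' - \<phi> t *\<^sub>R \<gamma> t)) \<le> \<bar>\<phi> t'\<bar> * nrm (\<gamma> t' - \<gamma> t) + \<bar>\<phi> t' - \<phi> t\<bar> * nrm (\<gamma> t)"
      using H by simp
  qed (use L in simp)
qed

text \<open>Otherwise finitely many explicit Euler steps along \<open>W u + \<langle>W u, u\<rangle> u\<close>, cut off below the level \<open>a / 2\<close>,
  would push the segment from \<open>0\<close> to \<open>e\<close> below the level \<open>a\<close>. The total displacement is at most
  exponential in the elapsed time, so the uniform differentiability on one fixed ball suffices.\<close>

theorem mountain_pass:
  fixes J :: "'v \<Rightarrow> real" and W :: "'v \<Rightarrow> 'v"
  assumes WH: "\<And>u. u \<in> H \<Longrightarrow> W u \<in> H"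
    and diff: "\<And>R \<epsilon>. \<epsilon> > 0 \<Longrightarrow> \<exists>\<tau>>0. \<forall>u\<in>H. \<forall>v\<in>H. nrm u \<le> R \<longrightarrow> nrm v \<le> \<tau> \<longrightarrow>
        \<bar>J (u + v) - J u - B (W u) v\<bar> \<le> \<epsilon> * nrm v"
    and Wcont: "\<And>u \<epsilon>. u \<in> H \<Longrightarrow> \<epsilon> > 0 \<Longrightarrow> \<exists>\<tau>>0. \<forall>v\<in>H. nrm v \<le> \<tau> \<longrightarrow> nrm (W (u + v) - W u) \<le> \<epsilon>"
    and J0: "J 0 = 0" and e: "e \<in> H" "J e \<le> 0" "nrm e > r" and r: "r > 0"
    and a: "a > 0" "\<And>u. u \<in> H \<Longrightarrow> nrm u = r \<Longrightarrow> a \<le> J u"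
    and b: "\<And>t. 0 \<le> t \<Longrightarrow> t \<le> 1 \<Longrightarrow> J (t *\<^sub>R e) \<le> b" and \<delta>: "\<delta> > 0"
  shows "\<exists>u\<in>H. a / 2 \<le> J u \<and> J u \<le> b \<and> nrm (W u) < \<delta> \<and> \<bar>B (W u) u\<bar> < \<delta>"
proof (rule ccontr)
  assume neg: "\<not> ?thesis"
  \<comment> \<open>The derivative of \<open>J\<close> along
    \<open>W u + B (W u) u *\<^sub>R u\<close>. The radial term makes it register
    \<open>B (W u) u\<close> as well as \<open>W u\<close>: under \<open>neg\<close> one of the two
    is at least \<delta> in the strip between the levels \<open>a / 2\<close> and
    \<open>b\<close>.\<close>
  define Q where "Q u = (nrm (W u))\<^sup>2 + (B (W u) u)\<^sup>2" for u
  have Q: "Q u \<ge> \<delta>\<^sup>2" if "u \<in> H" "a / 2 \<le> J u" "J u \<le> b" for u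
  proof -
    have "nrm (W u) \<ge> \<delta> \<or> \<bar>B (W u) u\<bar> \<ge> \<delta>" using neg that by force
    thus ?thesis
    proof
      assume "nrm (W u) \<ge> \<delta>"
      hence "\<delta>\<^sup>2 \<le> (nrm (W u))\<^sup>2" using \<delta> by (intro power_mono) auto
      thus ?thesis unfolding Q_def by (simp add: add_increasing2)
    next
      assume "\<bar>B (W u) u\<bar> \<ge> \<delta>"
      hence "\<delta>\<^sup>2 \<le> \<bar>B (W u) u\<bar>\<^sup>2" using \<delta> by (intro power_mono) auto
      thus ?thesis unfolding Q_def by (simp add: add_increasing)
    qed
  qed
  have b_pos: "b > 0"
  proof -
    have "nrm ((r / nrm e) *\<^sub>R e) = r" using e r by (simp add: nrm_scale)
    hence "a \<le> J ((r / nrm e) *\<^sub>R e)" using a(2) e by auto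
    also have "\<dots> \<le> b" using e r by (intro b) auto
    finally show ?thesis using a by simp
  qed
  \<comment> \<open>The cutoff vanishes below \<open>a / 2\<close>, so the end points 0 and
    \<open>e\<close> stay fixed; it is 1 above \<open>3a / 4\<close>, so the path can be pushed down
    to that level, still below \<open>a\<close>.\<close>
  define \<kappa> where "\<kappa> u = max 0 (min 1 ((J u - a / 2) / (a / 4)))" for u
  have chi: "0 \<le> \<kappa> u" "\<kappa> u \<le> 1" for u by (auto simp: \<kappa>_def)
  have chi0: "\<kappa> u = 0" if "J u \<le> a / 2" for u 
  proof -
    have "(J u - a / 2) / (a / 4) \<le> 0" using that a by (intro divide_nonpos_pos) auto
    thus ?thesis unfolding \<kappa>_def by simp
  qed
  have chi1: "\<kappa> u = 1" if "J u \<ge> 3 * a / 4" for u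
  proof -
    have "1 \<le> (J u - a / 2) / (a / 4)" using that a by (simp add: field_simps)
    thus ?thesis unfolding \<kappa>_def by simp
  qed
  \<comment> \<open>Dividing by \<open>Q\<close> normalises the decrease of \<open>J\<close> to
    \<open>\<kappa> u\<close>. The maximum with \<delta>^2 changes nothing where the cutoff is
    positive and \<open>J u \<le> b\<close>, and keeps the field defined and continuous
    elsewhere.\<close>
  define g where "g u = (\<kappa> u / max (Q u) (\<delta>\<^sup>2)) *\<^sub>R (W u + B (W u) u *\<^sub>R u)" for u
  have gH [simp]: "g u \<in> H" if "u \<in> H" for u using that WH unfolding g_def by simp
  have Bg: "B (W u) (g u) = \<kappa> u" if u: "u \<in> H" "J u \<le> b" for u
  proof (cases "J u \<le> a / 2")
    case True
    thus ?thesis using u WH chi0[OF True] unfolding g_def by (simp add: bilin)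
  next
    case False
    hence "Q u \<ge> \<delta>\<^sup>2" using Q u by simp
    moreover have "\<delta>\<^sup>2 > 0" using \<delta> by simp
    ultimately have "Q u > 0" by linarith
    moreover have "max (Q u) (\<delta>\<^sup>2) = Q u" using \<open>\<delta>\<^sup>2 \<le> Q u\<close> by simp
    moreover have "B (W u) (W u + B (W u) u *\<^sub>R u) = Q u"
      unfolding Q_def using u WH by (simp add: bilin nrm_sq) (simp add: power2_eq_square)
    ultimately show ?thesis unfolding g_def using u WH by (simp add: scale_right)
  qed
  \<comment> \<open>Both \<open>nrm (W u)\<close> and \<open>|B (W u) u|\<close> are at most
    \<open>sqrt (Q u)\<close>, so after the division the field grows at most linearly in
    \<open>nrm u\<close>.\<close>
  have ng: "nrm (g u) \<le> \<kappa> u * (1 + nrm u) / \<delta>" if u: "u \<in> H" for u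
  proof -
    define k where "k = sqrt (Q u)"
    have Q0: "Q u \<ge> 0" unfolding Q_def by simp
    have k: "k \<ge> 0" "Q u = k\<^sup>2" using Q0 by (auto simp: k_def)
    have "nrm (W u) \<le> k" unfolding k_def Q_def by (rule real_le_rsqrt) simp
    moreover have "\<bar>B (W u) u\<bar> \<le> k" unfolding k_def Q_def by (rule real_le_rsqrt) simp
    moreover have "nrm (W u + B (W u) u *\<^sub>R u) \<le> nrm (W u) + \<bar>B (W u) u\<bar> * nrm u"
      using nrm_triangle[of "W u" "B (W u) u *\<^sub>R u"] u WH by (simp add: nrm_scale)
    moreover have "\<bar>B (W u) u\<bar> * nrm u \<le> k * nrm u" using calculation(2) u by (intro mult_right_mono) auto
    ultimately have n: "nrm (W u + B (W u) u *\<^sub>R u) \<le> k * (1 + nrm u)" by (simp add: algebra_simps)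
    have "k * \<delta> \<le> max (Q u) (\<delta>\<^sup>2)"
    proof (cases "k \<le> \<delta>")
      case True
      hence "k * \<delta> \<le> \<delta>\<^sup>2" using \<delta> by (simp add: power2_eq_square)
      thus ?thesis by simp
    next
      case False
      hence "k * \<delta> \<le> k\<^sup>2" using k by (simp add: power2_eq_square mult_left_mono)
      thus ?thesis using k by simp
    qed
    moreover have M: "max (Q u) (\<delta>\<^sup>2) > 0" using \<delta> by (simp add: less_max_iff_disj)
    ultimately have kM: "k / max (Q u) (\<delta>\<^sup>2) \<le> 1 / \<delta>" using \<delta> by (simp add: field_simps)
    have "nrm (g u) = \<kappa> u / max (Q u) (\<delta>\<^sup>2) * nrm (W u + B (W u) u *\<^sub>R u)"
      unfolding g_def using u WH chi[of u] M by (simp add: nrm_scale abs_mult)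
    also have "\<dots> \<le> \<kappa> u / max (Q u) (\<delta>\<^sup>2) * (k * (1 + nrm u))"
      using n chi M by (intro mult_left_mono) auto
    also have "\<dots> = \<kappa> u * (1 + nrm u) * (k / max (Q u) (\<delta>\<^sup>2))" by simp
    also have "\<dots> \<le> \<kappa> u * (1 + nrm u) * (1 / \<delta>)"
      using kM chi[of u] u by (intro mult_left_mono) auto
    finally show ?thesis by simp
  qed
  \<comment> \<open>Each step multiplies \<open>1 + nrm\<close> by at most
    \<open>1 + \<sigma> / \<delta>\<close>, and the n steps have total time
    \<open>n * \<sigma> = 2 * b\<close>; the exponential of \<open>2 * b / \<delta>\<close> bounds
    the product for every n. Hence \<open>R\<close>, and with it \<tau>, can be fixed before
    n.\<close>
  define R where "R = exp (2 * b / \<delta>) * (1 + nrm e)"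
  have R: "R \<ge> 0" unfolding R_def using e by simp
  have "\<delta> / (2 * (1 + R)) > 0" using \<delta> R by simp
  then obtain \<tau> where \<tau>: "\<tau> > 0" and tau: "\<And>u v. u \<in> H \<Longrightarrow> v \<in> H \<Longrightarrow> nrm u \<le> R \<Longrightarrow> nrm v \<le> \<tau> \<Longrightarrow>
        \<bar>J (u + v) - J u - B (W u) v\<bar> \<le> \<delta> / (2 * (1 + R)) * nrm v" using diff by metis
  obtain n0 :: nat where n0: "2 * b * (1 + R) / \<delta> / \<tau> \<le> real n0" using real_arch_simple by blast
  define n where "n = Suc n0"
  \<comment> \<open>The tolerance in \<open>tau\<close> spends half of the first-order decrease
    \<open>\<sigma> * \<kappa> u\<close>, so a step at full cutoff gains
    \<open>\<sigma> / 2\<close>; n of them add up to \<open>b\<close>. Taking n large makes each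
    step shorter than \<tau>.\<close>
  define \<sigma> where "\<sigma> = 2 * b / real n"
  have n: "real n > 0" by (simp add: n_def)
  have sig: "\<sigma> > 0" using b_pos n by (simp add: \<sigma>_def)
  have small: "\<sigma> * (1 + R) / \<delta> \<le> \<tau>"
  proof -
    have "2 * b * (1 + R) / \<delta> / \<tau> \<le> real n" using n0 by (simp add: n_def)
    thus ?thesis using n \<tau> \<delta> unfolding \<sigma>_def by (simp add: field_simps)
  qed
  define \<Phi> where "\<Phi> u = u + (- \<sigma>) *\<^sub>R g u" for u
  have PhiH [simp]: "\<Phi> u \<in> H" if "u \<in> H" for u using that unfolding \<Phi>_def by simp
  have step: "J (\<Phi> u) \<le> J u - \<sigma> * \<kappa> u / 2" if u: "u \<in> H" "nrm u \<le> R" "J u \<le> b" for u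
  proof -
    let ?v = "(- \<sigma>) *\<^sub>R g u"
    have "\<kappa> u * (1 + nrm u) / \<delta> \<le> \<kappa> u * (1 + R) / \<delta>"
      using u chi[of u] \<delta> by (intro divide_right_mono mult_left_mono) auto
    with ng[OF u(1)] have ng': "nrm (g u) \<le> \<kappa> u * (1 + R) / \<delta>" by simp
    have nv: "nrm ?v = \<sigma> * nrm (g u)" using u sig by (simp add: nrm_scale del: scaleR_minus_left)
    have nv': "nrm ?v \<le> \<sigma> * (\<kappa> u * (1 + R) / \<delta>)" unfolding nv using ng' sig by (intro mult_left_mono) auto
    also have "\<dots> = \<kappa> u * (\<sigma> * (1 + R) / \<delta>)" by simp
    also have "\<dots> \<le> 1 * \<tau>" using chi[of u] small sig R \<delta> by (intro mult_mono) auto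
    finally have "nrm ?v \<le> \<tau>" by simp
    hence "\<bar>J (\<Phi> u) - J u - B (W u) ?v\<bar> \<le> \<delta> / (2 * (1 + R)) * nrm ?v"
      unfolding \<Phi>_def using u by (intro tau) auto
    also have "\<dots> \<le> \<delta> / (2 * (1 + R)) * (\<sigma> * (\<kappa> u * (1 + R) / \<delta>))"
      using nv' \<delta> R by (intro mult_left_mono) auto
    also have "\<dots> = \<sigma> * \<kappa> u / 2"
    proof -
      obtain K where K: "K = 1 + R" "K > 0" using R by simp
      show ?thesis unfolding K(1)[symmetric] using \<delta> K(2) by (simp add: field_simps)
    qed
    finally have "\<bar>J (\<Phi> u) - J u - B (W u) ?v\<bar> \<le> \<sigma> * \<kappa> u / 2" .
    moreover have "B (W u) ?v = - \<sigma> * \<kappa> u" using u WH Bg[of u] by (simp add: scale_right del: scaleR_minus_left)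
    ultimately have "\<bar>J (\<Phi> u) - J u + \<sigma> * \<kappa> u\<bar> \<le> \<sigma> * \<kappa> u / 2" by simp
    thus ?thesis by linarith
  qed
  define \<gamma> where "\<gamma> k t = (\<Phi> ^^ k) (t *\<^sub>R e)" for k and t :: real
  have \<gamma>_Suc: "\<gamma> (Suc k) t = \<Phi> (\<gamma> k t)" for k t by (simp add: \<gamma>_def)
  have \<gamma>H: "\<gamma> k t \<in> H" for k t by (induction k) (auto simp: \<gamma>_def e)
  \<comment> \<open>The three bounds need each other: the norm bound keeps the point in the ball
    where \<open>step\<close> applies, and \<open>step\<close> keeps the energy at most
    \<open>b\<close>, as its own premise requires.\<close>
  have inv: "1 + nrm (\<gamma> k t) \<le> (1 + \<sigma> / \<delta>) ^ k * (1 + nrm e) \<and> J (\<gamma> k t) \<le> max (3 * a / 4) (b - real k * \<sigma> / 2) \<and> J (\<gamma> k t) \<le> b"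
    if t: "0 \<le> t" "t \<le> 1" and k: "k \<le> n" for k t
    using k
  proof (induction k)
    case 0
    have "nrm (t *\<^sub>R e) \<le> 1 * nrm e" using t e by (simp only: nrm_scale) (intro mult_right_mono, auto)
    thus ?case using b[OF t] by (simp add: \<gamma>_def le_max_iff_disj)
  next
    case (Suc k)
    let ?u = "\<gamma> k t"
    from Suc have IH: "1 + nrm ?u \<le> (1 + \<sigma> / \<delta>) ^ k * (1 + nrm e)" "J ?u \<le> max (3 * a / 4) (b - real k * \<sigma> / 2)" "J ?u \<le> b" by auto
    have "(1 + \<sigma> / \<delta>) ^ k \<le> exp (\<sigma> / \<delta>) ^ k" using sig \<delta> by (intro power_mono exp_ge_add_one_self) auto
    also have "\<dots> = exp (real k * (\<sigma> / \<delta>))" by (rule exp_of_nat_mult[symmetric])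
    also have "\<dots> \<le> exp (2 * b / \<delta>)"
    proof -
      have "real k * \<sigma> \<le> real n * \<sigma>" using Suc.prems sig by (intro mult_right_mono) auto
      also have "\<dots> = 2 * b" using n by (simp add: \<sigma>_def)
      finally show ?thesis using \<delta> by (simp add: divide_right_mono)
    qed
    finally have "(1 + \<sigma> / \<delta>) ^ k * (1 + nrm e) \<le> R" unfolding R_def using e by (intro mult_right_mono) auto
    hence uR: "nrm ?u \<le> R" using IH(1) by simp
    have st: "J (\<Phi> ?u) \<le> J ?u - \<sigma> * \<kappa> ?u / 2" using step[OF \<gamma>H uR IH(3)] .
    have le: "J (\<Phi> ?u) \<le> J ?u" using st chi[of ?u] sig by (smt (verit) divide_nonneg_nonneg mult_nonneg_nonneg)
    have dec: "J (\<Phi> ?u) \<le> max (3 * a / 4) (b - real (Suc k) * \<sigma> / 2)"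
    proof (cases "J ?u \<ge> 3 * a / 4")
      case True
      hence "J (\<Phi> ?u) \<le> J ?u - \<sigma> / 2" using st chi1 by simp
      thus ?thesis using IH(2) sig by (auto simp: max_def algebra_simps add_divide_distrib split: if_splits)
    next
      case False
      thus ?thesis using le by simp
    qed
    have "nrm (\<Phi> ?u) \<le> nrm ?u + \<sigma> * nrm (g ?u)"
      unfolding \<Phi>_def using nrm_triangle[of ?u "(- \<sigma>) *\<^sub>R g ?u"] \<gamma>H[of k t] sig
      by (simp add: nrm_scale del: scaleR_minus_left)
    also have "\<sigma> * nrm (g ?u) \<le> \<sigma> * ((1 + nrm ?u) / \<delta>)"
    proof (rule mult_left_mono)
      have "\<kappa> ?u * (1 + nrm ?u) / \<delta> \<le> 1 * (1 + nrm ?u) / \<delta>"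
        using chi[of ?u] \<delta> \<gamma>H[of k t] by (intro divide_right_mono mult_right_mono) auto
      thus "nrm (g ?u) \<le> (1 + nrm ?u) / \<delta>" using ng[OF \<gamma>H[of k t]] by simp
    qed (use sig in simp)
    finally have "1 + nrm (\<Phi> ?u) \<le> (1 + \<sigma> / \<delta>) * (1 + nrm ?u)" by (simp add: algebra_simps add_divide_distrib)
    also have "\<dots> \<le> (1 + \<sigma> / \<delta>) * ((1 + \<sigma> / \<delta>) ^ k * (1 + nrm e))"
      using IH(1) sig \<delta> by (intro mult_left_mono) auto
    finally show ?case unfolding \<gamma>_Suc using dec le IH(3) by (simp add: mult.assoc)
  qed
  have pcW: "path_cont (\<lambda>t. W (\<eta> t))" if \<eta>: "path_cont \<eta>" for \<eta>
    unfolding path_cont_def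
  proof safe
    have H: "\<eta> t \<in> H" for t using \<eta> by (auto simp: path_cont_def)
    thus "W (\<eta> t) \<in> H" for t using WH by simp
    fix t
    show "((\<lambda>t'. nrm (W (\<eta> t') - W (\<eta> t))) \<longlongrightarrow> 0) (at t)"
    proof (rule tendstoI)
      fix \<epsilon> :: real assume \<epsilon>: "\<epsilon> > 0"
      obtain \<tau> where \<tau>: "\<tau> > 0" "\<And>v. v \<in> H \<Longrightarrow> nrm v \<le> \<tau> \<Longrightarrow> nrm (W (\<eta> t + v) - W (\<eta> t)) \<le> \<epsilon> / 2"
        using Wcont[OF H, of "\<epsilon> / 2" t] \<epsilon> by auto
      have "((\<lambda>t'. nrm (\<eta> t' - \<eta> t)) \<longlongrightarrow> 0) (at t)" using \<eta> by (auto simp: path_cont_def)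
      hence "\<forall>\<^sub>F t' in at t. nrm (\<eta> t' - \<eta> t) < \<tau>" using \<tau>(1) by (rule order_tendstoD)
      thus "\<forall>\<^sub>F t' in at t. dist (nrm (W (\<eta> t') - W (\<eta> t))) 0 < \<epsilon>"
      proof eventually_elim
        case (elim t')
        have "nrm (W (\<eta> t + (\<eta> t' - \<eta> t)) - W (\<eta> t)) \<le> \<epsilon> / 2" using elim H by (intro \<tau>) auto
        thus ?case using \<epsilon> H WH by simp
      qed
    qed
  qed
  have pcJ: "continuous_on UNIV (\<lambda>t. J (\<eta> t))" if \<eta>: "path_cont \<eta>" for \<eta>
    unfolding continuous_on_def
  proof safe
    fix t
    have H: "\<eta> t \<in> H" for t using \<eta> by (auto simp: path_cont_def)
    obtain \<tau> where \<tau>: "\<tau> > 0" "\<And>v. v \<in> H \<Longrightarrow> nrm v \<le> \<tau> \<Longrightarrow> \<bar>J (\<eta> t + v) - J (\<eta> t) - B (W (\<eta> t)) v\<bar> \<le> 1 * nrm v"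
      using diff[of 1 "nrm (\<eta> t)"] H by fastforce
    have lim: "((\<lambda>t'. nrm (\<eta> t' - \<eta> t)) \<longlongrightarrow> 0) (at t)" using \<eta> by (auto simp: path_cont_def)
    hence ev: "\<forall>\<^sub>F t' in at t. nrm (\<eta> t' - \<eta> t) < \<tau>" using \<tau>(1) by (rule order_tendstoD)
    have "((\<lambda>t'. J (\<eta> t') - J (\<eta> t)) \<longlongrightarrow> 0) (at t)"
    proof (rule Lim_null_comparison)
      show "\<forall>\<^sub>F t' in at t. norm (J (\<eta> t') - J (\<eta> t)) \<le> (1 + nrm (W (\<eta> t))) * nrm (\<eta> t' - \<eta> t)"
        using ev
      proof eventually_elim
        case (elim t')
        have "\<bar>J (\<eta> t + (\<eta> t' - \<eta> t)) - J (\<eta> t) - B (W (\<eta> t)) (\<eta> t' - \<eta> t)\<bar> \<le> 1 * nrm (\<eta> t' - \<eta> t)"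
          using elim H by (intro \<tau>) auto
        moreover have "\<bar>B (W (\<eta> t)) (\<eta> t' - \<eta> t)\<bar> \<le> nrm (W (\<eta> t)) * nrm (\<eta> t' - \<eta> t)"
          using H WH by (intro cauchy_schwarz) auto
        ultimately show ?case by (simp add: algebra_simps abs_le_iff)
      qed
      show "((\<lambda>t'. (1 + nrm (W (\<eta> t))) * nrm (\<eta> t' - \<eta> t)) \<longlongrightarrow> 0) (at t)"
        using tendsto_mult_left[OF lim, of "1 + nrm (W (\<eta> t))"] by simp
    qed
    thus "((\<lambda>t. J (\<eta> t)) \<longlongrightarrow> J (\<eta> t)) (at t)" by (simp add: LIM_zero_iff)
  qed
  have pc_step: "path_cont (\<lambda>t. \<Phi> (\<eta> t))" if \<eta>: "path_cont \<eta>" for \<eta>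
  proof -
    have M: "max (Q u) (\<delta>\<^sup>2) \<noteq> 0" for u
      using \<delta> by (metis less_max_iff_disj less_irrefl zero_less_power)
    have cQ: "continuous_on UNIV (\<lambda>t. Q (\<eta> t))"
      unfolding Q_def by (intro continuous_intros path_cont_nrm path_cont_inner pcW \<eta>)
    have cchi: "continuous_on UNIV (\<lambda>t. \<kappa> (\<eta> t))"
      unfolding \<kappa>_def using a by (intro continuous_intros pcJ \<eta>) auto
    show ?thesis unfolding \<Phi>_def g_def
      by (intro path_cont_add path_cont_scale \<eta> pcW path_cont_inner continuous_intros cQ cchi M ballI)
  qed
  have pc: "path_cont (\<gamma> k)" for k
  proof (induction k)
    case 0
    have "path_cont (\<lambda>t. e)" using e by (simp add: path_cont_def)
    hence "path_cont (\<lambda>t. t *\<^sub>R e)" by (intro path_cont_scale continuous_intros)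
    thus ?case by (simp add: \<gamma>_def[abs_def])
  next
    case (Suc k)
    thus ?case using pc_step[of "\<gamma> k"] by (simp add: \<gamma>_Suc[abs_def])
  qed
  have fix0: "\<gamma> k 0 = 0" for k
  proof (induction k)
    case (Suc k)
    have "\<kappa> 0 = 0" using a J0 by (intro chi0) auto
    thus ?case using Suc by (simp add: \<gamma>_Suc \<Phi>_def g_def)
  qed (simp add: \<gamma>_def)
  have fix1: "\<gamma> k 1 = e" for k
  proof (induction k)
    case (Suc k)
    have "\<kappa> e = 0" using a e by (intro chi0) auto
    thus ?case using Suc by (simp add: \<gamma>_Suc \<Phi>_def g_def)
  qed (simp add: \<gamma>_def)
  \<comment> \<open>The end points have not moved, so the deformed path still crosses the sphere of
    radius \<open>r\<close>, where \<open>J \<ge> a\<close>, although all its energies are at most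
    \<open>3a / 4\<close>.\<close>
  have "\<exists>t. 0 \<le> t \<and> t \<le> 1 \<and> nrm (\<gamma> n t) = r"
    by (rule IVT') (use fix0 fix1 e r path_cont_nrm[OF pc] in \<open>auto intro: continuous_on_subset\<close>)
  then obtain t where t: "0 \<le> t" "t \<le> 1" "nrm (\<gamma> n t) = r" by blast
  have z: "b - real n * \<sigma> / 2 = 0" using n by (simp add: \<sigma>_def)
  have "J (\<gamma> n t) \<le> max (3 * a / 4) 0" using inv[OF t(1,2), of n] unfolding z by simp
  hence "J (\<gamma> n t) \<le> 3 * a / 4" using a by simp
  moreover have "a \<le> J (\<gamma> n t)" using a(2)[OF \<gamma>H t(3)] .
  ultimately show False using a by simp
qed

end

text \<open>Makes real-valued functions vectors, with pointwise operations, so that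
  \<open>Hs s\<close> can serve as the set \<open>H\<close> of the abstract setting.\<close>

instantiation "fun" :: (type, real_vector) real_vector
begin

definition scaleR_fun :: "real \<Rightarrow> ('a \<Rightarrow> 'b) \<Rightarrow> 'a \<Rightarrow> 'b" where
  "scaleR_fun c u = (\<lambda>x. c *\<^sub>R u x)"

instance
  by standard (auto simp: scaleR_fun_def fun_eq_iff scaleR_add_right scaleR_add_left)

end

lemma scaleR_fun_apply [simp]: "(c *\<^sub>R u) x = c *\<^sub>R u x"
  by (simp add: scaleR_fun_def)

subsection \<open>Convergence of integrals from almost everywhere convergence\<close>

lemma integrable_mult_square:
  fixes f g :: "'b \<Rightarrow> real"
  assumes [measurable]: "f \<in> borel_measurable M" "g \<in> borel_measurable M"
    and "integrable M (\<lambda>x. (f x)\<^sup>2)" "integrable M (\<lambda>x. (g x)\<^sup>2)"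
  shows "integrable M (\<lambda>x. f x * g x)"
proof (rule Bochner_Integration.integrable_bound)
  show "integrable M (\<lambda>x. (f x)\<^sup>2 + (g x)\<^sup>2)" using assms by simp
  have "\<bar>f x * g x\<bar> \<le> (f x)\<^sup>2 + (g x)\<^sup>2" for x
  proof -
    have "2 * \<bar>f x\<bar> * \<bar>g x\<bar> \<le> \<bar>f x\<bar>\<^sup>2 + \<bar>g x\<bar>\<^sup>2" by (rule sum_squares_bound)
    moreover have "0 \<le> \<bar>f x\<bar> * \<bar>g x\<bar>" by simp
    ultimately have "\<bar>f x\<bar> * \<bar>g x\<bar> \<le> (f x)\<^sup>2 + (g x)\<^sup>2" by (simp only: power2_abs)
    thus ?thesis by (simp add: abs_mult)
  qed
  thus "AE x in M. norm (f x * g x) \<le> norm ((f x)\<^sup>2 + (g x)\<^sup>2)" by simp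
qed simp

lemma integrable_square_add:
  fixes f g :: "'b \<Rightarrow> real"
  assumes [measurable]: "f \<in> borel_measurable M" "g \<in> borel_measurable M"
    and "integrable M (\<lambda>x. (f x)\<^sup>2)" "integrable M (\<lambda>x. (g x)\<^sup>2)"
  shows "integrable M (\<lambda>x. (f x + g x)\<^sup>2)"
proof -
  have "integrable M (\<lambda>x. (f x)\<^sup>2 + (g x)\<^sup>2 + 2 * (f x * g x))"
    using integrable_mult_square[OF assms] assms by simp
  thus ?thesis by (simp add: power2_sum mult.assoc)
qed

text \<open>A form of Vitali's theorem. The truncated excess
  \<open>max 0 (|h n x| - \<epsilon> * k n x)\<close> is dominated by \<Phi> and tends to 0 almost
  everywhere, so its integral vanishes in the limit; what was cut off has integral at most
  \<open>\<epsilon> * C\<close>. Young's inequality supplies the domination in the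
  applications.\<close>

lemma AE_tendsto_imp_integral_tendsto_0:
  fixes h k :: "nat \<Rightarrow> 'b \<Rightarrow> real"
  assumes hm [measurable]: "\<And>n. h n \<in> borel_measurable M"
    and lim: "AE x in M. (\<lambda>n. h n x) \<longlonglongrightarrow> 0"
    and ki: "\<And>n. integrable M (k n)" and k0: "\<And>n x. 0 \<le> k n x" and kb: "\<And>n. (\<integral>x. k n x \<partial>M) \<le> C"
    and dom: "\<And>\<epsilon>. \<epsilon> > 0 \<Longrightarrow> \<exists>\<Phi>. integrable M \<Phi> \<and> (\<forall>n x. \<bar>h n x\<bar> \<le> \<Phi> x + \<epsilon> * k n x)"
  shows "\<And>n. integrable M (h n)" "(\<lambda>n. \<integral>x. \<bar>h n x\<bar> \<partial>M) \<longlonglongrightarrow> 0"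
proof -
  show hi: "integrable M (h n)" for n
  proof -
    obtain \<Phi> where \<Phi>: "integrable M \<Phi>" "\<And>n x. \<bar>h n x\<bar> \<le> \<Phi> x + 1 * k n x" using dom[of 1] by auto
    show ?thesis
    proof (rule Bochner_Integration.integrable_bound[of M "\<lambda>x. \<Phi> x + k n x"])
      show "integrable M (\<lambda>x. \<Phi> x + k n x)" by (intro Bochner_Integration.integrable_add \<Phi>(1) ki)
      show "AE x in M. norm (h n x) \<le> norm (\<Phi> x + k n x)"
      proof (rule AE_I2)
        fix x
        have "\<bar>h n x\<bar> \<le> \<Phi> x + k n x" using \<Phi>(2)[of n x] by simp
        thus "norm (h n x) \<le> norm (\<Phi> x + k n x)" by simp
      qed
    qed (rule hm)
  qed
  have "0 \<le> (\<integral>x. k 0 x \<partial>M)" by (rule integral_nonneg_AE) (simp add: k0)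
  hence C: "C \<ge> 0" using kb[of 0] by linarith
  show "(\<lambda>n. \<integral>x. \<bar>h n x\<bar> \<partial>M) \<longlonglongrightarrow> 0"
  proof (rule LIMSEQ_I)
    fix e :: real assume e: "e > 0"
    define \<epsilon> where "\<epsilon> = e / 2 / (C + 1)"
    have \<epsilon>: "\<epsilon> > 0" using e C by (simp add: \<epsilon>_def)
    have \<epsilon>C: "\<epsilon> * C \<le> e / 2"
    proof -
      have "\<epsilon> * C \<le> \<epsilon> * (C + 1)" using \<epsilon> by simp
      also have "\<dots> = e / 2" 
      proof -
        have "C + 1 \<noteq> 0" using C by simp
        from nonzero_eq_divide_eq[OF this, of \<epsilon> "e / 2"] \<epsilon>_def show ?thesis by blast
      qed
      finally show ?thesis .
    qed
    obtain \<Phi> where \<Phi>: "integrable M \<Phi>" "\<And>n x. \<bar>h n x\<bar> \<le> \<Phi> x + \<epsilon> * k n x" using dom[OF \<epsilon>] by auto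
    have [measurable]: "k n \<in> borel_measurable M" "\<Phi> \<in> borel_measurable M" for n using ki \<Phi> by auto
    define g where "g = (\<lambda>n x. max 0 (\<bar>h n x\<bar> - \<epsilon> * k n x))"
    have gb: "\<bar>g n x\<bar> \<le> \<bar>\<Phi> x\<bar>" for n x unfolding g_def using \<Phi>(2)[of n x] by auto
    have gh: "\<bar>g n x\<bar> \<le> \<bar>h n x\<bar>" for n x
      unfolding g_def using mult_nonneg_nonneg[OF less_imp_le[OF \<epsilon>] k0[of n x]] by auto
    have [measurable]: "g n \<in> borel_measurable M" for n unfolding g_def by measurable
    have glim: "(\<lambda>n. \<integral>x. g n x \<partial>M) \<longlonglongrightarrow> (\<integral>x. 0 \<partial>M)"
    proof (rule integral_dominated_convergence[where w = "\<lambda>x. \<bar>\<Phi> x\<bar>"])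
      show "AE x in M. (\<lambda>n. g n x) \<longlonglongrightarrow> 0" using lim
      proof eventually_elim
        case (elim x)
        have "(\<lambda>n. \<bar>h n x\<bar>) \<longlonglongrightarrow> 0" using elim by (simp add: tendsto_rabs_zero_iff)
        thus ?case by (rule Lim_null_comparison[rotated]) (use gh in auto)
      qed
    qed (use \<Phi> gb in auto)
    have gi: "integrable M (g n)" for n
      by (rule Bochner_Integration.integrable_bound[OF integrable_abs[OF \<Phi>(1)]]) (use gb in auto)
    obtain n0 where n0: "\<And>n. n \<ge> n0 \<Longrightarrow> norm ((\<integral>x. g n x \<partial>M) - 0) < e / 2"
      using LIMSEQ_D[OF glim, of "e/2"] e by auto
    have "norm ((\<integral>x. \<bar>h n x\<bar> \<partial>M) - 0) < e" if "n \<ge> n0" for n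
    proof -
      have "(\<integral>x. \<bar>h n x\<bar> \<partial>M) \<le> (\<integral>x. g n x + \<epsilon> * k n x \<partial>M)"
        by (rule integral_mono) (use hi gi ki in \<open>auto simp: g_def\<close>)
      also have "\<dots> = (\<integral>x. g n x \<partial>M) + \<epsilon> * (\<integral>x. k n x \<partial>M)" using gi ki by simp
      also have "\<epsilon> * (\<integral>x. k n x \<partial>M) \<le> \<epsilon> * C" using kb \<epsilon> by simp
      finally have "(\<integral>x. \<bar>h n x\<bar> \<partial>M) < e" using n0[OF that] \<epsilon>C by (simp add: abs_less_iff)
      thus ?thesis by simp
    qed
    thus "\<exists>no. \<forall>n\<ge>no. norm ((\<integral>x. \<bar>h n x\<bar> \<partial>M) - 0) < e" by blast
  qed
qed

text \<open>The weight turns the measure into a finite one with the same null sets. Local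
  compactness thus becomes a single Cauchy condition on the whole space, and one subsequence serves
  almost every point.\<close>

lemma L2_Cauchy_AE_convergent_subseq:
  fixes X :: "nat \<Rightarrow> 'b \<Rightarrow> real" and \<omega> :: "'b \<Rightarrow> real"
  assumes [measurable]: "\<And>n. X n \<in> borel_measurable M" "\<omega> \<in> borel_measurable M"
    and \<omega>: "\<And>x. \<omega> x > 0" "integrable M \<omega>"
    and cauchy: "\<And>e. e > 0 \<Longrightarrow> \<exists>K. \<forall>m\<ge>K. \<forall>n\<ge>K. (\<integral>\<^sup>+ x. ennreal (\<omega> x * (X m x - X n x)\<^sup>2) \<partial>M) \<le> ennreal e"
  shows "\<exists>r u. strict_mono (r::nat\<Rightarrow>nat) \<and> u \<in> borel_measurable M \<and> (AE x in M. (\<lambda>n. X (r n) x) \<longlonglongrightarrow> u x)"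
proof -
  have "\<exists>K. \<forall>j::nat. \<forall>m\<ge>K j. \<forall>n\<ge>K j. (\<integral>\<^sup>+ x. ennreal (\<omega> x * (X m x - X n x)\<^sup>2) \<partial>M) \<le> ennreal ((1/4) ^ j)"
    by (rule choice) (use cauchy in auto)
  then obtain K :: "nat \<Rightarrow> nat" where K: "\<And>j m n. m \<ge> K j \<Longrightarrow> n \<ge> K j \<Longrightarrow>
      (\<integral>\<^sup>+ x. ennreal (\<omega> x * (X m x - X n x)\<^sup>2) \<partial>M) \<le> ennreal ((1/4) ^ j)" by blast
  \<comment> \<open>Summing the \<open>K i\<close> puts \<open>r j\<close> beyond \<open>K j\<close>
    and makes it monotone; the extra \<open>j\<close> makes it strictly monotone.\<close>
  define r where "r = (\<lambda>j::nat. (\<Sum>i\<le>j. K i) + j)"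
  have r: "strict_mono r" unfolding strict_mono_Suc_iff by (simp add: r_def)
  have rK: "r j \<ge> K j" for j
  proof -
    have "K j \<le> (\<Sum>i\<le>j. K i)" by (rule member_le_sum) auto
    thus ?thesis by (simp add: r_def)
  qed
  define d where "d = (\<lambda>j x. \<bar>X (r (Suc j)) x - X (r j) x\<bar>)"
  have [measurable]: "d j \<in> borel_measurable M" for j unfolding d_def by measurable
  define W where "W = (\<integral>x. \<omega> x \<partial>M)"
  have W: "W \<ge> 0" unfolding W_def using \<omega>(1) by (simp add: less_imp_le)
  have dj: "(\<integral>\<^sup>+ x. ennreal (\<omega> x * d j x) \<partial>M) \<le> ennreal ((1/2) ^ j * (1 + W))" for j
  proof -
    have "(\<integral>\<^sup>+ x. ennreal (\<omega> x * d j x) \<partial>M)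
        \<le> (\<integral>\<^sup>+ x. ennreal (2 ^ j) * ennreal (\<omega> x * (X (r (Suc j)) x - X (r j) x)\<^sup>2) + ennreal ((1/2) ^ j) * ennreal (\<omega> x) \<partial>M)"
    proof (rule nn_integral_mono)
      fix x
      define c :: real where "c = 2 ^ j"
      have c: "c > 0" "(1/2) ^ j = 1 / c" by (auto simp: c_def power_divide)
      \<comment> \<open>The factor 2^j balances the squared increments, of integral at most 4^-j,
        against the constant term: both contribute order 2^-j, which is summable.\<close>
      have "d j x \<le> c * (d j x)\<^sup>2 + 1 / c"
      proof -
        have "0 \<le> (c * d j x - 1)\<^sup>2" by simp
        hence "2 * (c * d j x) \<le> (c * d j x)\<^sup>2 + 1" by (simp add: power2_diff)
        moreover have "0 \<le> c * d j x" using c by (simp add: d_def)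
        ultimately have "c * d j x \<le> c * (c * (d j x)\<^sup>2 + 1 / c)"
          using c by (simp add: power2_eq_square algebra_simps)
        thus ?thesis using c(1) by (simp only: mult_le_cancel_left_pos)
      qed
      hence "\<omega> x * d j x \<le> \<omega> x * (c * (d j x)\<^sup>2 + 1 / c)" using \<omega>(1)[of x] by (intro mult_left_mono) auto
      also have "\<dots> = c * (\<omega> x * (d j x)\<^sup>2) + (1 / c) * \<omega> x" by (simp add: algebra_simps)
      finally have "\<omega> x * d j x \<le> c * (\<omega> x * (d j x)\<^sup>2) + (1 / c) * \<omega> x" .
      moreover have "(d j x)\<^sup>2 = (X (r (Suc j)) x - X (r j) x)\<^sup>2" by (simp add: d_def)
      ultimately have "ennreal (\<omega> x * d j x) \<le> ennreal (c * (\<omega> x * (X (r (Suc j)) x - X (r j) x)\<^sup>2) + (1 / c) * \<omega> x)"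
        by (intro ennreal_leI) simp
      also have "\<dots> = ennreal c * ennreal (\<omega> x * (X (r (Suc j)) x - X (r j) x)\<^sup>2) + ennreal (1 / c) * ennreal (\<omega> x)"
        using c(1) less_imp_le[OF \<omega>(1)[of x]] by (simp only: ennreal_plus ennreal_mult mult_nonneg_nonneg zero_le_power2 zero_le_divide_1_iff less_imp_le)
      finally show "ennreal (\<omega> x * d j x) \<le> ennreal (2 ^ j) * ennreal (\<omega> x * (X (r (Suc j)) x - X (r j) x)\<^sup>2) + ennreal ((1/2) ^ j) * ennreal (\<omega> x)"
        unfolding c(2) by (simp add: c_def)
    qed
    also have "\<dots> = ennreal (2 ^ j) * (\<integral>\<^sup>+ x. ennreal (\<omega> x * (X (r (Suc j)) x - X (r j) x)\<^sup>2) \<partial>M) + ennreal ((1/2) ^ j) * ennreal W"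
      using \<omega> unfolding W_def by (simp add: nn_integral_add nn_integral_cmult nn_integral_eq_integral less_imp_le)
    also have "\<dots> \<le> ennreal (2 ^ j) * ennreal ((1/4) ^ j) + ennreal ((1/2) ^ j) * ennreal W"
    proof (intro add_mono mult_left_mono K order_refl)
      show "K j \<le> r (Suc j)" using rK[of j] r by (meson lessI less_imp_le order_trans strict_mono_less)
    qed (use rK in auto)
    also have "\<dots> = ennreal ((1/2) ^ j * (1 + W))"
    proof -
      have "(2::real) ^ j * (1/4) ^ j = (1/2) ^ j" by (simp flip: power_mult_distrib)
      thus ?thesis using W by (simp add: ennreal_mult[symmetric] ennreal_plus[symmetric] algebra_simps del: ennreal_plus)
    qed
    finally show ?thesis .
  qed
  have "(\<integral>\<^sup>+ x. (\<Sum>j. ennreal (\<omega> x * d j x)) \<partial>M) = (\<Sum>j. \<integral>\<^sup>+ x. ennreal (\<omega> x * d j x) \<partial>M)"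
    by (rule nn_integral_suminf) measurable
  also have "\<dots> \<le> (\<Sum>j. ennreal ((1/2) ^ j * (1 + W)))" by (intro suminf_le dj) auto
  also have "\<dots> < top"
  proof -
    have "summable (\<lambda>j. (1/2::real) ^ j * (1 + W))" by (intro summable_mult2 summable_geometric) simp
    thus ?thesis using W by (subst suminf_ennreal2) (auto simp: ennreal_less_top)
  qed
  finally have fin: "(\<integral>\<^sup>+ x. (\<Sum>j. ennreal (\<omega> x * d j x)) \<partial>M) \<noteq> \<infinity>" by simp
  have "AE x in M. (\<Sum>j. ennreal (\<omega> x * d j x)) \<noteq> \<infinity>"
    by (rule nn_integral_PInf_AE[OF _ fin]) measurable
  hence conv: "AE x in M. convergent (\<lambda>n. X (r n) x)"
  proof eventually_elim
    case (elim x)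
    have "summable (\<lambda>j. \<omega> x * d j x)"
      by (rule summable_suminf_not_top) (use elim \<omega>(1)[of x] in \<open>auto simp: d_def less_imp_le\<close>)
    hence "summable (\<lambda>j. (1 / \<omega> x) * (\<omega> x * d j x))" by (rule summable_mult)
    hence "summable (\<lambda>j. d j x)" using \<omega>(1)[of x] by simp
    hence "summable (\<lambda>j. X (r (Suc j)) x - X (r j) x)" unfolding d_def by (rule summable_rabs_cancel)
    hence "convergent (\<lambda>n. \<Sum>j<n. X (r (Suc j)) x - X (r j) x)" by (simp add: summable_iff_convergent)
    hence "convergent (\<lambda>n. X (r n) x - X (r 0) x)" using sum_lessThan_telescope[of "\<lambda>j. X (r j) x"] by (simp only:)
    then obtain l where "(\<lambda>n. X (r n) x - X (r 0) x) \<longlonglongrightarrow> l" unfolding convergent_def ..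
    hence "(\<lambda>n. X (r n) x - X (r 0) x + X (r 0) x) \<longlonglongrightarrow> l + X (r 0) x" by (intro tendsto_add tendsto_const)
    thus ?case unfolding convergent_def by auto
  qed
  have um: "(\<lambda>x. lim (\<lambda>n. X (r n) x)) \<in> borel_measurable M" by measurable
  have "AE x in M. (\<lambda>n. X (r n) x) \<longlonglongrightarrow> lim (\<lambda>n. X (r n) x)"
    using conv by eventually_elim (simp add: convergent_LIMSEQ_iff)
  thus ?thesis using r um by blast
qed

lemma bounded_diagonal_subseq:
  fixes a :: "nat \<Rightarrow> nat \<Rightarrow> real"
  assumes bd: "\<And>i n. \<bar>a i n\<bar> \<le> c i"
  shows "\<exists>r. strict_mono (r::nat\<Rightarrow>nat) \<and> (\<forall>i. convergent (\<lambda>n. a i (r n)))"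
proof -
  define P where "P = (\<lambda>i (r::nat\<Rightarrow>nat). convergent (\<lambda>n. a i (r n)))"
  interpret subseqs P
  proof
    fix i and r :: "nat \<Rightarrow> nat" assume "strict_mono r"
    have "bounded (range (\<lambda>n. a i (r n)))" using bd by (auto simp: bounded_iff)
    then obtain l r' where "strict_mono r'" "((\<lambda>n. a i (r n)) \<circ> r') \<longlonglongrightarrow> l"
      using bounded_imp_convergent_subsequence by blast
    thus "\<exists>r'. strict_mono r' \<and> P i (r \<circ> r')" unfolding P_def by (auto simp: convergent_def o_def)
  qed
  have "convergent (\<lambda>n. a i (diagseq n))" for i
  proof -
    have "P i (diagseq \<circ> ((+) (Suc i)))"
    proof (rule diagseq_holds)
      fix r s n assume "strict_mono (r::nat\<Rightarrow>nat)" "P n s"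
      thus "P n (s \<circ> r)" unfolding P_def
        using convergent_subseq_convergent[of "\<lambda>k. a n (s k)" r] by (simp add: o_def)
    qed
    hence "convergent (\<lambda>n. a i (diagseq (n + Suc i)))" by (simp add: P_def o_def add.commute)
    thus ?thesis using convergent_ignore_initial_segment[of "\<lambda>n. a i (diagseq n)" "Suc i"] by blast
  qed
  thus ?thesis using subseq_diagseq by blast
qed

subsection \<open>The space \<open>H\<^sup>s\<close>\<close>

text \<open>Fatou's lemma with a nonnegative integral on the left, so that it can be used before the
  limit is known to be integrable, and to show that it is.\<close>

lemma nn_integral_AE_limit_le:
  fixes g :: "'b \<Rightarrow> real" and h :: "nat \<Rightarrow> 'b \<Rightarrow> real"
  assumes lim: "AE x in M. (\<lambda>n. h n x) \<longlonglongrightarrow> g x" and i: "\<And>n. integrable M (h n)"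
    and h: "\<And>n x. 0 \<le> h n x" and le: "\<And>n. (\<integral>x. h n x \<partial>M) \<le> C"
  shows "(\<integral>\<^sup>+x. ennreal (g x) \<partial>M) \<le> ennreal C"
proof -
  have [measurable]: "h n \<in> borel_measurable M" for n using i by auto
  have "(\<integral>\<^sup>+x. ennreal (g x) \<partial>M) = (\<integral>\<^sup>+x. liminf (\<lambda>n. ennreal (h n x)) \<partial>M)"
  proof (rule nn_integral_cong_AE)
    show "AE x in M. ennreal (g x) = liminf (\<lambda>n. ennreal (h n x))"
      using lim by eventually_elim (rule lim_imp_Liminf[symmetric]; simp)
  qed
  also have "\<dots> \<le> liminf (\<lambda>n. \<integral>\<^sup>+x. ennreal (h n x) \<partial>M)" by (rule nn_integral_liminf) measurable
  also have "\<dots> = liminf (\<lambda>n. ennreal (\<integral>x. h n x \<partial>M))" using i h by (simp add: nn_integral_eq_integral)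
  also have "\<dots> \<le> ennreal C" using le by (intro Liminf_le) (auto intro!: always_eventually ennreal_leI)
  finally show ?thesis .
qed

text \<open>The exponent is half of the Gagliardo exponent: products of two such quotients are the
  integrand of \<open>gform\<close>, and the seminorm becomes an L2 norm of a function that depends
  linearly on \<open>u\<close>.\<close>

definition dquot :: "real \<Rightarrow> ('a::euclidean_space \<Rightarrow> real) \<Rightarrow> 'a \<times> 'a \<Rightarrow> real" where
  "dquot s u = (\<lambda>p. (u (fst p) - u (snd p)) / norm (fst p - snd p) powr ((real DIM('a) + 2 * s) / 2))"

lemma dquot_measurable [measurable]:
  assumes [measurable]: "u \<in> borel_measurable borel"
  shows "dquot s u \<in> borel_measurable (lborel \<Otimes>\<^sub>M lborel)"
  unfolding dquot_def by measurable

lemma dquot_mult: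
  fixes u v :: "'a::euclidean_space \<Rightarrow> real"
  shows "dquot s u p * dquot s v p = (u (fst p) - u (snd p)) * (v (fst p) - v (snd p))
        / norm (fst p - snd p) powr (real DIM('a) + 2 * s)"
  unfolding dquot_def by (simp add: powr_add[symmetric] field_sum_of_halves)

lemma dquot_linear: "dquot s (u + v) p = dquot s u p + dquot s v p" "dquot s (c *\<^sub>R u) p = c * dquot s u p"
    "dquot s (u - v) p = dquot s u p - dquot s v p"
  unfolding dquot_def by (simp_all add: add_divide_distrib diff_divide_distrib algebra_simps)

lemma gform_dquot: "gform s u v = (\<integral>p. dquot s u p * dquot s v p \<partial>(lborel \<Otimes>\<^sub>M lborel))"
  unfolding gform_def dquot_mult ..

lemma gagliardo_dquot: "gagliardo s u = (\<integral>\<^sup>+p. ennreal ((dquot s u p)\<^sup>2) \<partial>(lborel \<Otimes>\<^sub>M lborel))"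
  unfolding gagliardo_def power2_eq_square dquot_mult ..

lemma Hs_iff: "u \<in> Hs s \<longleftrightarrow> u \<in> borel_measurable borel \<and> integrable lborel (\<lambda>x. (u x)\<^sup>2)
    \<and> integrable (lborel \<Otimes>\<^sub>M lborel) (\<lambda>p. (dquot s u p)\<^sup>2)"
proof (cases "u \<in> borel_measurable borel")
  case True
  note [measurable] = True
  have "gagliardo s u < \<infinity> \<longleftrightarrow> integrable (lborel \<Otimes>\<^sub>M lborel) (\<lambda>p. (dquot s u p)\<^sup>2)"
    unfolding gagliardo_dquot by (subst integrable_iff_bounded) simp
  thus ?thesis using True by (simp add: Hs_def)
qed (simp add: Hs_def)

lemma Hs_measurable: "u \<in> Hs s \<Longrightarrow> u \<in> borel_measurable borel"
  by (simp add: Hs_iff)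

lemma gagliardo_Hs: "u \<in> Hs s \<Longrightarrow> enn2real (gagliardo s u) = (\<integral>p. (dquot s u p)\<^sup>2 \<partial>(lborel \<Otimes>\<^sub>M lborel))"
  unfolding gagliardo_dquot by (simp add: Hs_iff nn_integral_eq_integral)

lemma subspace_Hs: "subspace (Hs s :: ('a::euclidean_space \<Rightarrow> real) set)"
  unfolding subspace_def
proof safe
  show "(0 :: 'a \<Rightarrow> real) \<in> Hs s" by (simp add: Hs_iff dquot_def zero_fun_def)
next
  fix u v :: "'a \<Rightarrow> real" assume u: "u \<in> Hs s" and v: "v \<in> Hs s"
  note [measurable] = Hs_measurable[OF u] Hs_measurable[OF v]
  have "u + v \<in> borel_measurable borel" unfolding plus_fun_def by measurable
  thus "u + v \<in> Hs s" using u v integrable_square_add[of u lborel v]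
      integrable_square_add[of "dquot s u" "lborel \<Otimes>\<^sub>M lborel" "dquot s v"]
    by (simp add: Hs_iff dquot_linear)
next
  fix u :: "'a \<Rightarrow> real" and c assume u: "u \<in> Hs s"
  note [measurable] = Hs_measurable[OF u]
  have "c *\<^sub>R u \<in> borel_measurable borel" unfolding scaleR_fun_def by measurable
  thus "c *\<^sub>R u \<in> Hs s" using u by (simp add: Hs_iff dquot_linear power_mult_distrib)
qed

lemma AE_pair_fst_snd:
  fixes P :: "'a::euclidean_space \<Rightarrow> bool"
  assumes "AE x in lborel. P x"
  shows "AE p in lborel \<Otimes>\<^sub>M lborel. P (fst p) \<and> P (snd p)"
proof -
  from AE_E[OF assms] obtain S where S: "{x \<in> space lborel. \<not> P x} \<subseteq> S" "emeasure lborel S = 0" "S \<in> sets lborel" by blast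
  have [measurable]: "S \<in> sets lborel" by fact
  have ae: "AE x in lborel. x \<notin> S" using S by (intro AE_not_in) (auto simp: null_sets_def)
  have "AE p in lborel \<Otimes>\<^sub>M lborel. fst p \<notin> S \<and> snd p \<notin> S"
  proof (rule lborel_pair.AE_pair_measure)
    show "AE x in lborel. AE y in lborel. fst (x, y) \<notin> S \<and> snd (x, y) \<notin> S"
      using ae by eventually_elim (use ae in simp)
  qed measurable
  thus ?thesis by eventually_elim (use S in auto)
qed

lemma dquot_tendsto:
  assumes "AE x in lborel. (\<lambda>n. X n x) \<longlonglongrightarrow> u x"
  shows "AE p in lborel \<Otimes>\<^sub>M lborel. (\<lambda>n. dquot s (X n) p) \<longlonglongrightarrow> dquot s u p"
  using AE_pair_fst_snd[OF assms]
  unfolding dquot_def divide_inverse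
  by eventually_elim (intro tendsto_mult tendsto_diff tendsto_const; blast)

locale schroedinger_space =
  fixes s :: real and V :: "'a::euclidean_space \<Rightarrow> real" and \<alpha> \<beta> q p :: real
  assumes s: "0 < s" "s < 1" and dim: "2 * s < real DIM('a)"
    and V_cont: "continuous_on UNIV V" and \<alpha>: "0 < \<alpha>" and V_ge: "\<And>x. \<alpha> \<le> V x" and V_le: "\<And>x. V x \<le> \<beta>"
    and V_per: "\<And>x k. k \<in> int_lattice \<Longrightarrow> V (x + k) = V x"
    and q: "q = crit_exp s DIM('a)" and p: "p = 2 + 4 * s / real DIM('a)"
begin

sublocale frac_exponents s "real DIM('a)" q p
  using s dim q p by unfold_locales (auto simp: crit_exp_def)

lemma frac_exponents: "frac_exponents s (real DIM('a)) q p" ..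

lemma V_measurable [measurable]: "V \<in> borel_measurable borel"
  using V_cont by (rule borel_measurable_continuous_onI)

lemma V_pos: "0 < V x" using \<alpha> V_ge[of x] by linarith

lemma \<beta>_pos: "0 < \<beta>" using V_pos[of 0] V_le[of 0] by linarith

definition B :: "('a \<Rightarrow> real) \<Rightarrow> ('a \<Rightarrow> real) \<Rightarrow> real" where
  "B u v = gform s u v + (\<integral>x. V x * u x * v x \<partial>lborel)"

lemma integrable_Hs:
  assumes u: "u \<in> Hs s" and v: "v \<in> Hs s"
  shows "integrable lborel (\<lambda>x. u x * v x)" "integrable lborel (\<lambda>x. V x * u x * v x)"
    "integrable (lborel \<Otimes>\<^sub>M lborel) (\<lambda>p. dquot s u p * dquot s v p)"
    "integrable lborel (\<lambda>x. (u x)\<^sup>2)" "integrable lborel (\<lambda>x. V x * (u x)\<^sup>2)"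
    "integrable (lborel \<Otimes>\<^sub>M lborel) (\<lambda>p. (dquot s u p)\<^sup>2)"
proof -
  note [measurable] = Hs_measurable[OF u] Hs_measurable[OF v]
  show 1: "integrable lborel (\<lambda>x. u x * v x)" "integrable (lborel \<Otimes>\<^sub>M lborel) (\<lambda>p. dquot s u p * dquot s v p)"
    using u v by (intro integrable_mult_square; simp add: Hs_iff)+
  show 2: "integrable lborel (\<lambda>x. (u x)\<^sup>2)" "integrable (lborel \<Otimes>\<^sub>M lborel) (\<lambda>p. (dquot s u p)\<^sup>2)"
    using u by (simp_all add: Hs_iff)
  have Vb: "\<bar>V x\<bar> \<le> \<beta>" for x using V_pos[of x] V_le[of x] by simp
  have "integrable lborel (\<lambda>x. V x * (u x * v x))"
    by (rule Bochner_Integration.integrable_bound[of _ "\<lambda>x. \<beta> * (u x * v x)"])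
       (use 1 Vb \<beta>_pos in \<open>auto simp: abs_mult intro!: mult_right_mono\<close>)
  thus "integrable lborel (\<lambda>x. V x * u x * v x)" by (simp add: mult.assoc)
  show "integrable lborel (\<lambda>x. V x * (u x)\<^sup>2)"
    by (rule Bochner_Integration.integrable_bound[of _ "\<lambda>x. \<beta> * (u x)\<^sup>2"])
       (use 2 Vb \<beta>_pos in \<open>auto simp: abs_mult intro!: mult_right_mono\<close>)
qed

lemma B_self: "u \<in> Hs s \<Longrightarrow> B u u = (\<integral>p. (dquot s u p)\<^sup>2 \<partial>(lborel \<Otimes>\<^sub>M lborel)) + (\<integral>x. V x * (u x)\<^sup>2 \<partial>lborel)"
  unfolding B_def gform_dquot power2_eq_square mult.assoc ..

lemma dquot_le_B: "u \<in> Hs s \<Longrightarrow> (\<integral>p. (dquot s u p)\<^sup>2 \<partial>(lborel \<Otimes>\<^sub>M lborel)) \<le> B u u"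
  using V_pos by (subst B_self) (auto simp: less_imp_le)

lemma V_square_le_B: "u \<in> Hs s \<Longrightarrow> (\<integral>x. V x * (u x)\<^sup>2 \<partial>lborel) \<le> B u u"
  by (subst B_self) auto

lemma square_le_B: 
  assumes u: "u \<in> Hs s" shows "(\<integral>x. (u x)\<^sup>2 \<partial>lborel) \<le> B u u / \<alpha>"
proof -
  have "(\<integral>x. \<alpha> * (u x)\<^sup>2 \<partial>lborel) \<le> (\<integral>x. V x * (u x)\<^sup>2 \<partial>lborel)"
    by (rule integral_mono) (use integrable_Hs[OF u u] V_ge in \<open>auto intro: mult_right_mono\<close>)
  also have "\<dots> \<le> B u u" by (rule V_square_le_B[OF u])
  finally show ?thesis using \<alpha> by (simp add: field_simps)
qed

lemma B_nonneg: "u \<in> Hs s \<Longrightarrow> 0 \<le> B u u"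
  using V_pos by (subst B_self) (auto simp: less_imp_le)

text \<open>Fatou's lemma is applied separately to the seminorm and to the potential term, each
  bounded by \<open>C\<close>; this is the origin of the factor 2, harmless for completeness and
  compactness.\<close>

lemma AE_limit_Hs:
  assumes X: "\<And>n. X n \<in> Hs s" and um: "u \<in> borel_measurable borel"
    and lim: "AE x in lborel. (\<lambda>n. X n x) \<longlonglongrightarrow> u x"
    and C: "\<And>n. B (X n) (X n) \<le> C"
  shows "u \<in> Hs s" "B u u \<le> 2 * C"
proof -
  note [measurable] = um Hs_measurable[OF X]
  have a: "(\<integral>\<^sup>+p. ennreal ((dquot s u p)\<^sup>2) \<partial>(lborel \<Otimes>\<^sub>M lborel)) \<le> ennreal C"
  proof (rule nn_integral_AE_limit_le[where h = "\<lambda>n p. (dquot s (X n) p)\<^sup>2"])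
    show "AE x in lborel \<Otimes>\<^sub>M lborel. (\<lambda>n. (dquot s (X n) x)\<^sup>2) \<longlonglongrightarrow> (dquot s u x)\<^sup>2"
      using dquot_tendsto[OF lim, of s] by eventually_elim (rule tendsto_power)
    show "(\<integral>x. (dquot s (X n) x)\<^sup>2 \<partial>(lborel \<Otimes>\<^sub>M lborel)) \<le> C" for n
      using dquot_le_B[OF X[of n]] C[of n] by linarith
  qed (simp_all add: integrable_Hs(6)[OF X X])
  have b: "(\<integral>\<^sup>+x. ennreal (V x * (u x)\<^sup>2) \<partial>lborel) \<le> ennreal C"
  proof (rule nn_integral_AE_limit_le[where h = "\<lambda>n x. V x * (X n x)\<^sup>2"])
    show "AE x in lborel. (\<lambda>n. V x * (X n x)\<^sup>2) \<longlonglongrightarrow> V x * (u x)\<^sup>2"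
      using lim by eventually_elim (intro tendsto_intros)
    show "(\<integral>x. V x * (X n x)\<^sup>2 \<partial>lborel) \<le> C" for n using V_square_le_B[OF X[of n]] C[of n] by linarith
  qed (simp_all add: integrable_Hs(5)[OF X X] V_pos less_imp_le)
  have C0: "C \<ge> 0" using B_nonneg[OF X[of 0]] C[of 0] by linarith
  have i1: "integrable (lborel \<Otimes>\<^sub>M lborel) (\<lambda>p. (dquot s u p)\<^sup>2)"
    by (rule integrableI_bounded) (use a in \<open>auto intro: le_less_trans simp: ennreal_less_top\<close>)
  have i2: "integrable lborel (\<lambda>x. V x * (u x)\<^sup>2)"
    by (rule integrableI_bounded) (use b V_pos in \<open>auto intro: le_less_trans simp: ennreal_less_top abs_mult less_imp_le\<close>)
  have i3: "integrable lborel (\<lambda>x. (u x)\<^sup>2)"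
  proof (rule Bochner_Integration.integrable_bound)
    show "integrable lborel (\<lambda>x. 1 / \<alpha> * (V x * (u x)\<^sup>2))" using i2 by simp
    have "(u x)\<^sup>2 \<le> 1 / \<alpha> * (V x * (u x)\<^sup>2)" for x
      using \<alpha> mult_right_mono[OF V_ge[of x], of "(u x)\<^sup>2"] by (simp add: field_simps)
    thus "AE x in lborel. norm ((u x)\<^sup>2) \<le> norm (1 / \<alpha> * (V x * (u x)\<^sup>2))"
      by (intro AE_I2) (metis abs_ge_self order_trans real_norm_def abs_power2)
  qed simp
  show uH: "u \<in> Hs s" using i1 i3 um by (simp add: Hs_iff)
  have "(\<integral>p. (dquot s u p)\<^sup>2 \<partial>(lborel \<Otimes>\<^sub>M lborel)) \<le> C" using a i1 C0 by (simp add: nn_integral_eq_integral)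
  moreover have "(\<integral>x. V x * (u x)\<^sup>2 \<partial>lborel) \<le> C" using b i2 C0 V_pos by (simp add: nn_integral_eq_integral less_imp_le)
  ultimately show "B u u \<le> 2 * C" unfolding B_self[OF uH] by simp
qed

sublocale semi_hilbert "Hs s :: ('a \<Rightarrow> real) set" B
proof
  show "subspace (Hs s :: ('a \<Rightarrow> real) set)" by (rule subspace_Hs)
  fix u v w :: "'a \<Rightarrow> real" and c :: real
  assume u: "u \<in> Hs s"
  show "0 \<le> B u u" by (rule B_nonneg[OF u])
  assume w: "w \<in> Hs s"
  show "B (c *\<^sub>R u) w = c * B u w"
    using integrable_Hs[OF u w] unfolding B_def gform_dquot dquot_linear
    by (simp add: algebra_simps)
  assume v: "v \<in> Hs s"
  show "B u v = B v u" unfolding B_def gform_dquot by (simp add: mult_ac)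
  show "B (u + v) w = B u w + B v w"
    using integrable_Hs[OF u w] integrable_Hs[OF v w] unfolding B_def gform_dquot dquot_linear
    by (simp add: algebra_simps)
next
  fix X :: "nat \<Rightarrow> 'a \<Rightarrow> real"
  assume X: "\<And>n. X n \<in> Hs s" and cauchy: "\<And>e. e > 0 \<Longrightarrow> \<exists>M. \<forall>m\<ge>M. \<forall>n\<ge>M. B (X m - X n) (X m - X n) < e"
  note [measurable] = Hs_measurable[OF X]
  have diff: "u \<in> Hs s \<Longrightarrow> v \<in> Hs s \<Longrightarrow> u - v \<in> Hs s" for u v :: "'a \<Rightarrow> real" by (rule subspace_diff[OF subspace_Hs])
  obtain \<omega> :: "'a \<Rightarrow> real" where \<omega> [measurable]: "\<omega> \<in> borel_measurable lborel" and w: "\<And>x. \<omega> x > 0" "\<And>x. \<omega> x \<le> 1" "integrable lborel \<omega>"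
    by (rule sigma_finite_measure.obtain_positive_integrable_function[OF sigma_finite_lborel]) blast
  have "\<exists>r u. strict_mono (r::nat\<Rightarrow>nat) \<and> u \<in> borel_measurable lborel \<and> (AE x in lborel. (\<lambda>n. X (r n) x) \<longlonglongrightarrow> u x)"
  proof (rule L2_Cauchy_AE_convergent_subseq[OF _ \<omega> w(1,3)])
    fix e :: real assume "e > 0"
    then obtain K where K: "\<And>m n. m \<ge> K \<Longrightarrow> n \<ge> K \<Longrightarrow> B (X m - X n) (X m - X n) < \<alpha> * e"
      using cauchy[of "\<alpha> * e"] \<alpha> by auto
    have "(\<integral>\<^sup>+ x. ennreal (\<omega> x * (X m x - X n x)\<^sup>2) \<partial>lborel) \<le> ennreal e" if "m \<ge> K" "n \<ge> K" for m n
    proof -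
      have H: "X m - X n \<in> Hs s" by (intro diff X)
      have "(\<integral>\<^sup>+ x. ennreal (\<omega> x * (X m x - X n x)\<^sup>2) \<partial>lborel) \<le> (\<integral>\<^sup>+ x. ennreal (((X m - X n) x)\<^sup>2) \<partial>lborel)"
        using w(2) by (intro nn_integral_mono ennreal_leI) (auto intro: mult_left_le_one_le less_imp_le[OF w(1)])
      also have "\<dots> = ennreal (\<integral>x. ((X m - X n) x)\<^sup>2 \<partial>lborel)"
        using integrable_Hs(4)[OF H H] by (intro nn_integral_eq_integral) auto
      also have "\<dots> \<le> ennreal e"
      proof (rule ennreal_leI)
        have "B (X m - X n) (X m - X n) / \<alpha> \<le> e" using K[OF that] \<alpha> by (simp add: field_simps)
        thus "(\<integral>x. ((X m - X n) x)\<^sup>2 \<partial>lborel) \<le> e" using square_le_B[OF H] by linarith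
      qed
      finally show ?thesis .
    qed
    thus "\<exists>K. \<forall>m\<ge>K. \<forall>n\<ge>K. (\<integral>\<^sup>+ x. ennreal (\<omega> x * (X m x - X n x)\<^sup>2) \<partial>lborel) \<le> ennreal e" by blast
  qed measurable
  then obtain r u where r: "strict_mono (r::nat\<Rightarrow>nat)" and um: "u \<in> borel_measurable borel"
    and lim: "AE x in lborel. (\<lambda>n. X (r n) x) \<longlonglongrightarrow> u x" by auto
  note [measurable] = um
  \<comment> \<open>\<open>X n - u\<close> is the almost everywhere limit of the differences
    \<open>X n - X (r (k + K))\<close>, to which \<open>AE_limit_Hs\<close> applies. This transfers
    the Cauchy bound to the limit, at the cost of a factor 2, and also shows that \<open>u\<close>
    belongs to the space.\<close>
  have key: "X n - u \<in> Hs s \<and> B (X n - u) (X n - u) \<le> 2 * e"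
    if K: "\<And>m n. m \<ge> K \<Longrightarrow> n \<ge> K \<Longrightarrow> B (X m - X n) (X m - X n) < e" and n: "n \<ge> K" for e K n
  proof -
    have "X n - u \<in> borel_measurable borel" unfolding fun_diff_def by measurable
    moreover have "AE x in lborel. (\<lambda>k. (X n - X (r (k + K))) x) \<longlonglongrightarrow> (X n - u) x"
      using lim
    proof eventually_elim
      case (elim x)
      have "(\<lambda>k. X (r (k + K)) x) \<longlonglongrightarrow> u x" using elim by (rule LIMSEQ_ignore_initial_segment)
      thus ?case by (auto intro!: tendsto_intros)
    qed
    moreover have "r (k + K) \<ge> K" for k using seq_suble[OF r, of "k + K"] by simp
    hence "B (X n - X (r (k + K))) (X n - X (r (k + K))) \<le> e" for k using K[OF n, of "r (k + K)"] by (simp add: less_imp_le)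
    ultimately show ?thesis using AE_limit_Hs[of "\<lambda>k. X n - X (r (k + K))" "X n - u" e] diff X by blast
  qed
  have "u \<in> Hs s"
  proof -
    obtain K where "\<And>m n. m \<ge> K \<Longrightarrow> n \<ge> K \<Longrightarrow> B (X m - X n) (X m - X n) < 1" using cauchy[of 1] by auto
    from key[OF this order_refl] have "X K - u \<in> Hs s" by auto
    from diff[OF X[of K] this] show ?thesis by simp
  qed
  moreover have "(\<lambda>n. B (X n - u) (X n - u)) \<longlonglongrightarrow> 0"
  proof (rule LIMSEQ_I)
    fix e :: real assume e: "e > 0"
    then obtain K where K: "\<And>m n. m \<ge> K \<Longrightarrow> n \<ge> K \<Longrightarrow> B (X m - X n) (X m - X n) < e / 4" using cauchy[of "e / 4"] by auto
    have "norm (B (X n - u) (X n - u) - 0) < e" if "n \<ge> K" for n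
      using key[OF K that] B_nonneg[of "X n - u"] e by simp
    thus "\<exists>no. \<forall>n\<ge>no. norm (B (X n - u) (X n - u) - 0) < e" by blast
  qed
  ultimately show "\<exists>u\<in>Hs s. (\<lambda>n. B (X n - u) (X n - u)) \<longlonglongrightarrow> 0" by blast
qed

end

subsection \<open>Local compactness and translations\<close>

definition floor_point :: "'a::euclidean_space \<Rightarrow> 'a" where
  "floor_point x = (\<Sum>b\<in>Basis. of_int \<lfloor>x \<bullet> b\<rfloor> *\<^sub>R b)"

lemma floor_point_inner: "b \<in> Basis \<Longrightarrow> floor_point x \<bullet> b = of_int \<lfloor>x \<bullet> b\<rfloor>"
  unfolding floor_point_def by (simp add: inner_sum_left inner_Basis if_distrib sum.delta cong: if_cong)

lemma floor_point_lattice: "floor_point x \<in> int_lattice"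
  unfolding int_lattice_def by (auto simp: floor_point_inner)

lemma norm_diff_floor_point: "norm (x - floor_point x) \<le> real DIM('a)" for x :: "'a::euclidean_space"
proof -
  have "norm (x - floor_point x) \<le> (\<Sum>b\<in>Basis. \<bar>(x - floor_point x) \<bullet> b\<bar>)" by (rule norm_le_l1)
  also have "\<dots> \<le> (\<Sum>b\<in>(Basis::'a set). 1)"
    by (rule sum_mono) (simp add: inner_diff_left floor_point_inner abs_le_iff, linarith)
  finally show ?thesis by simp
qed

lemma floor_point_measurable [measurable]: "floor_point \<in> borel_measurable borel"
  unfolding floor_point_def by measurable

lemma countable_int_lattice: "countable (int_lattice :: 'a::euclidean_space set)"
proof -
  have "int_lattice \<subseteq> (\<lambda>g. \<Sum>b\<in>Basis. g b *\<^sub>R b) ` (Pi\<^sub>E (Basis::'a set) (\<lambda>_. \<int>))"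
  proof
    fix k :: 'a assume k: "k \<in> int_lattice"
    have "k = (\<Sum>b\<in>Basis. restrict (\<lambda>b. k \<bullet> b) Basis b *\<^sub>R b)"
      by (simp add: euclidean_representation)
    moreover have "restrict (\<lambda>b. k \<bullet> b) Basis \<in> Pi\<^sub>E (Basis::'a set) (\<lambda>_. \<int>)"
      using k by (auto simp: int_lattice_def)
    ultimately show "k \<in> (\<lambda>g. \<Sum>b\<in>Basis. g b *\<^sub>R b) ` (Pi\<^sub>E (Basis::'a set) (\<lambda>_. \<int>))" by blast
  qed
  moreover have "countable (Pi\<^sub>E (Basis::'a set) (\<lambda>_. \<int> :: real set))"
    by (intro countable_PiE) (auto simp: Ints_def)
  ultimately show ?thesis by (meson countable_image countable_subset)
qed

lemma int_lattice_uminus: "k \<in> int_lattice \<Longrightarrow> - k \<in> int_lattice"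
  by (auto simp: int_lattice_def)

section \<open>Translations\<close>

lemma lborel_integral_shift:
  fixes g :: "'b::euclidean_space \<Rightarrow> real"
  assumes [measurable]: "g \<in> borel_measurable borel"
  shows "(\<integral>x. g (x + c) \<partial>lborel) = (\<integral>x. g x \<partial>lborel)"
    and "integrable lborel (\<lambda>x. g (x + c)) \<longleftrightarrow> integrable lborel g"
proof -
  have "(\<lambda>x. x + c) = (+) c" by (simp add: fun_eq_iff add.commute)
  hence d: "lborel = distr lborel borel (\<lambda>x. x + c)" by (simp add: lborel_distr_plus)
  show "(\<integral>x. g (x + c) \<partial>lborel) = (\<integral>x. g x \<partial>lborel)"
    by (subst (2) d, subst integral_distr) auto
  show "integrable lborel (\<lambda>x. g (x + c)) \<longleftrightarrow> integrable lborel g"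
    by (subst (2) d, subst integrable_distr_eq) auto
qed

definition shift :: "'a::euclidean_space \<Rightarrow> ('a \<Rightarrow> real) \<Rightarrow> 'a \<Rightarrow> real" where
  "shift k u = (\<lambda>x. u (x + k))"

lemma shift_shift: "shift k (shift (- k) u) = u"
  by (simp add: shift_def)

lemma dquot_shift: "dquot s (shift k u) p = dquot s u (p + (k, k))"
  by (simp add: dquot_def shift_def)

text \<open>On pairs the translation is by \<open>(k, k)\<close>, which leaves x - y and hence the
  kernel unchanged.\<close>

lemma
  fixes u :: "'a::euclidean_space \<Rightarrow> real"
  assumes u: "u \<in> Hs s"
  shows shift_Hs: "shift k u \<in> Hs s"
    and gform_shift: "v \<in> Hs s \<Longrightarrow> gform s (shift k u) (shift k v) = gform s u v"
proof -
  note [measurable] = Hs_measurable[OF u]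
  have m: "dquot s v \<in> borel_measurable borel" if [measurable]: "v \<in> borel_measurable borel" for v :: "'a \<Rightarrow> real"
    using dquot_measurable[OF that, of s] by (simp add: lborel_prod)
  note [measurable] = m[OF Hs_measurable[OF u]]
  have "shift k u \<in> borel_measurable borel" unfolding shift_def by measurable
  thus "shift k u \<in> Hs s" using u
    lborel_integral_shift(2)[of "\<lambda>x. (u x)\<^sup>2" k] lborel_integral_shift(2)[of "\<lambda>p. (dquot s u p)\<^sup>2" "(k, k)"]
    by (simp add: Hs_iff dquot_shift lborel_prod) (simp add: shift_def)
  assume v: "v \<in> Hs s"
  note [measurable] = m[OF Hs_measurable[OF v]]
  show "gform s (shift k u) (shift k v) = gform s u v"
    unfolding gform_dquot dquot_shift lborel_prod
    using lborel_integral_shift(1)[of "\<lambda>p. dquot s u p * dquot s v p" "(k, k)"] by simp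
qed

context schroedinger_space
begin

lemma B_shift:
  assumes k: "k \<in> int_lattice" and u: "u \<in> Hs s" and v: "v \<in> Hs s"
  shows "B (shift k u) (shift k v) = B u v"
proof -
  note [measurable] = Hs_measurable[OF u] Hs_measurable[OF v]
  have "(\<integral>x. V x * shift k u x * shift k v x \<partial>lborel) = (\<integral>x. V (x + k) * u (x + k) * v (x + k) \<partial>lborel)"
    using V_per[OF k] by (simp add: shift_def)
  also have "\<dots> = (\<integral>x. V x * u x * v x \<partial>lborel)"
    by (rule lborel_integral_shift(1)[of "\<lambda>x. V x * u x * v x"]) measurable
  finally show ?thesis unfolding B_def by (simp add: gform_shift[OF u v])
qed

section \<open>Averages on a fine mesh and Rellich's theorem\<close>

definition mesh :: "nat \<Rightarrow> real" where "mesh j = 1 / real (Suc j)"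

lemma mesh_pos: "mesh j > 0" by (simp add: mesh_def)

text \<open>The corner of the mesh cell containing \<open>x\<close>. For each mesh size it takes
  only countably many values, so a diagonal sequence makes the averages converge at all nodes of all
  meshes.\<close>

definition node :: "nat \<Rightarrow> 'a \<Rightarrow> 'a" where "node j x = mesh j *\<^sub>R floor_point ((1 / mesh j) *\<^sub>R x)"

definition avg :: "nat \<Rightarrow> ('a \<Rightarrow> real) \<Rightarrow> 'a \<Rightarrow> real" where
  "avg j u z = (\<integral>y. u y * indicator (ball z (mesh j)) y \<partial>lborel) / measure lborel (ball z (mesh j))"

lemma node_measurable [measurable]: "node j \<in> borel_measurable borel"
  unfolding node_def by measurable

lemma norm_diff_node: "norm (x - node j x) \<le> real DIM('a) * mesh j"
proof -
  have "x - node j x = mesh j *\<^sub>R ((1 / mesh j) *\<^sub>R x - floor_point ((1 / mesh j) *\<^sub>R x))"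
    using mesh_pos[of j] by (simp add: node_def scaleR_diff_right)
  hence "norm (x - node j x) = mesh j * norm ((1 / mesh j) *\<^sub>R x - floor_point ((1 / mesh j) *\<^sub>R x))"
    using mesh_pos[of j] by simp
  also have "\<dots> \<le> mesh j * real DIM('a)"
    using mesh_pos[of j] by (intro mult_left_mono norm_diff_floor_point) auto
  finally show ?thesis by (simp add: mult.commute)
qed

lemma countable_nodes: "countable (range (node j))"
proof -
  have "range (node j) \<subseteq> (\<lambda>z. mesh j *\<^sub>R z) ` int_lattice"
    using floor_point_lattice by (auto simp: node_def)
  thus ?thesis by (rule countable_subset) (intro countable_image countable_int_lattice)
qed

lemma measure_mesh_ball: "measure lborel (ball z (mesh j) :: 'a set) = unit_ball_vol (real DIM('a)) * mesh j ^ DIM('a)"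
  using mesh_pos[of j] by (simp add: content_ball)

lemma measure_mesh_ball_pos: "measure lborel (ball (z::'a) (mesh j)) > 0"
  unfolding measure_mesh_ball using mesh_pos[of j] by simp

lemma integrable_on_ball:
  fixes u :: "'a \<Rightarrow> real"
  assumes u: "u \<in> Hs s"
  shows "integrable lborel (\<lambda>y. u y * indicator (ball z r) y)"
proof -
  note [measurable] = Hs_measurable[OF u]
  have [measurable]: "ball z r \<in> sets borel" by simp
  have i: "integrable lborel (indicator (ball z r) :: 'a \<Rightarrow> real)"
    using emeasure_lborel_ball_finite[of z r] by (intro integrable_real_indicator) auto
  have "indicator (ball z r) y ^ 2 = (indicator (ball z r) y :: real)" for y by (simp add: indicator_def)
  thus ?thesis using integrable_Hs(4)[OF u u] i by (intro integrable_mult_square) auto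
qed

text \<open>Follows from \<open>|u| \<le> u^2 + 1\<close> on the ball. The bound depends on
  \<open>u\<close> only through \<open>C\<close>, as needed for a bounded sequence.\<close>

lemma avg_bound:
  assumes u: "u \<in> Hs s" and C: "B u u \<le> C"
  shows "\<bar>avg j u z\<bar> \<le> (C / \<alpha> + measure lborel (ball z (mesh j))) / measure lborel (ball z (mesh j))"
proof -
  note [measurable] = Hs_measurable[OF u]
  let ?A = "ball z (mesh j)"
  have [measurable]: "?A \<in> sets borel" by simp
  have i: "integrable lborel (indicator ?A :: 'a \<Rightarrow> real)"
    using emeasure_lborel_ball_finite[of z "mesh j"] by (intro integrable_real_indicator) auto
  have "\<bar>\<integral>y. u y * indicator ?A y \<partial>lborel\<bar> \<le> (\<integral>y. \<bar>u y * indicator ?A y\<bar> \<partial>lborel)" by simp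
  also have "\<dots> \<le> (\<integral>y. (u y)\<^sup>2 + indicator ?A y \<partial>lborel)"
  proof (rule integral_mono)
    show "integrable lborel (\<lambda>y. \<bar>u y * indicator ?A y\<bar>)" using integrable_on_ball[OF u] by simp
    show "integrable lborel (\<lambda>y. (u y)\<^sup>2 + indicator ?A y)" using i integrable_Hs(4)[OF u u] by simp
    fix y
    have "2 * \<bar>u y\<bar> * 1 \<le> \<bar>u y\<bar>\<^sup>2 + 1\<^sup>2" by (rule sum_squares_bound)
    thus "\<bar>u y * indicator ?A y\<bar> \<le> (u y)\<^sup>2 + indicator ?A y" by (auto simp: indicator_def)
  qed
  also have "\<dots> = (\<integral>y. (u y)\<^sup>2 \<partial>lborel) + measure lborel ?A"
    using i integrable_Hs(4)[OF u u] by simp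
  also have "\<dots> \<le> C / \<alpha> + measure lborel ?A"
  proof -
    have "B u u / \<alpha> \<le> C / \<alpha>" using C \<alpha> by (simp add: divide_right_mono)
    thus ?thesis using square_le_B[OF u] by linarith
  qed
  finally show ?thesis unfolding avg_def using measure_mesh_ball_pos[of z j] by (simp add: divide_right_mono)
qed

lemma avg_measurable:
  assumes u: "u \<in> Hs s" shows "(\<lambda>x. avg j u (node j x)) \<in> borel_measurable borel"
proof -
  note [measurable] = Hs_measurable[OF u]
  have "(\<lambda>x. (\<integral>y. u y * indicator {y. dist (node j x) y < mesh j} y \<partial>lborel) / (unit_ball_vol (real DIM('a)) * mesh j ^ DIM('a))) \<in> borel_measurable borel"
    unfolding indicator_def by measurable
  thus ?thesis unfolding avg_def measure_mesh_ball by (simp add: ball_def)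
qed

text \<open>The difference is an average of \<open>u x - u y\<close> over a ball whose points lie
  within \<open>(N + 1) * mesh j\<close> of \<open>x\<close>, so by Jensen its square is at most the
  Gagliardo density times \<open>((N + 1) * mesh j) powr (N + 2s)\<close>, divided by the volume of
  the ball. The volume cancels \<open>mesh j ^ N\<close> and leaves the small factor
  \<open>mesh j powr (2s)\<close>.\<close>

lemma avg_approx:
  assumes u: "u \<in> Hs s"
  shows "(\<integral>\<^sup>+x. ennreal ((u x - avg j u (node j x))\<^sup>2) \<partial>lborel)
    \<le> ennreal ((real DIM('a) + 1) powr (real DIM('a) + 2 * s) / unit_ball_vol (real DIM('a)) * mesh j powr (2 * s) * B u u)"
proof -
  note [measurable] = Hs_measurable[OF u]
  define N where "N = real DIM('a)"
  define L where "L = ((N + 1) * mesh j) powr (N + 2 * s)"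
  define m where "m = unit_ball_vol N * mesh j ^ DIM('a)"
  have m: "m > 0" using mesh_pos[of j] by (simp add: m_def N_def)
  have L: "L > 0" using mesh_pos[of j] by (simp add: L_def N_def add_nonneg_eq_0_iff)
  have pt: "ennreal ((u x - avg j u (node j x))\<^sup>2) \<le> ennreal (L / m) * gag_density s u x" for x
  proof -
    define A where "A = ball (node j x) (mesh j)"
    have [measurable]: "A \<in> sets borel" by (simp add: A_def)
    have mA: "measure lborel A = m" by (simp add: A_def measure_mesh_ball m_def N_def)
    define g where "g y = (u x - u y) * indicator A y" for y
    have iA: "integrable lborel (indicator A :: 'a \<Rightarrow> real)"
      unfolding A_def using emeasure_lborel_ball_finite[of "node j x" "mesh j"] by (intro integrable_real_indicator) auto
    have iu: "integrable lborel (\<lambda>y. u y * indicator A y)" unfolding A_def by (rule integrable_on_ball[OF u])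
    have ig: "integrable lborel g" unfolding g_def left_diff_distrib using iA iu by simp
    have g2: "(g y)\<^sup>2 = (u x)\<^sup>2 * indicator A y - 2 * u x * (u y * indicator A y) + (u y)\<^sup>2 * indicator A y" for y
      by (simp add: g_def indicator_def power2_diff)
    have iu2: "integrable lborel (\<lambda>y. (u y)\<^sup>2 * indicator A y)"
      by (rule Bochner_Integration.integrable_bound[OF integrable_Hs(4)[OF u u]]) (auto simp: indicator_def)
    have ig2: "integrable lborel (\<lambda>y. (g y)\<^sup>2)" unfolding g2 using iA iu iu2 by simp
    define c where "c = u x - avg j u (node j x)"
    have cm: "(\<integral>y. g y \<partial>lborel) = c * m"
      unfolding g_def left_diff_distrib c_def avg_def A_def[symmetric] mA using iA iu m mA by simp
    \<comment> \<open>Jensen's inequality as nonnegativity of the variance of \<open>g\<close> over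
      the ball \<open>A\<close>.\<close>
    have "0 \<le> (\<integral>y. (g y - c * indicator A y)\<^sup>2 \<partial>lborel)" by simp
    also have "\<dots> = (\<integral>y. (g y)\<^sup>2 - 2 * c * g y + c\<^sup>2 * indicator A y \<partial>lborel)"
      by (rule Bochner_Integration.integral_cong) (auto simp: g_def indicator_def power2_diff)
    also have "\<dots> = (\<integral>y. (g y)\<^sup>2 \<partial>lborel) - 2 * c * (c * m) + c\<^sup>2 * m"
      using ig ig2 iA cm mA by simp
    finally have jensen: "c\<^sup>2 * m \<le> (\<integral>y. (g y)\<^sup>2 \<partial>lborel)" by (simp add: power2_eq_square)
    have "ennreal (\<integral>y. (g y)\<^sup>2 \<partial>lborel) = (\<integral>\<^sup>+y. ennreal ((g y)\<^sup>2) \<partial>lborel)"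
      using ig2 by (simp add: nn_integral_eq_integral)
    also have "\<dots> \<le> (\<integral>\<^sup>+y. ennreal L * ennreal ((u x - u y)\<^sup>2 / norm (x - y) powr (N + 2 * s)) \<partial>lborel)"
    proof (rule nn_integral_mono)
      fix y
      have "(g y)\<^sup>2 \<le> L * ((u x - u y)\<^sup>2 / norm (x - y) powr (N + 2 * s))"
      proof (cases "y \<in> A \<and> x \<noteq> y")
        case True
        have "norm (x - y) \<le> norm (x - node j x) + norm (node j x - y)" by (metis norm_triangle_ineq diff_add_cancel add_diff_eq)
        also have "\<dots> \<le> N * mesh j + mesh j"
          using norm_diff_node[of x j] True by (auto simp: A_def dist_norm N_def intro: add_mono less_imp_le)
        finally have "norm (x - y) powr (N + 2 * s) \<le> L"
          unfolding L_def using s by (intro powr_mono2) (auto simp: N_def algebra_simps)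
        hence "(u x - u y)\<^sup>2 * 1 \<le> (u x - u y)\<^sup>2 * (L / norm (x - y) powr (N + 2 * s))"
          using True by (intro mult_left_mono) (auto simp: field_simps)
        thus ?thesis using True by (simp add: g_def mult.commute)
      next
        case False
        thus ?thesis using L by (auto simp: g_def)
      qed
      thus "ennreal ((g y)\<^sup>2) \<le> ennreal L * ennreal ((u x - u y)\<^sup>2 / norm (x - y) powr (N + 2 * s))"
        using L by (simp add: ennreal_leI flip: ennreal_mult)
    qed
    also have "\<dots> = ennreal L * gag_density s u x"
      unfolding gag_density_def N_def by (rule nn_integral_cmult) measurable
    finally have D: "ennreal (\<integral>y. (g y)\<^sup>2 \<partial>lborel) \<le> ennreal L * gag_density s u x" .
    have "ennreal (c\<^sup>2) \<le> ennreal (1 / m) * ennreal (\<integral>y. (g y)\<^sup>2 \<partial>lborel)"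
      using jensen m by (simp add: ennreal_leI field_simps flip: ennreal_mult)
    also have "\<dots> \<le> ennreal (1 / m) * (ennreal L * gag_density s u x)" using D by (rule mult_left_mono) simp
    also have "\<dots> = ennreal (L / m) * gag_density s u x"
      using m L by (simp add: ennreal_mult[symmetric] mult.assoc[symmetric])
    finally show ?thesis by (simp add: c_def)
  qed
  have "(\<integral>\<^sup>+x. ennreal ((u x - avg j u (node j x))\<^sup>2) \<partial>lborel) \<le> (\<integral>\<^sup>+x. ennreal (L / m) * gag_density s u x \<partial>lborel)"
    by (intro nn_integral_mono pt)
  also have "\<dots> = ennreal (L / m) * gagliardo s u"
    by (simp add: nn_integral_cmult gagliardo_eq_density)
  also have "\<dots> = ennreal (L / m) * ennreal (enn2real (gagliardo s u))"
    using u by (simp add: Hs_def)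
  also have "\<dots> \<le> ennreal (L / m) * ennreal (B u u)"
    using gagliardo_Hs[OF u] dquot_le_B[OF u] by (intro mult_left_mono ennreal_leI) auto
  also have "\<dots> = ennreal (L / m * B u u)" using B_nonneg[OF u] L m by (intro ennreal_mult[symmetric]) auto
  also have "L / m = (N + 1) powr (N + 2 * s) / unit_ball_vol N * mesh j powr (2 * s)"
  proof -
    have "L = (N + 1) powr (N + 2 * s) * (mesh j ^ DIM('a) * mesh j powr (2 * s))"
      unfolding L_def using mesh_pos[of j] by (simp add: powr_mult powr_add N_def powr_realpow)
    thus ?thesis unfolding m_def using mesh_pos[of j] by simp
  qed
  finally show ?thesis by (simp add: N_def)
qed

lemma mesh_powr_tendsto: "(\<lambda>j. mesh j powr (2 * s)) \<longlonglongrightarrow> 0"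
proof -
  have "mesh \<longlonglongrightarrow> 0" using LIMSEQ_inverse_real_of_nat by (simp add: mesh_def[abs_def] divide_inverse)
  hence "(\<lambda>j. mesh j powr (2 * s)) \<longlonglongrightarrow> 0 powr (2 * s)"
    using s mesh_pos by (intro tendsto_powr') (auto simp: less_imp_le)
  thus ?thesis by simp
qed

text \<open>The averaged functions take countably many values, converge at every node along one
  diagonal subsequence and are uniformly bounded, so they are Cauchy in the weighted L2 space.
  Averaging changes each \<open>X n\<close> by an amount that is small uniformly in n.\<close>

lemma rellich:
  assumes X: "\<And>n. X n \<in> Hs s" and C: "\<And>n. B (X n) (X n) \<le> C"
  shows "\<exists>r u. strict_mono (r::nat\<Rightarrow>nat) \<and> u \<in> Hs s \<and> (AE x in lborel. (\<lambda>n. X (r n) x) \<longlonglongrightarrow> u x)"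
proof -
  note [measurable] = Hs_measurable[OF X] avg_measurable[OF X]
  obtain \<omega> :: "'a \<Rightarrow> real" where \<omega> [measurable]: "\<omega> \<in> borel_measurable lborel" and w: "\<And>x. \<omega> x > 0" "\<And>x. \<omega> x \<le> 1" "integrable lborel \<omega>"
    by (rule sigma_finite_measure.obtain_positive_integrable_function[OF sigma_finite_lborel]) blast
  \<comment> \<open>All pairs of a mesh index and a node of that mesh, enumerated to index the
    diagonal argument.\<close>
  define I where "I = (SIGMA j:UNIV. range (node j))"
  have cI: "countable I" unfolding I_def using countable_nodes by (intro countable_SIGMA) auto
  have neI: "I \<noteq> {}" unfolding I_def by auto
  define idx where "idx = from_nat_into I"
  have ridx: "range idx = I" unfolding idx_def by (rule range_from_nat_into[OF neI cI])
  have "\<exists>r. strict_mono (r::nat\<Rightarrow>nat) \<and> (\<forall>i. convergent (\<lambda>n. avg (fst (idx i)) (X (r n)) (snd (idx i))))"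
    by (rule bounded_diagonal_subseq[where a = "\<lambda>i n. avg (fst (idx i)) (X n) (snd (idx i))"]) (rule avg_bound[OF X C])
  then obtain r where r: "strict_mono (r::nat\<Rightarrow>nat)" and conv: "\<And>i. convergent (\<lambda>n. avg (fst (idx i)) (X (r n)) (snd (idx i)))" by blast
  have conv': "convergent (\<lambda>n. avg j (X (r n)) (node j x))" for j x
  proof -
    have "(j, node j x) \<in> range idx" unfolding ridx I_def by auto
    then obtain i where "idx i = (j, node j x)" by (metis imageE)
    thus ?thesis using conv[of i] by simp
  qed
  define K where "K = (real DIM('a) + 1) powr (real DIM('a) + 2 * s) / unit_ball_vol (real DIM('a))"
  have K: "K \<ge> 0" by (simp add: K_def)
  have approx: "(\<integral>\<^sup>+x. ennreal ((X n x - avg j (X n) (node j x))\<^sup>2) \<partial>lborel) \<le> ennreal (K * mesh j powr (2 * s) * C)" for n j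
  proof (rule order_trans[OF avg_approx[OF X]])
    show "ennreal ((real DIM('a) + 1) powr (real DIM('a) + 2 * s) / unit_ball_vol (real DIM('a)) * mesh j powr (2 * s) * B (X n) (X n))
      \<le> ennreal (K * mesh j powr (2 * s) * C)"
      unfolding K_def[symmetric] using K C by (intro ennreal_leI mult_left_mono) auto
  qed
  have "\<exists>r' u. strict_mono (r'::nat\<Rightarrow>nat) \<and> u \<in> borel_measurable lborel \<and> (AE x in lborel. (\<lambda>n. X (r (r' n)) x) \<longlonglongrightarrow> u x)"
  proof (rule L2_Cauchy_AE_convergent_subseq[where X = "\<lambda>n. X (r n)", OF _ \<omega> w(1,3)])
    fix e :: real assume e: "e > 0"
    have "(\<lambda>j. K * mesh j powr (2 * s) * C) \<longlonglongrightarrow> K * 0 * C" by (intro tendsto_intros mesh_powr_tendsto)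
    hence "\<forall>\<^sub>F j in sequentially. K * mesh j powr (2 * s) * C < e / 16" using e by (intro order_tendstoD(2)) auto
    \<comment> \<open>The mesh is fixed before the indices of the sequence. A difference
      \<open>X m - X n\<close> splits into four parts; the square of a sum of four costs a factor 4,
      hence \<open>e / 16\<close> for each part.\<close>
    then obtain j where j: "K * mesh j powr (2 * s) * C < e / 16" by (auto simp: eventually_sequentially)
    define Y where "Y n x = avg j (X (r n)) (node j x)" for n x
    have [measurable]: "Y n \<in> borel_measurable borel" for n unfolding Y_def by measurable
    define l where "l x = lim (\<lambda>n. Y n x)" for x
    have Yl: "(\<lambda>n. Y n x) \<longlonglongrightarrow> l x" for x
      unfolding l_def Y_def using conv' by (simp add: convergent_LIMSEQ_iff)
    have [measurable]: "l \<in> borel_measurable borel" unfolding l_def by measurable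
    define M where "M = (C / \<alpha> + unit_ball_vol (real DIM('a)) * mesh j ^ DIM('a)) / (unit_ball_vol (real DIM('a)) * mesh j ^ DIM('a))"
    have Yb: "\<bar>Y n x\<bar> \<le> M" for n x
      unfolding Y_def M_def using avg_bound[OF X C, of j "r n" "node j x"] by (simp add: measure_mesh_ball)
    have lb: "\<bar>l x\<bar> \<le> M" for x
      by (rule LIMSEQ_le_const2[OF tendsto_rabs[OF Yl]]) (use Yb in auto)
    have dom: "\<omega> x * (Y n x - l x)\<^sup>2 \<le> \<omega> x * (2 * M)\<^sup>2" for n x
    proof -
      have "\<bar>Y n x - l x\<bar> \<le> 2 * M" using Yb[of n x] lb[of x] by linarith
      hence "\<bar>Y n x - l x\<bar>\<^sup>2 \<le> (2 * M)\<^sup>2" by (rule power_mono) simp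
      thus ?thesis using w(1)[of x] by simp
    qed
    have idom: "integrable lborel (\<lambda>x. \<omega> x * (2 * M)\<^sup>2)" using w(3) by simp
    have Yi: "integrable lborel (\<lambda>x. \<omega> x * (Y n x - l x)\<^sup>2)" for n
      by (rule Bochner_Integration.integrable_bound[OF idom]) (use dom w(1) in \<open>auto simp: abs_mult less_imp_le\<close>)
    have "(\<lambda>n. \<integral>x. \<omega> x * (Y n x - l x)\<^sup>2 \<partial>lborel) \<longlonglongrightarrow> (\<integral>x. 0 \<partial>(lborel :: 'a measure))"
    proof (rule integral_dominated_convergence[where w = "\<lambda>x. \<omega> x * (2 * M)\<^sup>2"])
      have "(\<lambda>n. \<omega> x * (Y n x - l x)\<^sup>2) \<longlonglongrightarrow> \<omega> x * (l x - l x)\<^sup>2" for x by (intro tendsto_intros Yl)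
      thus "AE x in lborel. (\<lambda>n. \<omega> x * (Y n x - l x)\<^sup>2) \<longlonglongrightarrow> 0" by simp
    qed (use dom w(1) idom in \<open>auto simp: abs_mult less_imp_le\<close>)
    hence "\<forall>\<^sub>F n in sequentially. (\<integral>x. \<omega> x * (Y n x - l x)\<^sup>2 \<partial>lborel) < e / 16" using e by (intro order_tendstoD(2)) auto
    then obtain n0 where n0: "\<And>n. n \<ge> n0 \<Longrightarrow> (\<integral>x. \<omega> x * (Y n x - l x)\<^sup>2 \<partial>lborel) < e / 16" by (auto simp: eventually_sequentially)
    have Yn: "(\<integral>\<^sup>+x. ennreal (\<omega> x * (Y n x - l x)\<^sup>2) \<partial>lborel) \<le> ennreal (e / 16)" if "n \<ge> n0" for n
      using Yi[of n] n0[OF that] w(1) by (simp add: nn_integral_eq_integral less_imp_le ennreal_leI)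
    have Xn: "(\<integral>\<^sup>+x. ennreal ((X (r n) x - Y n x)\<^sup>2) \<partial>lborel) \<le> ennreal (e / 16)" for n
      unfolding Y_def using j by (intro order_trans[OF approx] ennreal_leI) auto
    have "(\<integral>\<^sup>+ x. ennreal (\<omega> x * (X (r m) x - X (r n) x)\<^sup>2) \<partial>lborel) \<le> ennreal e" if "m \<ge> n0" "n \<ge> n0" for m n
    proof -
      have "(\<integral>\<^sup>+ x. ennreal (\<omega> x * (X (r m) x - X (r n) x)\<^sup>2) \<partial>lborel)
        \<le> (\<integral>\<^sup>+ x. ennreal 4 * (ennreal ((X (r m) x - Y m x)\<^sup>2) + ennreal (\<omega> x * (Y m x - l x)\<^sup>2)
            + ennreal (\<omega> x * (Y n x - l x)\<^sup>2) + ennreal ((X (r n) x - Y n x)\<^sup>2)) \<partial>lborel)"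
      proof (rule nn_integral_mono)
        fix x
        let ?a = "X (r m) x - Y m x" and ?b = "Y m x - l x" and ?c = "Y n x - l x" and ?d = "X (r n) x - Y n x"
        have sq: "(a + b - c - d)\<^sup>2 \<le> 4 * (a\<^sup>2 + b\<^sup>2 + c\<^sup>2 + d\<^sup>2)" for a b c d :: real
          using sum_squares_bound[of a b] sum_squares_bound[of c d]
            sum_squares_bound[of "a + b" "- (c + d)"] by (simp add: power2_eq_square algebra_simps)
        have "(X (r m) x - X (r n) x)\<^sup>2 \<le> 4 * (?a\<^sup>2 + ?b\<^sup>2 + ?c\<^sup>2 + ?d\<^sup>2)"
          using sq[of ?a ?b ?c ?d] by simp
        hence "\<omega> x * (X (r m) x - X (r n) x)\<^sup>2 \<le> \<omega> x * (4 * (?a\<^sup>2 + ?b\<^sup>2 + ?c\<^sup>2 + ?d\<^sup>2))"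
          using w(1)[of x] by (intro mult_left_mono) auto
        also have "\<dots> = 4 * (\<omega> x * ?a\<^sup>2 + \<omega> x * ?b\<^sup>2 + \<omega> x * ?c\<^sup>2 + \<omega> x * ?d\<^sup>2)" by (simp add: algebra_simps)
        also have "\<dots> \<le> 4 * (?a\<^sup>2 + \<omega> x * ?b\<^sup>2 + \<omega> x * ?c\<^sup>2 + ?d\<^sup>2)"
          using w(1,2)[of x] by (intro mult_left_mono add_mono mult_left_le_one_le order_refl) (auto simp: less_imp_le)
        finally have "ennreal (\<omega> x * (X (r m) x - X (r n) x)\<^sup>2) \<le> ennreal (4 * (?a\<^sup>2 + \<omega> x * ?b\<^sup>2 + \<omega> x * ?c\<^sup>2 + ?d\<^sup>2))"
          by (rule ennreal_leI)
        also have "\<dots> = ennreal 4 * (ennreal (?a\<^sup>2) + ennreal (\<omega> x * ?b\<^sup>2) + ennreal (\<omega> x * ?c\<^sup>2) + ennreal (?d\<^sup>2))"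
        proof -
          have nn: "0 \<le> \<omega> x * ?b\<^sup>2" "0 \<le> \<omega> x * ?c\<^sup>2" using w(1)[of x] by auto
          show ?thesis using nn by (simp only: ennreal_mult ennreal_plus add_nonneg_nonneg zero_le_power2 zero_le_numeral)
        qed
        finally show "ennreal (\<omega> x * (X (r m) x - X (r n) x)\<^sup>2) \<le> ennreal 4 * (ennreal (?a\<^sup>2) + ennreal (\<omega> x * ?b\<^sup>2) + ennreal (\<omega> x * ?c\<^sup>2) + ennreal (?d\<^sup>2))" .
      qed
      also have "\<dots> = ennreal 4 * ((\<integral>\<^sup>+x. ennreal ((X (r m) x - Y m x)\<^sup>2) \<partial>lborel) + (\<integral>\<^sup>+x. ennreal (\<omega> x * (Y m x - l x)\<^sup>2) \<partial>lborel)
            + (\<integral>\<^sup>+x. ennreal (\<omega> x * (Y n x - l x)\<^sup>2) \<partial>lborel) + (\<integral>\<^sup>+x. ennreal ((X (r n) x - Y n x)\<^sup>2) \<partial>lborel))"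
        by (simp add: nn_integral_add nn_integral_cmult)
      also have "\<dots> \<le> ennreal 4 * (ennreal (e / 16) + ennreal (e / 16) + ennreal (e / 16) + ennreal (e / 16))"
        by (intro mult_left_mono add_mono Xn Yn that) simp
      also have "ennreal (e / 16) + ennreal (e / 16) + ennreal (e / 16) + ennreal (e / 16) = ennreal (e / 4)"
        using e by (simp flip: ennreal_plus)
      also have "ennreal 4 * ennreal (e / 4) = ennreal (4 * (e / 4))" using e by (intro ennreal_mult[symmetric]) auto
      also have "\<dots> = ennreal e" by simp
      finally show ?thesis .
    qed
    thus "\<exists>K. \<forall>m\<ge>K. \<forall>n\<ge>K. (\<integral>\<^sup>+ x. ennreal (\<omega> x * (X (r m) x - X (r n) x)\<^sup>2) \<partial>lborel) \<le> ennreal e" by blast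
  qed measurable
  then obtain r' u where r': "strict_mono (r'::nat\<Rightarrow>nat)" and um: "u \<in> borel_measurable borel"
    and lim: "AE x in lborel. (\<lambda>n. X (r (r' n)) x) \<longlonglongrightarrow> u x" by auto
  have "u \<in> Hs s" by (rule AE_limit_Hs(1)[OF X um lim C])
  thus ?thesis using strict_mono_o[OF r r'] lim by (auto simp: o_def)
qed

end

section \<open>Vanishing or a nontrivial limit of translates\<close>

lemma square_le_const_plus_powr:
  fixes q :: real assumes "q > 2" "\<epsilon> > 0"
  shows "\<exists>K\<ge>0. \<forall>t::real. t\<^sup>2 \<le> K + \<epsilon> * \<bar>t\<bar> powr q"
proof -
  \<comment> \<open>The point where \<open>\<epsilon> * T powr q = T^2\<close>; the square is
    dominated by the constant before it and by the power after it.\<close>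
  define T where "T = (1 / \<epsilon>) powr (1 / (q - 2))"
  have T: "T > 0" "T powr (q - 2) = 1 / \<epsilon>" using assms by (auto simp: T_def powr_powr)
  have "t\<^sup>2 \<le> T\<^sup>2 + \<epsilon> * \<bar>t\<bar> powr q" for t :: real
  proof (cases "\<bar>t\<bar> \<le> T")
    case True
    hence "\<bar>t\<bar>\<^sup>2 \<le> T\<^sup>2" by (intro power_mono) auto
    moreover have "0 \<le> \<epsilon> * \<bar>t\<bar> powr q" using assms by simp
    ultimately show ?thesis by simp
  next
    case False
    hence "1 / \<epsilon> \<le> \<bar>t\<bar> powr (q - 2)" unfolding T(2)[symmetric] using T(1) assms by (intro powr_mono2) auto
    hence "1 \<le> \<epsilon> * \<bar>t\<bar> powr (q - 2)" using assms by (simp add: field_simps)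
    hence "\<bar>t\<bar> powr 2 * 1 \<le> \<bar>t\<bar> powr 2 * (\<epsilon> * \<bar>t\<bar> powr (q - 2))" by (rule mult_left_mono) simp
    also have "\<dots> = \<epsilon> * (\<bar>t\<bar> powr 2 * \<bar>t\<bar> powr (q - 2))" by (rule mult.left_commute)
    also have "\<bar>t\<bar> powr 2 * \<bar>t\<bar> powr (q - 2) = \<bar>t\<bar> powr q" by (simp flip: powr_add del: powr_numeral)
    finally have "t\<^sup>2 \<le> \<epsilon> * \<bar>t\<bar> powr q" by (simp add: abs_powr_two del: powr_numeral)
    thus ?thesis by (simp add: add_increasing)
  qed
  thus ?thesis by (intro exI[of _ "T\<^sup>2"]) simp
qed

lemma powr_between:
  fixes a b c t :: real assumes "0 \<le> t" "a \<le> b" "b \<le> c"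
  shows "t powr b \<le> t powr a + t powr c"
proof (cases "t \<le> 1")
  case True
  hence "t powr b \<le> t powr a" using assms by (cases "t = 0") (auto intro: powr_mono')
  thus ?thesis by (simp add: add_increasing2)
next
  case False
  hence "t powr b \<le> t powr c" using assms by (intro powr_mono) auto
  thus ?thesis by (simp add: add_increasing)
qed

context schroedinger_space
begin

text \<open>The Sobolev constant, fixed once and expressed with the full form \<open>B\<close>, so
  that later bounds depend on one quantity only.\<close>

definition Sob :: real where
  "Sob = (SOME C. C > 0 \<and> (\<forall>u\<in>Hs s. integrable lborel (\<lambda>x::'a. \<bar>u x\<bar> powr q) \<and>
     (\<integral>x. \<bar>u x\<bar> powr q \<partial>lborel) \<le> C * (B u u) powr (q / 2)))"

lemma Sob: "Sob > 0" "u \<in> Hs s \<Longrightarrow> integrable lborel (\<lambda>x. \<bar>u x\<bar> powr q)"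
  "u \<in> Hs s \<Longrightarrow> (\<integral>x. \<bar>u x\<bar> powr q \<partial>lborel) \<le> Sob * (B u u) powr (q / 2)"
proof -
  obtain C where C: "C > 0" "\<And>u::'a\<Rightarrow>real. u \<in> Hs s \<Longrightarrow> integrable lborel (\<lambda>x. \<bar>u x\<bar> powr q) \<and>
     (\<integral>x. \<bar>u x\<bar> powr q \<partial>lborel) \<le> C * enn2real (gagliardo s u) powr (q / 2)"
    using sobolev_inequality[OF frac_exponents] by blast
  have "\<exists>C. C > 0 \<and> (\<forall>u\<in>Hs s. integrable lborel (\<lambda>x::'a. \<bar>u x\<bar> powr q) \<and>
     (\<integral>x. \<bar>u x\<bar> powr q \<partial>lborel) \<le> C * (B u u) powr (q / 2))"
  proof (intro exI[of _ C] conjI ballI C(1))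
    fix u :: "'a \<Rightarrow> real" assume u: "u \<in> Hs s"
    show "integrable lborel (\<lambda>x::'a. \<bar>u x\<bar> powr q)" using C(2)[OF u] by blast
    have "enn2real (gagliardo s u) powr (q / 2) \<le> (B u u) powr (q / 2)"
      using gagliardo_Hs[OF u] dquot_le_B[OF u] q_gt_2 by (intro powr_mono2) auto
    hence "C * enn2real (gagliardo s u) powr (q / 2) \<le> C * (B u u) powr (q / 2)" using C(1) by simp
    thus "(\<integral>x. \<bar>u x\<bar> powr q \<partial>lborel) \<le> C * (B u u) powr (q / 2)" using C(2)[OF u] by linarith
  qed
  from someI_ex[OF this, folded Sob_def]
  show "Sob > 0" "u \<in> Hs s \<Longrightarrow> integrable lborel (\<lambda>x. \<bar>u x\<bar> powr q)"
    "u \<in> Hs s \<Longrightarrow> (\<integral>x. \<bar>u x\<bar> powr q \<partial>lborel) \<le> Sob * (B u u) powr (q / 2)" by auto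
qed

lemma powr_q_bound:
  assumes u: "u \<in> Hs s" and C: "B u u \<le> C"
  shows "(\<integral>x. \<bar>u x\<bar> powr q \<partial>lborel) \<le> Sob * C powr (q / 2)"
proof -
  have "(B u u) powr (q / 2) \<le> C powr (q / 2)" using C B_nonneg[OF u] q_gt_2 by (intro powr_mono2) auto
  hence "Sob * (B u u) powr (q / 2) \<le> Sob * C powr (q / 2)" using Sob(1) by simp
  thus ?thesis using Sob(3)[OF u] by linarith
qed

lemma square_bound:
  assumes u: "u \<in> Hs s" and C: "B u u \<le> C"
  shows "(\<integral>x. (u x)\<^sup>2 \<partial>lborel) \<le> C / \<alpha>"
proof -
  have "B u u / \<alpha> \<le> C / \<alpha>" using C \<alpha> by (simp add: divide_right_mono)
  thus ?thesis using square_le_B[OF u] by linarith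
qed

lemma integrable_powr_p:
  fixes u :: "'a \<Rightarrow> real"
  assumes u: "u \<in> Hs s" shows "integrable lborel (\<lambda>x. \<bar>u x\<bar> powr p)"
proof (rule Bochner_Integration.integrable_bound)
  note [measurable] = Hs_measurable[OF u]
  show "integrable lborel (\<lambda>x. (u x)\<^sup>2 + \<bar>u x\<bar> powr q)" using integrable_Hs(4)[OF u u] Sob(2)[OF u] by simp
  have "\<bar>u x\<bar> powr p \<le> (u x)\<^sup>2 + \<bar>u x\<bar> powr q" for x
    using powr_between[of "\<bar>u x\<bar>" 2 p q] p_gt_2 p_less_q by (simp add: abs_powr_two del: powr_numeral)
  thus "AE x in lborel. norm (\<bar>u x\<bar> powr p) \<le> norm ((u x)\<^sup>2 + \<bar>u x\<bar> powr q)" by (simp add: abs_of_nonneg)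
  show "(\<lambda>x. \<bar>u x\<bar> powr p) \<in> borel_measurable lborel" by measurable
qed

text \<open>If the limit vanished, the squares would tend to 0 in L1 of the ball:
  \<open>t^2 \<le> K + \<epsilon> * |t| powr q\<close>, where \<open>K\<close> is integrable over
  the ball and the \<open>q\<close>-integrals are bounded. Strong local L2 convergence is not
  invoked.\<close>

lemma nontrivial_limit:
  assumes X: "\<And>n. X n \<in> Hs s" and C: "\<And>n. B (X n) (X n) \<le> C" and lim: "AE x in lborel. (\<lambda>n. X n x) \<longlonglongrightarrow> u x"
    and \<eta>: "\<eta> > 0" "\<And>n. \<eta> \<le> (\<integral>x. (X n x)\<^sup>2 * indicator (ball z R) x \<partial>lborel)"
  shows "nontrivial u"
proof (rule ccontr)
  assume "\<not> nontrivial u"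
  hence u0: "AE x in lborel. u x = 0" by (simp add: nontrivial_def)
  note [measurable] = Hs_measurable[OF X]
  have [measurable]: "ball z R \<in> sets borel" by simp
  have i: "integrable lborel (indicator (ball z R) :: 'a \<Rightarrow> real)"
    using emeasure_lborel_ball_finite[of z R] by (intro integrable_real_indicator) auto
  have "(\<lambda>n. \<integral>x. \<bar>(X n x)\<^sup>2 * indicator (ball z R) x\<bar> \<partial>lborel) \<longlonglongrightarrow> 0"
  proof (rule AE_tendsto_imp_integral_tendsto_0(2)[where k = "\<lambda>n x. \<bar>X n x\<bar> powr q"])
    show "AE x in lborel. (\<lambda>n. (X n x)\<^sup>2 * indicator (ball z R) x) \<longlonglongrightarrow> 0"
      using lim u0
    proof eventually_elim
      case (elim x)
      have "(\<lambda>n. (X n x)\<^sup>2 * indicator (ball z R) x) \<longlonglongrightarrow> (u x)\<^sup>2 * indicator (ball z R) x"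
        by (intro tendsto_intros elim(1))
      thus ?case using elim(2) by simp
    qed
    show "(\<integral>x. \<bar>X n x\<bar> powr q \<partial>lborel) \<le> Sob * C powr (q / 2)" for n by (rule powr_q_bound[OF X C])
    fix \<epsilon> :: real assume "\<epsilon> > 0"
    then obtain K where K: "K \<ge> 0" "\<And>t::real. t\<^sup>2 \<le> K + \<epsilon> * \<bar>t\<bar> powr q" using square_le_const_plus_powr[OF q_gt_2] by blast
    show "\<exists>\<Phi>. integrable lborel \<Phi> \<and> (\<forall>n x. \<bar>(X n x)\<^sup>2 * indicator (ball z R) x\<bar> \<le> \<Phi> x + \<epsilon> * \<bar>X n x\<bar> powr q)"
    proof (intro exI[of _ "\<lambda>x. K * indicator (ball z R) x"] conjI allI)
      show "integrable lborel (\<lambda>x. K * indicator (ball z R) x)" using i by simp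
      show "\<bar>(X n x)\<^sup>2 * indicator (ball z R) x\<bar> \<le> K * indicator (ball z R) x + \<epsilon> * \<bar>X n x\<bar> powr q" for n x
        using K(2)[of "X n x"] \<open>\<epsilon> > 0\<close> by (auto simp: indicator_def)
    qed
  qed (auto intro: Sob(2)[OF X])
  hence "(\<lambda>n. \<integral>x. (X n x)\<^sup>2 * indicator (ball z R) x \<partial>lborel) \<longlonglongrightarrow> 0" by simp
  hence "\<eta> \<le> 0" by (rule LIMSEQ_le_const) (use \<eta>(2) in auto)
  thus False using \<eta>(1) by simp
qed

text \<open>Either the masses in unit balls tend to 0 uniformly, and
  \<open>vanishing_inequality\<close> applies, or some mass \<eta> persists along a subsequence.
  Translation by a lattice vector, which preserves \<open>B\<close>, then moves that mass into a
  fixed ball, and an almost everywhere limit there cannot vanish.\<close>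

lemma lions_alternative:
  assumes X: "\<And>n. X n \<in> Hs s" and C: "\<And>n. B (X n) (X n) \<le> C"
  shows "(\<lambda>n. \<integral>x. \<bar>X n x\<bar> powr p \<partial>lborel) \<longlonglongrightarrow> 0 \<or>
    (\<exists>r k u. strict_mono (r::nat\<Rightarrow>nat) \<and> (\<forall>n. k n \<in> int_lattice) \<and> u \<in> Hs s \<and> nontrivial u \<and>
      (AE x in lborel. (\<lambda>n. shift (k n) (X (r n)) x) \<longlonglongrightarrow> u x))"
proof (cases "\<forall>\<eta>>0. \<forall>\<^sub>F n in sequentially. \<forall>x. (\<integral>y. (X n y)\<^sup>2 * indicator (ball x 1) y \<partial>lborel) \<le> \<eta>")
  case True
  have C0: "C \<ge> 0" using B_nonneg[OF X[of 0]] C[of 0] by linarith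
  obtain Cv where Cv: "Cv > 0" "\<And>(u::'a\<Rightarrow>real) \<mu>. u \<in> Hs s \<Longrightarrow> \<mu> > 0 \<Longrightarrow>
     (\<And>x. (\<integral>y. (u y)\<^sup>2 * indicator (ball x 1) y \<partial>lborel) \<le> \<mu>) \<Longrightarrow> integrable lborel (\<lambda>x. \<bar>u x\<bar> powr p) \<and>
     (\<integral>x. \<bar>u x\<bar> powr p \<partial>lborel) \<le> Cv * \<mu> powr (2 * s / real DIM('a)) * (enn2real (gagliardo s u) + (\<integral>x. (u x)\<^sup>2 \<partial>lborel))"
    using vanishing_inequality[OF frac_exponents] by blast
  define K where "K = Cv * (C + C / \<alpha>) + 1"
  have K: "K > 0" using Cv C0 \<alpha> by (simp add: K_def add_nonneg_pos)
  have "(\<lambda>n. \<integral>x. \<bar>X n x\<bar> powr p \<partial>lborel) \<longlonglongrightarrow> 0"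
  proof (rule tendstoI)
    fix e :: real assume e: "e > 0"
    define d where "d = e / (2 * K)"
    have d: "d > 0" using e K by (simp add: d_def)
    \<comment> \<open>Solves \<open>\<eta> powr (2s/N) = d\<close>, the factor by which
      \<open>vanishing_inequality\<close> multiplies the bounded quantities.\<close>
    define \<eta> where "\<eta> = d powr (real DIM('a) / (2 * s))"
    have eta: "\<eta> > 0" "\<eta> powr (2 * s / real DIM('a)) = d" using d s by (auto simp: \<eta>_def powr_powr)
    have "\<forall>\<^sub>F n in sequentially. \<forall>x. (\<integral>y. (X n y)\<^sup>2 * indicator (ball x 1) y \<partial>lborel) \<le> \<eta>" using True eta by blast
    thus "\<forall>\<^sub>F n in sequentially. dist (\<integral>x. \<bar>X n x\<bar> powr p \<partial>lborel) 0 < e"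
    proof eventually_elim
      case (elim n)
      have "(\<integral>x. \<bar>X n x\<bar> powr p \<partial>lborel) \<le> Cv * d * (enn2real (gagliardo s (X n)) + (\<integral>x. (X n x)\<^sup>2 \<partial>lborel))"
        using Cv(2)[OF X eta(1)] elim eta(2) by auto
      also have "\<dots> \<le> Cv * d * (C + C / \<alpha>)"
        using gagliardo_Hs[OF X, of n] dquot_le_B[OF X, of n] C[of n] square_bound[OF X C, of n] Cv(1) d
        by (intro mult_left_mono add_mono) auto
      also have "\<dots> \<le> K * d" using d by (simp add: K_def algebra_simps)
      also have "\<dots> < e" using e K by (simp add: d_def)
      finally show ?case by (simp add: abs_of_nonneg)
    qed
  qed
  thus ?thesis ..
next
  case False
  then obtain \<eta> where eta: "\<eta> > 0" and inf: "\<exists>\<^sub>F n in sequentially. \<exists>x. \<eta> < (\<integral>y. (X n y)\<^sup>2 * indicator (ball x 1) y \<partial>lborel)"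
    by (auto simp: frequently_def not_le[symmetric] simp del: not_le)
  have "infinite {n. \<exists>x. \<eta> < (\<integral>y. (X n y)\<^sup>2 * indicator (ball x 1) y \<partial>lborel)}"
    using inf by (simp add: frequently_cofinite[symmetric] cofinite_eq_sequentially)
  then obtain r where r: "strict_mono (r::nat\<Rightarrow>nat)" "\<And>n. \<exists>x. \<eta> < (\<integral>y. (X (r n) y)\<^sup>2 * indicator (ball x 1) y \<partial>lborel)"
    using infinite_enumerate by blast
  then obtain x where x: "\<And>n. \<eta> < (\<integral>y. (X (r n) y)\<^sup>2 * indicator (ball (x n) 1) y \<partial>lborel)" by metis
  define k where "k n = floor_point (x n)" for n
  have k: "k n \<in> int_lattice" for n by (simp add: k_def floor_point_lattice)
  define Y where "Y n = shift (k n) (X (r n))" for n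
  have Y: "Y n \<in> Hs s" for n unfolding Y_def by (rule shift_Hs[OF X])
  have YC: "B (Y n) (Y n) \<le> C" for n unfolding Y_def B_shift[OF k X X] by (rule C)
  \<comment> \<open>A point and its \<open>floor_point\<close> are at distance at most N, so the
    unit ball around \<open>x n\<close> lies in the ball of radius N + 1 around
    \<open>k n\<close>.\<close>
  define R where "R = real DIM('a) + 1"
  have lower: "\<eta> \<le> (\<integral>y. (Y n y)\<^sup>2 * indicator (ball 0 R) y \<partial>lborel)" for n
  proof -
    note [measurable] = Hs_measurable[OF X[of "r n"]]
    have [measurable]: "ball z t \<in> sets borel" for z :: 'a and t by simp
    have ib: "integrable lborel (\<lambda>y. (X (r n) y)\<^sup>2 * indicator (ball z t) y)" for z t
      by (rule Bochner_Integration.integrable_bound[OF integrable_Hs(4)[OF X X, of "r n"]]) (auto simp: indicator_def)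
    have "\<eta> \<le> (\<integral>y. (X (r n) y)\<^sup>2 * indicator (ball (x n) 1) y \<partial>lborel)" using x[of n] by simp
    also have "\<dots> \<le> (\<integral>y. (X (r n) y)\<^sup>2 * indicator (ball (k n) R) y \<partial>lborel)"
    proof (rule integral_mono[OF ib ib])
      fix y
      have "ball (x n) 1 \<subseteq> ball (k n) R"
      proof
        fix y assume "y \<in> ball (x n) 1"
        moreover have "dist (k n) (x n) \<le> real DIM('a)"
          using norm_diff_floor_point[of "x n"] by (simp add: k_def dist_norm norm_minus_commute)
        ultimately have "dist (k n) y < R" using dist_triangle[of "k n" y "x n"] by (simp add: R_def)
        thus "y \<in> ball (k n) R" by simp
      qed
      thus "(X (r n) y)\<^sup>2 * indicator (ball (x n) 1) y \<le> (X (r n) y)\<^sup>2 * indicator (ball (k n) R) y"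
        by (auto simp: indicator_def)
    qed
    also have "\<dots> = (\<integral>y. (X (r n) (y + k n))\<^sup>2 * indicator (ball (k n) R) (y + k n) \<partial>lborel)"
      by (rule lborel_integral_shift(1)[symmetric, of "\<lambda>y. (X (r n) y)\<^sup>2 * indicator (ball (k n) R) y"]) measurable
    also have "\<dots> = (\<integral>y. (Y n y)\<^sup>2 * indicator (ball 0 R) y \<partial>lborel)"
      by (rule Bochner_Integration.integral_cong) (auto simp: Y_def shift_def indicator_def dist_norm)
    finally show ?thesis .
  qed
  from rellich[of Y C, OF Y YC] obtain r' u where r': "strict_mono (r'::nat\<Rightarrow>nat)" and u: "u \<in> Hs s"
    and lim: "AE x in lborel. (\<lambda>n. Y (r' n) x) \<longlonglongrightarrow> u x"
    by (elim exE conjE)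
  have nt: "nontrivial u"
    by (rule nontrivial_limit[where X = "\<lambda>n. Y (r' n)", OF Y YC lim eta lower])
  have "strict_mono (\<lambda>n. r (r' n))" using strict_mono_o[OF r(1) r'] by (simp add: o_def)
  thus ?thesis using k u nt lim unfolding Y_def
    by (intro disjI2 exI[of _ "\<lambda>n. r (r' n)"] exI[of _ "\<lambda>n. k (r' n)"] exI[of _ u]) auto
qed

end

section \<open>A nontrivial element of the fractional Sobolev space\<close>

lemma kernel_integral_finite:
  assumes s: "0 < s" "s < 1"
  shows "(\<integral>\<^sup>+z. ennreal (min 1 ((norm z)\<^sup>2) / norm z powr (real DIM('a) + 2 * s)) \<partial>(lborel :: 'a::euclidean_space measure)) < \<infinity>"
proof -
  define N where "N = real DIM('a)"
  define w where "w = unit_ball_vol N"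
  have w: "w > 0" and N0: "N > 0" by (simp_all add: w_def N_def)
  \<comment> \<open>Bounds on dyadic shells: \<open>a j\<close> for
    \<open>2^(-j-1) \<le> |z| < 2^(-j)\<close> and \<open>b j\<close> for
    \<open>2^j \<le> |z| < 2^(j+1)\<close>. Multiplied by the volumes of the enclosing balls they
    form geometric series with ratios \<open>2 powr (2s - 2)\<close> and
    \<open>2 powr (-2s)\<close>, both below 1 because 0 < s < 1.\<close>
  define a where "a j = ((1/2) ^ j)\<^sup>2 / ((1/2) ^ Suc j) powr (N + 2 * s)" for j :: nat
  define b where "b j = 1 / (2 ^ j) powr (N + 2 * s)" for j :: nat
  have a0: "a j \<ge> 0" and b0: "b j \<ge> 0" for j by (simp_all add: a_def b_def)
  let ?m = "\<lambda>z::'a. min 1 ((norm z)\<^sup>2) / norm z powr (N + 2 * s)"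
  have single: "g j \<le> (\<Sum>j. g j)" for g :: "nat \<Rightarrow> ennreal" and j
    using sum_le_suminf[of g "{j}"] by simp
  have pt: "ennreal (?m z) \<le> (\<Sum>j. ennreal (a j) * indicator (ball 0 ((1/2) ^ j)) z) + (\<Sum>j. ennreal (b j) * indicator (ball 0 (2 ^ Suc j)) z)" for z :: 'a
  proof (cases "z = 0")
    case False
    show ?thesis
    proof (cases "norm z < 1")
      case True
      have ex: "\<exists>n. (1/2::real) ^ Suc n \<le> norm z"
      proof -
        obtain n where "(1/2::real) ^ n < norm z" using real_arch_pow_inv[of "norm z" "1/2"] False by auto
        moreover have "(1/2::real) ^ Suc n \<le> (1/2) ^ n" by simp
        ultimately show ?thesis by (intro exI[of _ n]) linarith
      qed
      define j where "j = (LEAST n. (1/2::real) ^ Suc n \<le> norm z)"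
      have j1: "(1/2::real) ^ Suc j \<le> norm z" unfolding j_def using ex by (rule LeastI_ex)
      have j2: "norm z < (1/2) ^ j"
      proof (cases j)
        case (Suc i)
        hence "\<not> (1/2::real) ^ Suc i \<le> norm z" using not_less_Least[of i "\<lambda>n. (1/2::real) ^ Suc n \<le> norm z"] j_def by simp
        thus ?thesis using Suc by simp
      qed (use True in simp)
      have "?m z \<le> a j" unfolding a_def
      proof (rule frac_le)
        show "min 1 ((norm z)\<^sup>2) \<le> ((1/2) ^ j)\<^sup>2" using j2 by (intro min.coboundedI2 power_mono) auto
        show "((1/2) ^ Suc j) powr (N + 2 * s) \<le> norm z powr (N + 2 * s)"
          using j1 s N0 by (intro powr_mono2) auto
      qed auto
      hence "ennreal (?m z) \<le> ennreal (a j) * indicator (ball 0 ((1/2) ^ j)) z"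
        using j2 by (simp add: ennreal_leI)
      also have "\<dots> \<le> (\<Sum>j. ennreal (a j) * indicator (ball 0 ((1/2) ^ j)) z)"
        by (rule single)
      finally show ?thesis by (rule order_trans) simp
    next
      case F: False
      have ex: "\<exists>n. norm z < 2 ^ Suc n"
      proof -
        obtain n where "norm z < 2 ^ n" using real_arch_pow[of 2 "norm z"] by auto
        moreover have "(2::real) ^ n \<le> 2 ^ Suc n" by simp
        ultimately show ?thesis by (intro exI[of _ n]) linarith
      qed
      define j where "j = (LEAST n. norm z < 2 ^ Suc n)"
      have j1: "norm z < 2 ^ Suc j" unfolding j_def using ex by (rule LeastI_ex)
      have j2: "2 ^ j \<le> norm z"
      proof (cases j)
        case (Suc i)
        hence "\<not> norm z < 2 ^ Suc i" using not_less_Least[of i "\<lambda>n. norm z < 2 ^ Suc n"] j_def by simp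
        thus ?thesis using Suc by simp
      qed (use F in simp)
      have "?m z \<le> b j" unfolding b_def
      proof (rule frac_le)
        show "(2 ^ j) powr (N + 2 * s) \<le> norm z powr (N + 2 * s)" using j2 s N0 by (intro powr_mono2) auto
      qed auto
      hence "ennreal (?m z) \<le> ennreal (b j) * indicator (ball 0 (2 ^ Suc j)) z" using j1 by (simp add: ennreal_leI)
      also have "\<dots> \<le> (\<Sum>j. ennreal (b j) * indicator (ball 0 (2 ^ Suc j)) z)"
        by (rule single)
      finally show ?thesis by (rule order_trans) simp
    qed
  qed simp
  have sa: "a j * (w * ((1/2) ^ j) ^ DIM('a)) = w * 2 powr (N + 2 * s) * (2 powr (2 * s - 2)) ^ j" for j
  proof -
    have h: "(1/2::real) ^ i = 2 powr (- real i)" for i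
    proof -
      have "(1/2::real) ^ i = inverse (2 powr real i)" by (simp add: powr_realpow field_simps)
      also have "\<dots> = 2 powr (- real i)" by (rule powr_minus[symmetric])
      finally show ?thesis .
    qed
    have "a j = 2 powr (- real j + - real j) / 2 powr (- real (Suc j) * (N + 2 * s))"
      unfolding a_def h power2_eq_square powr_powr powr_add[of 2 "- real j" "- real j"] ..
    also have "\<dots> = 2 powr (- real j + - real j - - real (Suc j) * (N + 2 * s))" by (rule powr_diff[symmetric])
    also have "\<dots> = 2 powr (- real j * 2 + real (Suc j) * (N + 2 * s))" by (simp add: algebra_simps)
    finally have "a j = 2 powr (- real j * 2 + real (Suc j) * (N + 2 * s))" .
    moreover have "((1/2::real) ^ j) ^ DIM('a) = 2 powr (- real j * N)"
      unfolding power_mult[symmetric] unfolding h by (simp add: N_def)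
    moreover have g: "(2 powr (2 * s - 2)) ^ j = 2 powr ((2 * s - 2) * real j)"
      by (simp add: powr_realpow[symmetric] powr_powr)
    ultimately have "a j * (w * ((1/2) ^ j) ^ DIM('a)) = w * (2 powr (- real j * 2 + real (Suc j) * (N + 2 * s)) * 2 powr (- real j * N))"
      by simp
    also have "\<dots> = w * 2 powr ((N + 2 * s) + (2 * s - 2) * real j)"
    proof -
      have "- real j * 2 + real (Suc j) * (N + 2 * s) + - real j * N = (N + 2 * s) + (2 * s - 2) * real j"
        by (simp add: algebra_simps)
      thus ?thesis by (simp only: powr_add[symmetric])
    qed
    also have "\<dots> = w * 2 powr (N + 2 * s) * (2 powr (2 * s - 2)) ^ j"
      unfolding g powr_add by (simp only: mult.assoc)
    finally show ?thesis .
  qed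
  have sb: "b j * (w * (2 ^ Suc j) ^ DIM('a)) = w * 2 powr N * (2 powr (- 2 * s)) ^ j" for j
  proof -
    have h: "(2::real) ^ i = 2 powr (real i)" for i by (simp add: powr_realpow)
    have "b j = 1 / 2 powr (real j * (N + 2 * s))" unfolding b_def h powr_powr ..
    also have "\<dots> = 2 powr - (real j * (N + 2 * s))" by (rule powr_minus_divide[symmetric])
    finally have "b j = 2 powr (- real j * (N + 2 * s))" by simp
    moreover have "((2::real) ^ Suc j) ^ DIM('a) = 2 powr (real (Suc j) * N)"
      unfolding power_mult[symmetric] unfolding h by (simp add: N_def algebra_simps)
    moreover have g: "(2 powr (- 2 * s)) ^ j = 2 powr ((- 2 * s) * real j)"
      by (simp add: powr_realpow[symmetric] powr_powr)
    ultimately have "b j * (w * (2 ^ Suc j) ^ DIM('a)) = w * (2 powr (- real j * (N + 2 * s)) * 2 powr (real (Suc j) * N))"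
      by simp
    also have "\<dots> = w * 2 powr (- real j * (N + 2 * s) + real (Suc j) * N)" by (simp only: powr_add)
    also have "\<dots> = w * 2 powr (N + (- 2 * s) * real j)" by (simp add: algebra_simps)
    also have "\<dots> = w * 2 powr N * (2 powr (- 2 * s)) ^ j" unfolding g powr_add by (simp only: mult.assoc)
    finally show ?thesis .
  qed
  have ball: "(\<integral>\<^sup>+z. ennreal c * indicator (ball (0::'a) r) z \<partial>lborel) = ennreal (c * (w * r ^ DIM('a)))" if "c \<ge> 0" "r \<ge> 0" for c r
    using that w by (simp add: nn_integral_cmult_indicator emeasure_ball w_def N_def ennreal_mult)
  have [measurable]: "ball (0::'a) r \<in> sets borel" for r by simp
  have "(\<integral>\<^sup>+z. ennreal (?m z) \<partial>lborel) \<le> (\<integral>\<^sup>+z. (\<Sum>j. ennreal (a j) * indicator (ball 0 ((1/2) ^ j)) z) + (\<Sum>j. ennreal (b j) * indicator (ball (0::'a) (2 ^ Suc j)) z) \<partial>lborel)"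
    by (intro nn_integral_mono pt)
  also have "\<dots> = (\<Sum>j. \<integral>\<^sup>+z. ennreal (a j) * indicator (ball (0::'a) ((1/2) ^ j)) z \<partial>lborel) + (\<Sum>j. \<integral>\<^sup>+z. ennreal (b j) * indicator (ball (0::'a) (2 ^ Suc j)) z \<partial>lborel)"
    by (subst nn_integral_add, measurable, subst (1 2) nn_integral_suminf, measurable)
  also have "\<dots> = (\<Sum>j. ennreal (w * 2 powr (N + 2 * s) * (2 powr (2 * s - 2)) ^ j)) + (\<Sum>j. ennreal (w * 2 powr N * (2 powr (- 2 * s)) ^ j))"
    unfolding sa[symmetric] sb[symmetric] using a0 b0 by (simp only: ball zero_le_power zero_le_numeral zero_le_divide_1_iff zero_le_one)
  also have "\<dots> < \<infinity>"
  proof -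
    have g: "(\<Sum>j. ennreal (c * x ^ j)) < top" if "c \<ge> 0" "0 \<le> x" "x < 1" for c x :: real
    proof -
      have "summable (\<lambda>j. c * x ^ j)" using that by (intro summable_mult summable_geometric) auto
      thus ?thesis using that by (subst suminf_ennreal2) (auto simp: ennreal_less_top)
    qed
    have "2 powr (2 * s - 2) < 2 powr 0" "2 powr (- 2 * s) < 2 powr (0::real)" using s by (intro powr_less_mono; simp)+
    thus ?thesis using w by (auto intro!: g simp: ennreal_add_less_top)
  qed
  finally show ?thesis by (simp add: N_def)
qed

text \<open>The tent function is 1-Lipschitz with values in [0, 1], so its difference quotient is
  dominated by the integrable kernel when one of the two points lies in the unit ball, and vanishes
  otherwise. It provides the direction in which the energy becomes negative.\<close>

lemma bump_Hs:
  assumes s: "0 < s" "s < 1"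
  shows "(\<lambda>x::'a::euclidean_space. max 0 (1 - norm x)) \<in> Hs s" "nontrivial (\<lambda>x::'a. max 0 (1 - norm x))"
proof -
  let ?u = "\<lambda>x::'a. max 0 (1 - norm x)"
  have [measurable]: "?u \<in> borel_measurable borel" by measurable
  have [measurable]: "ball (0::'a) r \<in> sets borel" for r by simp
  have i: "integrable lborel (indicator (ball 0 1) :: 'a \<Rightarrow> real)"
    using emeasure_lborel_ball_finite[of 0 1] by (intro integrable_real_indicator) auto
  have L2: "integrable lborel (\<lambda>x. (?u x)\<^sup>2)"
    by (rule Bochner_Integration.integrable_bound[OF i]) (auto simp: indicator_def max_def power_le_one)
  let ?m = "\<lambda>z::'a. ennreal (min 1 ((norm z)\<^sup>2) / norm z powr (real DIM('a) + 2 * s))"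
  define I where "I = (\<integral>\<^sup>+z. ?m z \<partial>lborel)"
  have I: "I < \<infinity>" unfolding I_def by (rule kernel_integral_finite[OF s])
  have shift: "(\<integral>\<^sup>+y. ?m (x - y) \<partial>lborel) = I" "(\<integral>\<^sup>+y. ?m (y - x) \<partial>lborel) = I" for x
  proof -
    show 2: "(\<integral>\<^sup>+y. ?m (y - x) \<partial>lborel) = I"
    proof -
      have "I = (\<integral>\<^sup>+z. ?m z \<partial>(distr lborel borel ((+) (- x))))" unfolding I_def lborel_distr_plus ..
      also have "\<dots> = (\<integral>\<^sup>+y. ?m (- x + y) \<partial>lborel)" by (subst nn_integral_distr) auto
      finally show ?thesis by simp
    qed
    show "(\<integral>\<^sup>+y. ?m (x - y) \<partial>lborel) = I" using 2 by (simp add: norm_minus_commute)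
  qed
  have "gagliardo s ?u \<le> (\<integral>\<^sup>+p. ?m (fst p - snd p) * indicator (ball 0 1) (fst p) + ?m (fst p - snd p) * indicator (ball 0 1) (snd p) \<partial>(lborel \<Otimes>\<^sub>M lborel))"
    unfolding gagliardo_def
  proof (rule nn_integral_mono)
    fix p :: "'a \<times> 'a"
    obtain x y where p: "p = (x, y)" by (cases p)
    show "ennreal ((?u (fst p) - ?u (snd p))\<^sup>2 / norm (fst p - snd p) powr (real DIM('a) + 2 * s))
      \<le> ?m (fst p - snd p) * indicator (ball 0 1) (fst p) + ?m (fst p - snd p) * indicator (ball 0 1) (snd p)"
    proof (cases "x \<in> ball 0 1 \<or> y \<in> ball 0 1")
      case True
      have "\<bar>?u x - ?u y\<bar> \<le> norm (x - y)" using norm_triangle_ineq3[of x y] by (auto simp: max_def abs_le_iff)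
      hence 1: "\<bar>?u x - ?u y\<bar>\<^sup>2 \<le> (norm (x - y))\<^sup>2" by (rule power_mono) simp
      have "\<bar>?u x - ?u y\<bar> \<le> 1" 
      proof -
        have "0 \<le> ?u z \<and> ?u z \<le> 1" for z :: 'a by simp
        from this[of x] this[of y] show ?thesis by linarith
      qed
      hence 2: "\<bar>?u x - ?u y\<bar>\<^sup>2 \<le> 1\<^sup>2" by (rule power_mono) simp
      have "ennreal ((?u x - ?u y)\<^sup>2 / norm (x - y) powr (real DIM('a) + 2 * s)) \<le> ?m (x - y)"
        using 1 2 by (intro ennreal_leI divide_right_mono) auto
      also have "\<dots> \<le> ?m (x - y) * indicator (ball 0 1) x + ?m (x - y) * indicator (ball 0 1) y"
        using True by (auto simp: indicator_def)
      finally show ?thesis by (simp add: p)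
    next
      case False
      thus ?thesis by (simp add: p max_def)
    qed
  qed
  also have "\<dots> = (\<integral>\<^sup>+p. ?m (fst p - snd p) * indicator (ball 0 1) (fst p) \<partial>(lborel \<Otimes>\<^sub>M lborel)) + (\<integral>\<^sup>+p. ?m (fst p - snd p) * indicator (ball 0 1) (snd p) \<partial>(lborel \<Otimes>\<^sub>M lborel))"
    by (rule nn_integral_add) measurable
  also have "(\<integral>\<^sup>+p. ?m (fst p - snd p) * indicator (ball 0 1) (fst p) \<partial>(lborel \<Otimes>\<^sub>M lborel)) = (\<integral>\<^sup>+x. \<integral>\<^sup>+y. ?m (x - y) * indicator (ball 0 1) x \<partial>lborel \<partial>lborel)"
    by (subst lborel.nn_integral_fst[symmetric]) auto
  also have "\<dots> = (\<integral>\<^sup>+x. I * indicator (ball (0::'a) 1) x \<partial>lborel)"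
    by (subst nn_integral_multc) (auto simp: shift)
  also have "(\<integral>\<^sup>+p. ?m (fst p - snd p) * indicator (ball 0 1) (snd p) \<partial>(lborel \<Otimes>\<^sub>M lborel)) = (\<integral>\<^sup>+y. \<integral>\<^sup>+x. ?m (x - y) * indicator (ball 0 1) y \<partial>lborel \<partial>lborel)"
    by (subst lborel_pair.nn_integral_snd[symmetric]) auto
  also have "\<dots> = (\<integral>\<^sup>+x. I * indicator (ball (0::'a) 1) x \<partial>lborel)"
    by (subst nn_integral_multc) (auto simp: shift)
  also have "(\<integral>\<^sup>+x. I * indicator (ball (0::'a) 1) x \<partial>lborel) + (\<integral>\<^sup>+x. I * indicator (ball (0::'a) 1) x \<partial>lborel) < \<infinity>"
    using I emeasure_lborel_ball_finite[of "0::'a" 1]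
    by (simp add: nn_integral_cmult_indicator ennreal_mult_less_top)
  finally show "?u \<in> Hs s" using L2 by (simp add: Hs_def)
  show "nontrivial ?u"
    unfolding nontrivial_def
  proof
    assume "AE x in lborel. ?u x = 0"
    hence "AE x in lborel. x \<notin> ball (0::'a) 1" by eventually_elim (auto simp: max_def split: if_splits)
    hence "ball (0::'a) 1 \<in> null_sets lborel" by (subst AE_iff_null_sets) auto
    hence "emeasure lborel (ball (0::'a) 1) = 0" by auto
    moreover have "unit_ball_vol (real DIM('a)) > 0" by simp
    ultimately show False by (simp add: emeasure_ball)
  qed
qed

subsection \<open>The nonlinearity\<close>

text \<open>Obtained by splitting at \<open>b = \<epsilon> * a\<close>; only smallness of the
  coefficient of \<open>a powr q\<close> matters, so the constants are not optimised.\<close>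

lemma young_powr:
  fixes a b q \<epsilon> :: real
  assumes "0 \<le> a" "0 \<le> b" "1 < q" "0 < \<epsilon>"
  shows "a powr (q - 1) * b \<le> \<epsilon> * a powr q + (1 / \<epsilon>) powr (q - 1) * b powr q"
proof (cases "b \<le> \<epsilon> * a")
  case True
  have "a powr (q - 1) * b \<le> a powr (q - 1) * (\<epsilon> * a)" using True by (intro mult_left_mono) auto
  also have "\<dots> = \<epsilon> * a powr q" using assms by (cases "a = 0") (auto simp: powr_mult_base[symmetric] powr_diff)
  finally show ?thesis by (simp add: add_increasing2)
next
  case False
  hence "a \<le> 1 / \<epsilon> * b" using assms by (simp add: field_simps)
  hence "a powr (q - 1) * b \<le> (1 / \<epsilon> * b) powr (q - 1) * b" using assms by (intro mult_right_mono powr_mono2) auto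
  also have "(1 / \<epsilon> * b) powr (q - 1) = (1 / \<epsilon>) powr (q - 1) * b powr (q - 1)" by (rule powr_mult)
  also have "(1 / \<epsilon>) powr (q - 1) * b powr (q - 1) * b = (1 / \<epsilon>) powr (q - 1) * b powr q"
    using assms by (cases "b = 0") (auto simp: powr_diff)
  finally show ?thesis using assms by (simp add: add_increasing)
qed

lemma young_square:
  fixes a b \<epsilon> :: real assumes "0 < \<epsilon>"
  shows "\<bar>a * b\<bar> \<le> \<epsilon> * a\<^sup>2 + 1 / \<epsilon> * b\<^sup>2"
proof -
  have "\<bar>b\<bar> \<le> \<epsilon> * \<bar>a\<bar> \<or> \<bar>a\<bar> \<le> 1 / \<epsilon> * \<bar>b\<bar>" using assms by (auto simp: field_simps)
  thus ?thesis
  proof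
    assume "\<bar>b\<bar> \<le> \<epsilon> * \<bar>a\<bar>"
    hence "\<bar>a\<bar> * \<bar>b\<bar> \<le> \<bar>a\<bar> * (\<epsilon> * \<bar>a\<bar>)" by (rule mult_left_mono) simp
    hence "\<bar>a * b\<bar> \<le> \<epsilon> * a\<^sup>2" by (simp add: abs_mult power2_eq_square mult_ac)
    moreover have "0 \<le> 1 / \<epsilon> * b\<^sup>2" using assms by simp
    ultimately show ?thesis by linarith
  next
    assume "\<bar>a\<bar> \<le> 1 / \<epsilon> * \<bar>b\<bar>"
    hence "\<bar>a\<bar> * \<bar>b\<bar> \<le> (1 / \<epsilon> * \<bar>b\<bar>) * \<bar>b\<bar>" by (rule mult_right_mono) simp
    hence "\<bar>a * b\<bar> \<le> 1 / \<epsilon> * b\<^sup>2" by (simp add: abs_mult power2_eq_square mult_ac)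
    moreover have "0 \<le> \<epsilon> * a\<^sup>2" using assms by simp
    ultimately show ?thesis by linarith
  qed
qed

lemma powr_add_le:
  fixes a b r :: real assumes "0 \<le> a" "0 \<le> b" "0 \<le> r"
  shows "(a + b) powr r \<le> 2 powr r * (a powr r + b powr r)"
proof -
  have "(a + b) powr r \<le> (2 * max a b) powr r" using assms by (intro powr_mono2) auto
  also have "\<dots> = 2 powr r * (max a b) powr r" by (rule powr_mult)
  also have "(max a b) powr r \<le> a powr r + b powr r" by (simp add: max_def)
  finally show ?thesis by (simp add: mult_left_mono)
qed

section \<open>Growth and oscillation of the nonlinearity, uniformly in space\<close>

locale schroedinger = schroedinger_space s V \<alpha> \<beta> q p
  for s :: real and V :: "'a::euclidean_space \<Rightarrow> real" and \<alpha> \<beta> q p +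
  fixes f :: "'a \<Rightarrow> real \<Rightarrow> real" and lam :: real
  assumes f_cont: "continuous_on UNIV (\<lambda>(x, t). f x t)"
    and f_per: "\<And>x k t. k \<in> int_lattice \<Longrightarrow> f (x + k) t = f x t"
    and f_infty: "\<And>\<epsilon>. \<epsilon> > 0 \<Longrightarrow> \<exists>R. \<forall>x t. \<bar>t\<bar> \<ge> R \<longrightarrow> \<bar>f x t\<bar> \<le> \<epsilon> * \<bar>t\<bar> powr (q - 1)"
    and f_zero: "\<And>\<epsilon>. \<epsilon> > 0 \<Longrightarrow> \<exists>\<delta>>0. \<forall>x t. \<bar>t\<bar> \<le> \<delta> \<longrightarrow> \<bar>f x t\<bar> \<le> \<epsilon> * \<bar>t\<bar>"
    and f_super: "\<And>x. filterlim (\<lambda>t. primF f x t / t\<^sup>2) at_top at_infinity"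
    and lam: "lam \<ge> 1" and f_mono: "\<And>x t \<theta>. 0 \<le> \<theta> \<Longrightarrow> \<theta> \<le> 1 \<Longrightarrow>
            f x (\<theta> * t) * (\<theta> * t) - 2 * primF f x (\<theta> * t) \<le> lam * (f x t * t - 2 * primF f x t)"
begin

abbreviation "F \<equiv> primF f"

text \<open>Reduction modulo the lattice into the closed unit cube. Compactness of the cube makes
  bounds and moduli of continuity of \<open>f\<close> on bounded ranges of t uniform over the whole
  space.\<close>

definition cell :: "'a \<Rightarrow> 'a" where "cell x = x - floor_point x"

lemma f_cell: "f (cell x) t = f x t"
  using f_per[OF int_lattice_uminus[OF floor_point_lattice[of x]], of x t] by (simp add: cell_def)

lemma cell_cbox: "cell x \<in> cbox 0 One"
  unfolding cell_def mem_box by (auto simp: inner_diff_left floor_point_inner) linarith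

lemma f_unif_cont:
  assumes "\<epsilon> > 0"
  shows "\<exists>\<eta>>0. \<forall>x t t'. \<bar>t\<bar> \<le> R \<longrightarrow> \<bar>t'\<bar> \<le> R \<longrightarrow> \<bar>t - t'\<bar> < \<eta> \<longrightarrow> \<bar>f x t - f x t'\<bar> \<le> \<epsilon>"
proof -
  have "uniformly_continuous_on (cbox (0::'a) One \<times> {-R..R}) (\<lambda>(x, t). f x t)"
    by (intro compact_uniformly_continuous continuous_on_subset[OF f_cont] compact_Times) auto
  then obtain \<eta> where \<eta>: "\<eta> > 0" "\<And>p p'. p \<in> cbox (0::'a) One \<times> {-R..R} \<Longrightarrow> p' \<in> cbox 0 One \<times> {-R..R} \<Longrightarrow> dist p' p < \<eta> \<Longrightarrow>
      dist ((\<lambda>(x, t). f x t) p') ((\<lambda>(x, t). f x t) p) < \<epsilon>"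
    using assms unfolding uniformly_continuous_on_def by blast
  have "\<bar>f x t - f x t'\<bar> \<le> \<epsilon>" if "\<bar>t\<bar> \<le> R" "\<bar>t'\<bar> \<le> R" "\<bar>t - t'\<bar> < \<eta>" for x t t'
  proof -
    have "dist (f (cell x) t) (f (cell x) t') < \<epsilon>"
      using \<eta>(2)[of "(cell x, t')" "(cell x, t)"] that cell_cbox[of x] by (auto simp: dist_Pair_Pair dist_real_def abs_le_iff)
    thus ?thesis by (simp add: f_cell dist_real_def)
  qed
  thus ?thesis using \<eta>(1) by blast
qed

lemma f_bounded: "\<exists>M>0. \<forall>x t. \<bar>t\<bar> \<le> R \<longrightarrow> \<bar>f x t\<bar> \<le> M"
proof -
  have "compact ((\<lambda>(x, t). f x t) ` (cbox (0::'a) One \<times> {-R..R}))"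
    by (intro compact_continuous_image continuous_on_subset[OF f_cont] compact_Times) auto
  then obtain M where M: "M > 0" "\<And>y. y \<in> (\<lambda>(x, t). f x t) ` (cbox (0::'a) One \<times> {-R..R}) \<Longrightarrow> norm y \<le> M"
    using compact_imp_bounded bounded_pos by metis
  have "\<bar>f x t\<bar> \<le> M" if "\<bar>t\<bar> \<le> R" for x t
  proof -
    have "f (cell x) t \<in> (\<lambda>(x, t). f x t) ` (cbox (0::'a) One \<times> {-R..R})"
      using cell_cbox[of x] that by (intro image_eqI[of _ _ "(cell x, t)"]) (auto simp: abs_le_iff)
    thus ?thesis using M(2) by (fastforce simp: f_cell)
  qed
  thus ?thesis using M(1) by blast
qed

text \<open>Leaves \<open>\<delta> < |t| < R\<close> as the only range in which (f1) and (f2) are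
  not enough and compactness has to be used.\<close>

lemma f_small_or_large:
  assumes "\<epsilon> > 0"
  obtains \<delta> R where "0 < \<delta>" "\<delta> \<le> R" "1 \<le> R" "\<And>x t. \<bar>t\<bar> \<le> \<delta> \<or> R \<le> \<bar>t\<bar> \<Longrightarrow> \<bar>f x t\<bar> \<le> \<epsilon> * (\<bar>t\<bar> + \<bar>t\<bar> powr (q - 1))"
proof -
  obtain \<delta> where \<delta>: "\<delta> > 0" "\<And>x t. \<bar>t\<bar> \<le> \<delta> \<Longrightarrow> \<bar>f x t\<bar> \<le> \<epsilon> * \<bar>t\<bar>" using f_zero[OF assms] by blast
  obtain R where R: "\<And>x t. R \<le> \<bar>t\<bar> \<Longrightarrow> \<bar>f x t\<bar> \<le> \<epsilon> * \<bar>t\<bar> powr (q - 1)" using f_infty[OF assms] by blast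
  have "\<bar>f x t\<bar> \<le> \<epsilon> * (\<bar>t\<bar> + \<bar>t\<bar> powr (q - 1))" if t: "\<bar>t\<bar> \<le> \<delta> \<or> max R (max 1 \<delta>) \<le> \<bar>t\<bar>" for x t
  proof -
    have "\<bar>f x t\<bar> \<le> \<epsilon> * \<bar>t\<bar> \<or> \<bar>f x t\<bar> \<le> \<epsilon> * \<bar>t\<bar> powr (q - 1)" using t \<delta>(2)[of t x] R[of t x] by auto
    moreover have "0 \<le> \<epsilon> * \<bar>t\<bar>" "0 \<le> \<epsilon> * \<bar>t\<bar> powr (q - 1)" using assms by auto
    ultimately show ?thesis unfolding distrib_left by linarith
  qed
  thus ?thesis using \<delta>(1) by (intro that[of \<delta> "max R (max 1 \<delta>)"]) auto
qed

text \<open>In the middle range both \<open>|t|\<close> and \<open>|t| powr (q - 1)\<close> are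
  bounded below, so a multiple of their minimum dominates the bounded function \<open>f\<close>.
  With the minimum, one estimate serves several ends: after multiplication by \<open>|t|\<close> the
  remainder is at most \<open>|t| powr q\<close> (near zero) and also at most
  \<open>|t| powr p\<close> (vanishing).\<close>

lemma f_growth:
  assumes "\<epsilon> > 0"
  shows "\<exists>C\<ge>0. \<forall>x t. \<bar>f x t\<bar> \<le> \<epsilon> * (\<bar>t\<bar> + \<bar>t\<bar> powr (q - 1)) + C * min \<bar>t\<bar> (\<bar>t\<bar> powr (q - 1))"
proof -
  obtain \<delta> R where \<delta>: "0 < \<delta>" and R: "\<And>x t. \<bar>t\<bar> \<le> \<delta> \<or> R \<le> \<bar>t\<bar> \<Longrightarrow> \<bar>f x t\<bar> \<le> \<epsilon> * (\<bar>t\<bar> + \<bar>t\<bar> powr (q - 1))"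
    using f_small_or_large[OF assms] by metis
  obtain M where M: "M > 0" "\<And>x t. \<bar>t\<bar> \<le> R \<Longrightarrow> \<bar>f x t\<bar> \<le> M" using f_bounded by blast
  define m where "m = min \<delta> (\<delta> powr (q - 1))"
  have m: "m > 0" using \<delta> by (simp add: m_def)
  have "\<bar>f x t\<bar> \<le> \<epsilon> * (\<bar>t\<bar> + \<bar>t\<bar> powr (q - 1)) + M / m * min \<bar>t\<bar> (\<bar>t\<bar> powr (q - 1))" for x t
  proof (cases "\<bar>t\<bar> \<le> \<delta> \<or> R \<le> \<bar>t\<bar>")
    case True
    moreover have "0 \<le> M / m * min \<bar>t\<bar> (\<bar>t\<bar> powr (q - 1))" using M m by simp
    ultimately show ?thesis using R[of t x] by linarith
  next
    case False
    have "\<delta> powr (q - 1) \<le> \<bar>t\<bar> powr (q - 1)" using False \<delta> q_gt_2 by (intro powr_mono2) auto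
    hence "m \<le> min \<bar>t\<bar> (\<bar>t\<bar> powr (q - 1))" using False by (auto simp: m_def min_def)
    hence "M / m * m \<le> M / m * min \<bar>t\<bar> (\<bar>t\<bar> powr (q - 1))" using M m by (intro mult_left_mono) auto
    moreover have "\<bar>f x t\<bar> \<le> M" using False by (intro M(2)) auto
    moreover have "0 \<le> \<epsilon> * (\<bar>t\<bar> + \<bar>t\<bar> powr (q - 1))" using assms by simp
    ultimately show ?thesis using m by simp
  qed
  thus ?thesis using M m by (intro exI[of _ "M / m"]) auto
qed

lemma f_linear_growth: "\<exists>M>0. \<forall>x t. \<bar>f x t\<bar> \<le> M * (\<bar>t\<bar> + \<bar>t\<bar> powr (q - 1))"
proof -
  obtain C where C: "C \<ge> 0" "\<And>x t. \<bar>f x t\<bar> \<le> 1 * (\<bar>t\<bar> + \<bar>t\<bar> powr (q - 1)) + C * min \<bar>t\<bar> (\<bar>t\<bar> powr (q - 1))"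
    using f_growth[of 1] by auto
  have "\<bar>f x t\<bar> \<le> (1 + C) * (\<bar>t\<bar> + \<bar>t\<bar> powr (q - 1))" for x t
  proof -
    have "C * min \<bar>t\<bar> (\<bar>t\<bar> powr (q - 1)) \<le> C * (\<bar>t\<bar> + \<bar>t\<bar> powr (q - 1))"
      using C(1) by (intro mult_left_mono) (auto simp: min_def add_increasing add_increasing2)
    thus ?thesis using C(2)[of x t] by (simp add: distrib_right)
  qed
  thus ?thesis using C(1) by (intro exI[of _ "1 + C"]) auto
qed

text \<open>Stands in for a Lipschitz bound. For t in the middle range three positions of t' occur:
  closer than \<eta>, where uniform continuity gives the error
  \<open>\<epsilon> * \<delta> \<le> \<epsilon> * |t|\<close>; farther but within
  \<open>R + 1\<close>, where boundedness is paid for by \<open>|t - t'| \<ge> \<eta>\<close>;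
  beyond \<open>R + 1\<close>, where \<open>|t - t'| \<ge> 1\<close> pays for \<open>f x t\<close>
  and the growth bound controls \<open>f x t'\<close>.\<close>

lemma f_oscillation:
  assumes "\<epsilon> > 0"
  shows "\<exists>C\<ge>0. \<forall>x t t'. \<bar>f x t - f x t'\<bar> \<le> \<epsilon> * (\<bar>t\<bar> + \<bar>t\<bar> powr (q - 1) + (\<bar>t'\<bar> + \<bar>t'\<bar> powr (q - 1))) + C * \<bar>t - t'\<bar>"
proof -
  obtain \<delta> R where \<delta>: "0 < \<delta>" and R: "\<And>x t. \<bar>t\<bar> \<le> \<delta> \<or> R \<le> \<bar>t\<bar> \<Longrightarrow> \<bar>f x t\<bar> \<le> \<epsilon> * (\<bar>t\<bar> + \<bar>t\<bar> powr (q - 1))"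
    using f_small_or_large[OF assms] by metis
  obtain M where M: "M > 0" "\<And>x t. \<bar>t\<bar> \<le> R + 1 \<Longrightarrow> \<bar>f x t\<bar> \<le> M" using f_bounded by blast
  obtain \<eta> where \<eta>: "\<eta> > 0" "\<And>x t t'. \<bar>t\<bar> \<le> R + 1 \<Longrightarrow> \<bar>t'\<bar> \<le> R + 1 \<Longrightarrow> \<bar>t - t'\<bar> < \<eta> \<Longrightarrow> \<bar>f x t - f x t'\<bar> \<le> \<epsilon> * \<delta>"
    using f_unif_cont[of "\<epsilon> * \<delta>" "R + 1"] assms \<delta> by auto
  define C where "C = 2 * M / \<eta> + M"
  have C: "C \<ge> 0" using M \<eta> by (simp add: C_def)
  define P where "P t = \<epsilon> * (\<bar>t\<bar> + \<bar>t\<bar> powr (q - 1))" for t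
  have P: "P t \<ge> 0" for t using assms by (simp add: P_def)
  have bad: "\<bar>f x t - f x t'\<bar> \<le> P t + P t' + C * \<bar>t - t'\<bar>" if t: "\<delta> < \<bar>t\<bar>" "\<bar>t\<bar> < R" for x t t'
  proof (cases "\<bar>t'\<bar> \<le> R + 1")
    case True
    show ?thesis
    proof (cases "\<bar>t - t'\<bar> < \<eta>")
      case True
      have "\<bar>f x t - f x t'\<bar> \<le> \<epsilon> * \<delta>" using True t \<open>\<bar>t'\<bar> \<le> R + 1\<close> by (intro \<eta>(2)) auto
      also have "\<dots> \<le> \<epsilon> * \<bar>t\<bar>" using t assms by simp
      also have "\<dots> \<le> P t" using assms by (simp add: P_def)
      finally show ?thesis using P[of t'] C by (simp add: add_increasing2)
    next
      case False
      have "\<bar>f x t - f x t'\<bar> \<le> 2 * M" using M(2)[of t x] M(2)[of t' x] t \<open>\<bar>t'\<bar> \<le> R + 1\<close> by linarith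
      also have "2 * M = 2 * M / \<eta> * \<eta>" using \<eta> by simp
      also have "\<dots> \<le> 2 * M / \<eta> * \<bar>t - t'\<bar>" using False M \<eta> by (intro mult_left_mono) auto
      also have "\<dots> \<le> C * \<bar>t - t'\<bar>" using M by (intro mult_right_mono) (auto simp: C_def)
      finally show ?thesis using P[of t] P[of t'] by linarith
    qed
  next
    case False
    hence 1: "1 \<le> \<bar>t - t'\<bar>" using t by linarith
    have "\<bar>f x t\<bar> \<le> M" using t by (intro M(2)) auto
    also have "M * 1 \<le> M * \<bar>t - t'\<bar>" using 1 M by (intro mult_left_mono) auto
    hence "M \<le> M * \<bar>t - t'\<bar>" by simp
    also have "\<dots> \<le> C * \<bar>t - t'\<bar>" using M \<eta> by (intro mult_right_mono) (auto simp: C_def)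
    finally have "\<bar>f x t\<bar> \<le> C * \<bar>t - t'\<bar>" .
    moreover have "\<bar>f x t'\<bar> \<le> P t'" unfolding P_def using False by (intro R) auto
    ultimately show ?thesis using P[of t] by linarith
  qed
  have "\<bar>f x t - f x t'\<bar> \<le> P t + P t' + C * \<bar>t - t'\<bar>" for x t t'
  proof -
    consider "\<delta> < \<bar>t\<bar>" "\<bar>t\<bar> < R" | "\<delta> < \<bar>t'\<bar>" "\<bar>t'\<bar> < R" | "\<bar>t\<bar> \<le> \<delta> \<or> R \<le> \<bar>t\<bar>" "\<bar>t'\<bar> \<le> \<delta> \<or> R \<le> \<bar>t'\<bar>" by linarith
    thus ?thesis
    proof cases
      case 1 thus ?thesis by (rule bad)
    next
      case 2
      from bad[OF this, of x t] show ?thesis by (simp add: abs_minus_commute)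
    next
      case 3
      have "\<bar>f x t\<bar> \<le> P t" "\<bar>f x t'\<bar> \<le> P t'" unfolding P_def using 3 by (auto intro!: R)
      moreover have "0 \<le> C * \<bar>t - t'\<bar>" using C by simp
      ultimately show ?thesis by linarith
    qed
  qed
  thus ?thesis using C by (intro exI[of _ C]) (auto simp: P_def distrib_left)
qed

text \<open>Together with Sobolev's inequality this makes the derivative of the energy uniformly continuous
  on bounded sets.\<close>

lemma f_increment:
  assumes "\<epsilon> > 0"
  shows "\<exists>C\<ge>0. \<forall>x t h \<theta>. \<bar>\<theta>\<bar> \<le> \<bar>h\<bar> \<longrightarrow> \<bar>f x (t + \<theta>) - f x t\<bar>
      \<le> \<epsilon> * ((\<bar>t\<bar> + \<bar>t\<bar> powr (q - 1)) + (\<bar>h\<bar> + \<bar>h\<bar> powr (q - 1))) + C * \<bar>h\<bar>"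
proof -
  \<comment> \<open>Absorbs the constant lost in the power of \<open>|t| + |h|\<close> and the
    doubled \<open>|t|\<close>; \<epsilon> is divided by it in advance. The increment \<theta> is
    kept apart from \<open>h\<close> so that an intermediate point can be inserted.\<close>
  define c where "c = 2 powr (q - 1) + 2"
  have c: "c > 0" by (simp add: c_def add_pos_pos)
  have c2: "2 powr (q - 1) \<ge> 0" by simp
  obtain C where C: "C \<ge> 0" "\<And>x t t'. \<bar>f x t - f x t'\<bar> \<le> \<epsilon> / c * (\<bar>t\<bar> + \<bar>t\<bar> powr (q - 1) + (\<bar>t'\<bar> + \<bar>t'\<bar> powr (q - 1))) + C * \<bar>t - t'\<bar>"
    using f_oscillation[of "\<epsilon> / c"] assms c by auto
  have "\<bar>f x (t + \<theta>) - f x t\<bar> \<le> \<epsilon> * ((\<bar>t\<bar> + \<bar>t\<bar> powr (q - 1)) + (\<bar>h\<bar> + \<bar>h\<bar> powr (q - 1))) + C * \<bar>h\<bar>" if h: "\<bar>\<theta>\<bar> \<le> \<bar>h\<bar>" for x t h \<theta>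
  proof -
    define a where "a = \<bar>t\<bar> powr (q - 1)"
    define b where "b = \<bar>h\<bar> powr (q - 1)"
    have ab: "a \<ge> 0" "b \<ge> 0" by (auto simp: a_def b_def)
    have "\<bar>t + \<theta>\<bar> powr (q - 1) \<le> (\<bar>t\<bar> + \<bar>h\<bar>) powr (q - 1)" using h q_gt_2 by (intro powr_mono2) auto
    also have "\<dots> \<le> 2 powr (q - 1) * (a + b)" unfolding a_def b_def using q_gt_2 by (intro powr_add_le) auto
    finally have 1: "\<bar>t + \<theta>\<bar> powr (q - 1) \<le> 2 powr (q - 1) * (a + b)" .
    have "\<bar>t + \<theta>\<bar> \<le> \<bar>t\<bar> + \<bar>h\<bar>" using h by linarith
    hence "\<bar>t + \<theta>\<bar> + \<bar>t + \<theta>\<bar> powr (q - 1) + (\<bar>t\<bar> + a) \<le> (2 * \<bar>t\<bar> + \<bar>h\<bar>) + (2 powr (q - 1) * (a + b) + a)"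
      using 1 by linarith
    also have "\<dots> \<le> c * (\<bar>t\<bar> + \<bar>h\<bar>) + c * (a + b)"
    proof (rule add_mono)
      have "0 \<le> 2 powr (q - 1) * (\<bar>t\<bar> + \<bar>h\<bar>)" using c2 by (intro mult_nonneg_nonneg) auto
      thus "2 * \<bar>t\<bar> + \<bar>h\<bar> \<le> c * (\<bar>t\<bar> + \<bar>h\<bar>)" unfolding c_def distrib_right distrib_left by linarith
      show "2 powr (q - 1) * (a + b) + a \<le> c * (a + b)" unfolding c_def distrib_right distrib_left using ab by linarith
    qed
    also have "\<dots> = c * ((\<bar>t\<bar> + a) + (\<bar>h\<bar> + b))" by (simp add: algebra_simps)
    finally have "\<epsilon> / c * (\<bar>t + \<theta>\<bar> + \<bar>t + \<theta>\<bar> powr (q - 1) + (\<bar>t\<bar> + a)) \<le> \<epsilon> / c * (c * ((\<bar>t\<bar> + a) + (\<bar>h\<bar> + b)))"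
      using assms c by (intro mult_left_mono) auto
    also have "\<dots> = \<epsilon> * ((\<bar>t\<bar> + a) + (\<bar>h\<bar> + b))" using c by simp
    finally have "\<epsilon> / c * (\<bar>t + \<theta>\<bar> + \<bar>t + \<theta>\<bar> powr (q - 1) + (\<bar>t\<bar> + a)) \<le> \<epsilon> * ((\<bar>t\<bar> + a) + (\<bar>h\<bar> + b))" .
    moreover have "C * \<bar>t + \<theta> - t\<bar> \<le> C * \<bar>h\<bar>" using h C(1) by (intro mult_left_mono) auto
    ultimately show ?thesis using C(2)[of x "t + \<theta>" t] unfolding a_def[symmetric] b_def[symmetric]
      by (meson add_mono order_trans)
  qed
  thus ?thesis using C(1) by blast
qed

section \<open>The primitive and the consequences of (f4)\<close>

lemma f_cont_t: "continuous_on A (f x)"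
proof -
  have "continuous_on UNIV (\<lambda>t. (\<lambda>(x, t). f x t) (x, t))"
    by (rule continuous_on_compose2[OF f_cont]) (auto intro: continuous_intros)
  thus ?thesis by (auto intro: continuous_on_subset)
qed

lemma f_measurable2 [measurable]: "(\<lambda>z. f (fst z) (snd z)) \<in> borel_measurable borel"
  using borel_measurable_continuous_onI[OF f_cont] by (simp add: case_prod_unfold)

lemma f_measurable [measurable (raw)]:
  assumes [measurable]: "g \<in> borel_measurable M" "u \<in> borel_measurable M"
  shows "(\<lambda>x. f (g x) (u x)) \<in> borel_measurable M"
proof -
  have "(\<lambda>x. (g x, u x)) \<in> borel_measurable M" by measurable
  from measurable_compose[OF this f_measurable2] show ?thesis by simp
qed

text \<open>Moves the limit of integration into the integrand, where measurability in a variable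
  upper limit is immediate.\<close>

lemma F_eq: "F x t = (if 0 \<le> t then (\<integral>\<tau>. (if 0 < \<tau> \<and> \<tau> < t then f x \<tau> else 0) \<partial>lborel)
    else - (\<integral>\<tau>. (if t < \<tau> \<and> \<tau> < 0 then f x \<tau> else 0) \<partial>lborel))"
  unfolding primF_def interval_lebesgue_integral_def set_lebesgue_integral_def
  by (auto simp: einterval_def indicator_def zero_ereal_def intro!: Bochner_Integration.integral_cong)

lemma F_measurable [measurable (raw)]:
  assumes [measurable]: "u \<in> borel_measurable borel"
  shows "(\<lambda>x. F x (u x)) \<in> borel_measurable borel"
  unfolding F_eq by measurable

lemma F_0 [simp]: "F x 0 = 0"
proof -
  have "\<not> (0 < \<tau> \<and> \<tau> < 0)" for \<tau> :: real by auto
  thus ?thesis by (simp only: F_eq if_False) simp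
qed

lemma F_deriv: "(F x has_real_derivative f x t) (at t)"
proof -
  define T where "T = \<bar>t\<bar> + 1"
  have "((\<lambda>u. LBINT y=0..u. f x y) has_vector_derivative f x t) (at t within {-T..T})"
    using interval_integral_FTC2[of "- T" 0 T "f x" t] f_cont_t[of "{-T..T}" x] by (auto simp: T_def zero_ereal_def)
  hence "((\<lambda>u. LBINT y=0..u. f x y) has_vector_derivative f x t) (at t within {-T<..<T})"
    by (rule has_vector_derivative_within_subset) auto
  moreover have "t \<in> {-T<..<T}" by (auto simp: T_def)
  ultimately have "((\<lambda>u. LBINT y=0..u. f x y) has_vector_derivative f x t) (at t)"
    by (simp add: at_within_open[of t "{-T<..<T}"])
  thus ?thesis by (simp add: primF_def[abs_def] has_real_derivative_iff_has_vector_derivative)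
qed

lemma F_mvt: "\<exists>\<theta>. \<bar>\<theta>\<bar> \<le> \<bar>h\<bar> \<and> F x (t + h) - F x t = h * f x (t + \<theta>)"
proof -
  consider "h = 0" | "h > 0" | "h < 0" by linarith
  thus ?thesis
  proof cases
    case 2
    from MVT2[of t "t + h" "F x" "f x"] F_deriv 2
    obtain z where "t < z" "z < t + h" "F x (t + h) - F x t = h * f x z" by auto
    thus ?thesis by (intro exI[of _ "z - t"]) auto
  next
    case 3
    from MVT2[of "t + h" t "F x" "f x"] F_deriv 3
    obtain z where "t + h < z" "z < t" "F x t - F x (t + h) = - h * f x z" by auto
    thus ?thesis using 3 by (intro exI[of _ "z - t"]) auto
  qed auto
qed

text \<open>For \<open>F\<close> the mean value theorem yields an intermediate point of modulus at
  most \<open>|t|\<close>; since the growth bound \<open>P\<close> is increasing, it may be replaced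
  by t.\<close>

lemma fF_growth:
  assumes "\<epsilon> > 0"
  shows "\<exists>C\<ge>0. \<forall>x t. \<bar>f x t * t\<bar> \<le> \<epsilon> * (t\<^sup>2 + \<bar>t\<bar> powr q) + C * min (t\<^sup>2) (\<bar>t\<bar> powr q) \<and>
      \<bar>F x t\<bar> \<le> \<epsilon> * (t\<^sup>2 + \<bar>t\<bar> powr q) + C * min (t\<^sup>2) (\<bar>t\<bar> powr q)"
proof -
  obtain C where C: "C \<ge> 0" "\<And>x t. \<bar>f x t\<bar> \<le> \<epsilon> * (\<bar>t\<bar> + \<bar>t\<bar> powr (q - 1)) + C * min \<bar>t\<bar> (\<bar>t\<bar> powr (q - 1))"
    using f_growth[OF assms] by blast
  define P where "P t = \<epsilon> * (t + t powr (q - 1)) + C * min t (t powr (q - 1))" for t :: real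
  have Pmono: "P a \<le> P b" if "0 \<le> a" "a \<le> b" for a b
  proof -
    have "a powr (q - 1) \<le> b powr (q - 1)" using that q_gt_2 by (intro powr_mono2) auto
    thus ?thesis unfolding P_def using assms C(1) that by (intro add_mono mult_left_mono) (auto simp: min_def)
  qed
  have eq: "\<bar>t\<bar> * P \<bar>t\<bar> = \<epsilon> * (t\<^sup>2 + \<bar>t\<bar> powr q) + C * min (t\<^sup>2) (\<bar>t\<bar> powr q)" for t
  proof -
    have 1: "\<bar>t\<bar> * \<bar>t\<bar> = t\<^sup>2" by (simp add: power2_eq_square)
    have 2: "\<bar>t\<bar> * \<bar>t\<bar> powr (q - 1) = \<bar>t\<bar> powr q" by (cases "t = 0") (auto simp: powr_diff)
    have 3: "\<bar>t\<bar> * min \<bar>t\<bar> (\<bar>t\<bar> powr (q - 1)) = min (t\<^sup>2) (\<bar>t\<bar> powr q)"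
      unfolding 1[symmetric] 2[symmetric] by (simp add: min_mult_distrib_left)
    have "\<bar>t\<bar> * P \<bar>t\<bar> = \<epsilon> * (\<bar>t\<bar> * \<bar>t\<bar> + \<bar>t\<bar> * \<bar>t\<bar> powr (q - 1)) + C * (\<bar>t\<bar> * min \<bar>t\<bar> (\<bar>t\<bar> powr (q - 1)))"
      unfolding P_def by (simp only: distrib_left mult.left_commute)
    thus ?thesis unfolding 1 2 3 .
  qed
  have "\<bar>f x t * t\<bar> \<le> \<bar>t\<bar> * P \<bar>t\<bar>" for x t
    using C(2)[of x t] unfolding P_def by (simp add: abs_mult mult.commute mult_left_mono)
  moreover have "\<bar>F x t\<bar> \<le> \<bar>t\<bar> * P \<bar>t\<bar>" for x t
  proof -
    obtain \<theta> where \<theta>: "\<bar>\<theta>\<bar> \<le> \<bar>t\<bar>" "F x t = t * f x \<theta>" using F_mvt[of t x 0] by auto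
    have "\<bar>f x \<theta>\<bar> \<le> P \<bar>\<theta>\<bar>" using C(2)[of x \<theta>] unfolding P_def by simp
    also have "\<dots> \<le> P \<bar>t\<bar>" using \<theta> by (intro Pmono) auto
    finally show ?thesis unfolding \<theta>(2) by (simp add: abs_mult mult_left_mono)
  qed
  ultimately show ?thesis unfolding eq using C(1) by blast
qed

definition G :: "'a \<Rightarrow> real \<Rightarrow> real" where "G x t = f x t * t - 2 * F x t"

text \<open>This is (f4) at \<theta> = 0, where the left side vanishes and \<open>lam\<close> is
  positive.\<close>

lemma G_nonneg: "0 \<le> G x t"
  using f_mono[of 0 x t] lam by (simp add: G_def zero_le_mult_iff)

lemma G_scale_le: "0 \<le> \<theta> \<Longrightarrow> \<theta> \<le> 1 \<Longrightarrow> G x (\<theta> * t) \<le> lam * G x t"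
  unfolding G_def by (rule f_mono)

text \<open>\<open>\<theta> \<mapsto> F x (\<theta> t) / \<theta>\<^sup>2\<close> has derivative \<open>G x (\<theta> t) / \<theta>\<^sup>3 \<ge> 0\<close> and tends to \<open>0\<close> at \<open>\<theta> = 0\<close>.\<close>

lemma F_nonneg: "0 \<le> F x t"
proof -
  define \<phi> where "\<phi> \<theta> = F x (\<theta> * t) / \<theta>\<^sup>2" for \<theta>
  have deriv: "(\<phi> has_real_derivative G x (\<theta> * t) / \<theta> ^ 3) (at \<theta>)" if "\<theta> > 0" for \<theta>
  proof -
    have "((\<lambda>\<theta>. F x (\<theta> * t)) has_real_derivative f x (\<theta> * t) * t) (at \<theta>)"
      by (rule DERIV_chain2[OF F_deriv]) (auto intro!: derivative_eq_intros)
    hence "(\<phi> has_real_derivative (f x (\<theta> * t) * t * \<theta>\<^sup>2 - F x (\<theta> * t) * (2 * \<theta>)) / (\<theta>\<^sup>2 * \<theta>\<^sup>2)) (at \<theta>)"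
      unfolding \<phi>_def using that by (auto intro!: derivative_eq_intros)
    moreover have "(f x (\<theta> * t) * t * \<theta>\<^sup>2 - F x (\<theta> * t) * (2 * \<theta>)) / (\<theta>\<^sup>2 * \<theta>\<^sup>2) = G x (\<theta> * t) / \<theta> ^ 3"
      using that by (simp add: G_def field_simps power2_eq_square power3_eq_cube)
    ultimately show ?thesis by simp
  qed
  have mono: "\<phi> \<theta> \<le> \<phi> 1" if "0 < \<theta>" "\<theta> \<le> 1" for \<theta>
  proof (rule DERIV_nonneg_imp_nondecreasing[OF that(2)])
    fix y assume "\<theta> \<le> y" "y \<le> 1"
    hence "0 < y" using that by simp
    thus "\<exists>d. (\<phi> has_real_derivative d) (at y) \<and> 0 \<le> d"
      using deriv[of y] G_nonneg by (intro exI[of _ "G x (y * t) / y ^ 3"]) auto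
  qed
  have "- \<epsilon> \<le> F x t" if \<epsilon>: "\<epsilon> > 0" for \<epsilon>
  proof -
    define e where "e = \<epsilon> / (t\<^sup>2 + 1)"
    have t1: "t\<^sup>2 + 1 > 0" by (simp add: add_nonneg_pos)
    have e: "e > 0" using \<epsilon> t1 by (simp add: e_def)
    obtain \<delta> where \<delta>: "\<delta> > 0" "\<And>x t. \<bar>t\<bar> \<le> \<delta> \<Longrightarrow> \<bar>f x t\<bar> \<le> e * \<bar>t\<bar>" using f_zero[OF e] by blast
    define \<theta> where "\<theta> = min 1 (\<delta> / (\<bar>t\<bar> + 1))"
    have \<theta>: "0 < \<theta>" "\<theta> \<le> 1" using \<delta> by (auto simp: \<theta>_def)
    have "\<theta> * \<bar>t\<bar> \<le> \<delta> / (\<bar>t\<bar> + 1) * \<bar>t\<bar>" by (intro mult_right_mono) (auto simp: \<theta>_def)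
    also have "\<dots> \<le> \<delta>" using \<delta> by (simp add: field_simps)
    finally have small: "\<bar>\<theta> * t\<bar> \<le> \<delta>" using \<theta> by (simp add: abs_mult)
    obtain \<xi> where \<xi>: "\<bar>\<xi>\<bar> \<le> \<bar>\<theta> * t\<bar>" "F x (\<theta> * t) = (\<theta> * t) * f x \<xi>" using F_mvt[of "\<theta> * t" x 0] by auto
    have "\<bar>f x \<xi>\<bar> \<le> e * \<bar>\<xi>\<bar>" using \<xi>(1) small by (intro \<delta>(2)) simp
    also have "\<dots> \<le> e * \<bar>\<theta> * t\<bar>" using \<xi>(1) e by simp
    finally have "\<bar>\<theta> * t\<bar> * \<bar>f x \<xi>\<bar> \<le> \<bar>\<theta> * t\<bar> * (e * \<bar>\<theta> * t\<bar>)" by (rule mult_left_mono) simp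
    also have "\<dots> = e * (\<theta> * t)\<^sup>2" by (simp add: power2_eq_square mult_ac abs_mult)
    finally have "\<bar>F x (\<theta> * t)\<bar> \<le> e * (\<theta> * t)\<^sup>2" unfolding \<xi>(2) by (simp add: abs_mult)
    hence "- (e * t\<^sup>2) \<le> \<phi> \<theta>" using \<theta> by (simp add: \<phi>_def field_simps power_mult_distrib abs_le_iff)
    also have "\<dots> \<le> \<phi> 1" by (rule mono[OF \<theta>])
    also have "\<dots> = F x t" by (simp add: \<phi>_def)
    finally have "- (e * t\<^sup>2) \<le> F x t" .
    moreover have "e * t\<^sup>2 \<le> \<epsilon>" using \<epsilon> t1 by (simp add: e_def field_simps)
    ultimately show ?thesis by linarith
  qed
  hence "0 \<le> F x t + \<epsilon>" if "\<epsilon> > 0" for \<epsilon> using that by (smt (verit))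
  thus ?thesis by (rule field_le_epsilon)
qed

end

subsection \<open>The energy functional\<close>

text \<open>Homogeneity arguments divide by some d > 0 above the seminorm rather than by the
  seminorm, which may be 0; this lemma lets d decrease to it.\<close>

lemma le_of_scaled_bound:
  fixes A K a :: real
  assumes "\<And>d. d > 0 \<Longrightarrow> a \<le> d \<Longrightarrow> A \<le> K * d" "0 \<le> a" "0 \<le> K"
  shows "A \<le> K * a"
proof (cases "a = 0")
  case True
  have "A \<le> 0 + e" if "e > 0" for e
  proof -
    have "A \<le> K * (e / (K + 1))" using assms that True by (intro assms(1)) (auto simp: add_nonneg_pos)
    also have "\<dots> \<le> e" using assms(3) that by (simp add: field_simps)
    finally show ?thesis by simp
  qed
  hence "A \<le> 0" by (rule field_le_epsilon)
  thus ?thesis using True by simp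
qed (use assms in auto)

context schroedinger
begin

abbreviation "J \<equiv> energy s V f"
abbreviation "DJ \<equiv> energy_deriv s V f"

lemma J_eq: "u \<in> Hs s \<Longrightarrow> J u = 1/2 * B u u - (\<integral>x. F x (u x) \<partial>lborel)"
  unfolding energy_def by (simp add: B_self gagliardo_Hs)

lemma DJ_eq: "DJ u v = B u v - (\<integral>x. f x (u x) * v x \<partial>lborel)"
  unfolding energy_deriv_def B_def by simp

section \<open>Dual bounds for the nonlinear term\<close>

abbreviation pw :: "('a \<Rightarrow> real) \<Rightarrow> 'a \<Rightarrow> real" where
  "pw u x \<equiv> \<bar>u x\<bar> + \<bar>u x\<bar> powr (q - 1)"

text \<open>Hoelder's inequality for the pairs of exponents 2, 2 and q/(q - 1), q in the guise of
  Young's: after division of \<open>v\<close> by c both functions have bounded form, so Young's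
  inequality with coefficient 1 bounds the product by an integrable function of bounded
  integral.\<close>

lemma dual_bound:
  assumes R: "R \<ge> 0"
  shows "\<exists>K\<ge>0. \<forall>u\<in>Hs s. \<forall>v\<in>Hs s. B u u \<le> R \<longrightarrow> integrable lborel (\<lambda>x. pw u x * \<bar>v x\<bar>) \<and>
     (\<integral>x. pw u x * \<bar>v x\<bar> \<partial>lborel) \<le> K * nrm v"
proof -
  \<comment> \<open>The L2 and Lq bounds of \<open>u\<close>, whose form is at most
    \<open>R\<close>, and of the normalised \<open>v\<close>, whose form is at most 1.\<close>
  define K where "K = R / \<alpha> + 1 / \<alpha> + Sob * R powr (q / 2) + Sob * 1 powr (q / 2)"
  have K: "K \<ge> 0" unfolding K_def using R \<alpha> Sob(1) by simp
  have main: "integrable lborel (\<lambda>x. pw u x * \<bar>v x\<bar>) \<and> (\<integral>x. pw u x * \<bar>v x\<bar> \<partial>lborel) \<le> K * c"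
    if u: "u \<in> Hs s" and v: "v \<in> Hs s" and uR: "B u u \<le> R" and c: "c > 0" "nrm v \<le> c" for u v c
  proof -
    note [measurable] = Hs_measurable[OF u] Hs_measurable[OF v]
    define w where "w = (1 / c) *\<^sub>R v"
    have w: "w \<in> Hs s" using v by (simp add: w_def)
    have "nrm w \<le> 1" using c v by (simp add: w_def nrm_scale)
    hence "(nrm w)\<^sup>2 \<le> 1\<^sup>2" using w by (intro power_mono) auto
    hence wB: "B w w \<le> 1" using w by (simp add: nrm_sq)
    define g where "g x = (u x)\<^sup>2 + (w x)\<^sup>2 + \<bar>u x\<bar> powr q + \<bar>w x\<bar> powr q" for x
    have ig: "integrable lborel g" unfolding g_def
      using integrable_Hs(4)[OF u u] integrable_Hs(4)[OF w w] Sob(2)[OF u] Sob(2)[OF w] by simp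
    have "(\<integral>x. g x \<partial>lborel) = (\<integral>x. (u x)\<^sup>2 \<partial>lborel) + (\<integral>x. (w x)\<^sup>2 \<partial>lborel) + (\<integral>x. \<bar>u x\<bar> powr q \<partial>lborel) + (\<integral>x. \<bar>w x\<bar> powr q \<partial>lborel)"
      unfolding g_def using integrable_Hs(4)[OF u u] integrable_Hs(4)[OF w w] Sob(2)[OF u] Sob(2)[OF w] by simp
    also have "\<dots> \<le> K" unfolding K_def
      by (intro add_mono square_bound[OF u uR] square_bound[OF w wB] powr_q_bound[OF u uR] powr_q_bound[OF w wB])
    finally have gK: "(\<integral>x. g x \<partial>lborel) \<le> K" .
    have pt: "pw u x * \<bar>v x\<bar> \<le> c * g x" for x
    proof -
      have "\<bar>u x\<bar> powr (q - 1) * \<bar>w x\<bar> \<le> 1 * \<bar>u x\<bar> powr q + (1 / 1) powr (q - 1) * \<bar>w x\<bar> powr q"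
        using q_gt_2 by (intro young_powr) auto
      moreover have "\<bar>u x * w x\<bar> \<le> 1 * (u x)\<^sup>2 + 1 / 1 * (w x)\<^sup>2" by (rule young_square) simp
      ultimately have "pw u x * \<bar>w x\<bar> \<le> g x" unfolding g_def by (simp add: abs_mult distrib_right)
      hence "c * (pw u x * \<bar>w x\<bar>) \<le> c * g x" using c by simp
      moreover have "\<bar>v x\<bar> = c * \<bar>w x\<bar>" using c by (simp add: w_def abs_mult)
      ultimately show ?thesis by (simp add: mult_ac)
    qed
    have i: "integrable lborel (\<lambda>x. pw u x * \<bar>v x\<bar>)"
    proof (rule Bochner_Integration.integrable_bound)
      show "integrable lborel (\<lambda>x. c * g x)" using ig by simp
      show "AE x in lborel. norm (pw u x * \<bar>v x\<bar>) \<le> norm (c * g x)"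
      proof (rule AE_I2)
        fix x
        have "0 \<le> pw u x * \<bar>v x\<bar>" by simp
        thus "norm (pw u x * \<bar>v x\<bar>) \<le> norm (c * g x)" using pt[of x] by simp
      qed
    qed measurable
    have "(\<integral>x. pw u x * \<bar>v x\<bar> \<partial>lborel) \<le> (\<integral>x. c * g x \<partial>lborel)"
      by (rule integral_mono[OF i]) (use ig pt in auto)
    also have "\<dots> \<le> K * c" using gK c by (simp add: mult.commute)
    finally show ?thesis using i by simp
  qed
  show ?thesis
  proof (intro exI[of _ K] conjI ballI impI K)
    fix u v :: "'a \<Rightarrow> real" assume u: "u \<in> Hs s" and v: "v \<in> Hs s" and uR: "B u u \<le> R"
    show "integrable lborel (\<lambda>x. pw u x * \<bar>v x\<bar>)" using main[OF u v uR, of "nrm v + 1"] v by (auto simp: add_nonneg_pos)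
    show "(\<integral>x. pw u x * \<bar>v x\<bar> \<partial>lborel) \<le> K * nrm v"
      by (rule le_of_scaled_bound) (use main[OF u v uR] v K in auto)
  qed
qed

lemma product_bound:
  assumes h: "h \<in> Hs s" and v: "v \<in> Hs s" and c: "c > 0" "nrm h \<le> c"
  shows "(\<integral>x. \<bar>h x\<bar> * \<bar>v x\<bar> \<partial>lborel) \<le> 2 * c / \<alpha> * nrm v"
proof (rule le_of_scaled_bound)
  fix d :: real assume d: "d > 0" "nrm v \<le> d"
  note [measurable] = Hs_measurable[OF h] Hs_measurable[OF v]
  have i: "integrable lborel (\<lambda>x. \<bar>h x\<bar> * \<bar>v x\<bar>)"
    using integrable_abs[OF integrable_Hs(1)[OF h v]] by (simp add: abs_mult)
  have "(nrm h)\<^sup>2 \<le> c\<^sup>2" "(nrm v)\<^sup>2 \<le> d\<^sup>2" using c d h v by (auto intro!: power_mono)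
  hence hB: "B h h \<le> c\<^sup>2" and vB: "B v v \<le> d\<^sup>2" using h v by (auto simp: nrm_sq)
  \<comment> \<open>The weight d / c balances the two terms of Young's inequality: each is at most c
    d / \<alpha>.\<close>
  have "(\<integral>x. \<bar>h x\<bar> * \<bar>v x\<bar> \<partial>lborel) \<le> (\<integral>x. d / c * (h x)\<^sup>2 + 1 / (d / c) * (v x)\<^sup>2 \<partial>lborel)"
  proof (rule integral_mono[OF i])
    show "\<bar>h x\<bar> * \<bar>v x\<bar> \<le> d / c * (h x)\<^sup>2 + 1 / (d / c) * (v x)\<^sup>2" for x
      using young_square[of "d / c" "h x" "v x"] c d by (simp add: abs_mult)
  qed (use integrable_Hs(4)[OF h h] integrable_Hs(4)[OF v v] in simp)
  also have "\<dots> = d / c * (\<integral>x. (h x)\<^sup>2 \<partial>lborel) + c / d * (\<integral>x. (v x)\<^sup>2 \<partial>lborel)"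
    using integrable_Hs(4)[OF h h] integrable_Hs(4)[OF v v] by simp
  also have "\<dots> \<le> d / c * (c\<^sup>2 / \<alpha>) + c / d * (d\<^sup>2 / \<alpha>)"
    using square_bound[OF h hB] square_bound[OF v vB] c d by (intro add_mono mult_left_mono) auto
  also have "\<dots> = 2 * c / \<alpha> * d" using c d \<alpha> by (simp add: field_simps power2_eq_square)
  finally show "(\<integral>x. \<bar>h x\<bar> * \<bar>v x\<bar> \<partial>lborel) \<le> 2 * c / \<alpha> * d" .
qed (use v c \<alpha> in auto)

lemma f_dual:
  assumes R: "R \<ge> 0"
  shows "\<exists>K\<ge>0. \<forall>u\<in>Hs s. \<forall>v\<in>Hs s. B u u \<le> R \<longrightarrow> integrable lborel (\<lambda>x. f x (u x) * v x) \<and>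
     \<bar>\<integral>x. f x (u x) * v x \<partial>lborel\<bar> \<le> K * nrm v"
proof -
  obtain K where K: "K \<ge> 0" "\<And>u v. u \<in> Hs s \<Longrightarrow> v \<in> Hs s \<Longrightarrow> B u u \<le> R \<Longrightarrow> integrable lborel (\<lambda>x. pw u x * \<bar>v x\<bar>)"
    "\<And>u v. u \<in> Hs s \<Longrightarrow> v \<in> Hs s \<Longrightarrow> B u u \<le> R \<Longrightarrow> (\<integral>x. pw u x * \<bar>v x\<bar> \<partial>lborel) \<le> K * nrm v"
    using dual_bound[OF R] by blast
  obtain M where M: "M > 0" "\<And>x t. \<bar>f x t\<bar> \<le> M * (\<bar>t\<bar> + \<bar>t\<bar> powr (q - 1))"
    using f_linear_growth by blast
  have "integrable lborel (\<lambda>x. f x (u x) * v x) \<and> \<bar>\<integral>x. f x (u x) * v x \<partial>lborel\<bar> \<le> (M * K) * nrm v"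
    if u: "u \<in> Hs s" and v: "v \<in> Hs s" and uR: "B u u \<le> R" for u v
  proof -
    note [measurable] = Hs_measurable[OF u] Hs_measurable[OF v]
    have pt: "\<bar>f x (u x) * v x\<bar> \<le> M * (pw u x * \<bar>v x\<bar>)" for x
      using mult_right_mono[OF M(2)[of x "u x"], of "\<bar>v x\<bar>"] by (simp add: abs_mult mult.assoc)
    have i2: "integrable lborel (\<lambda>x. M * (pw u x * \<bar>v x\<bar>))" using K(2)[OF u v uR] by simp
    have i: "integrable lborel (\<lambda>x. f x (u x) * v x)"
    proof (rule Bochner_Integration.integrable_bound[OF i2])
      show "AE x in lborel. norm (f x (u x) * v x) \<le> norm (M * (pw u x * \<bar>v x\<bar>))"
        using pt by (intro AE_I2) (metis abs_ge_self order_trans real_norm_def)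
    qed measurable
    have "\<bar>\<integral>x. f x (u x) * v x \<partial>lborel\<bar> \<le> (\<integral>x. \<bar>f x (u x) * v x\<bar> \<partial>lborel)" by simp
    also have "\<dots> \<le> (\<integral>x. M * (pw u x * \<bar>v x\<bar>) \<partial>lborel)"
      by (rule integral_mono) (use i i2 pt in auto)
    also have "\<dots> = M * (\<integral>x. pw u x * \<bar>v x\<bar> \<partial>lborel)" by simp
    also have "\<dots> \<le> M * (K * nrm v)" using K(3)[OF u v uR] M(1) by (intro mult_left_mono) auto
    finally show ?thesis using i by (simp add: mult.assoc)
  qed
  moreover have "M * K \<ge> 0" using M(1) K(1) by simp
  ultimately show ?thesis by blast
qed

lemma integrable_fuv: "u \<in> Hs s \<Longrightarrow> v \<in> Hs s \<Longrightarrow> integrable lborel (\<lambda>x. f x (u x) * v x)"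
  using f_dual[OF B_nonneg, of u] by auto

lemma integrable_F:
  assumes u: "u \<in> Hs s" shows "integrable lborel (\<lambda>x. F x (u x))"
proof -
  note [measurable] = Hs_measurable[OF u]
  obtain C where C: "C \<ge> 0" "\<And>x t. \<bar>F x t\<bar> \<le> 1 * (t\<^sup>2 + \<bar>t\<bar> powr q) + C * min (t\<^sup>2) (\<bar>t\<bar> powr q)"
    using fF_growth[of 1] by auto
  show ?thesis
  proof (rule Bochner_Integration.integrable_bound)
    show "integrable lborel (\<lambda>x. (u x)\<^sup>2 + \<bar>u x\<bar> powr q + C * (u x)\<^sup>2)"
      using integrable_Hs(4)[OF u u] Sob(2)[OF u] by simp
    have "\<bar>F x (u x)\<bar> \<le> (u x)\<^sup>2 + \<bar>u x\<bar> powr q + C * (u x)\<^sup>2" for x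
    proof -
      have "C * min ((u x)\<^sup>2) (\<bar>u x\<bar> powr q) \<le> C * (u x)\<^sup>2" using C(1) by (intro mult_left_mono) auto
      hence "(u x)\<^sup>2 + \<bar>u x\<bar> powr q + C * min ((u x)\<^sup>2) (\<bar>u x\<bar> powr q) \<le> (u x)\<^sup>2 + \<bar>u x\<bar> powr q + C * (u x)\<^sup>2"
        by (rule add_left_mono)
      with C(2)[of x "u x"] show ?thesis by (simp only: mult_1_left)
    qed
    thus "AE x in lborel. norm (F x (u x)) \<le> norm ((u x)\<^sup>2 + \<bar>u x\<bar> powr q + C * (u x)\<^sup>2)"
      by (intro AE_I2) (metis abs_ge_self order_trans real_norm_def)
  qed measurable
qed

lemma integrable_G: "u \<in> Hs s \<Longrightarrow> integrable lborel (\<lambda>x. G x (u x))"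
  unfolding G_def by (intro Bochner_Integration.integrable_diff integrable_fuv integrable_mult_right integrable_F) auto

lemma G_identity: "u \<in> Hs s \<Longrightarrow> (\<integral>x. G x (u x) \<partial>lborel) = 2 * J u - DJ u u"
  unfolding G_def using integrable_F[of u] integrable_fuv[of u u] by (simp add: J_eq DJ_eq)

text \<open>One majorant serves every \<theta> with \<open>|\<theta>| \<le> |h x|\<close>. The
  mean-value point, which varies with x in a possibly nonmeasurable way, can thus be inserted
  without being integrated; the choice \<open>\<theta> = h x\<close> serves the continuity of the
  derivative.\<close>

lemma f_osc:
  assumes R: "R \<ge> 0" and \<epsilon>: "\<epsilon> > 0"
  shows "\<exists>\<tau>>0. \<forall>u\<in>Hs s. \<forall>h\<in>Hs s. \<forall>v\<in>Hs s. nrm u \<le> R \<longrightarrow> nrm h \<le> \<tau> \<longrightarrow>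
     (\<exists>g. integrable lborel g \<and> (\<forall>x \<theta>. \<bar>\<theta>\<bar> \<le> \<bar>h x\<bar> \<longrightarrow> \<bar>f x (u x + \<theta>) - f x (u x)\<bar> * \<bar>v x\<bar> \<le> g x)
        \<and> (\<integral>x. g x \<partial>lborel) \<le> \<epsilon> * nrm v)"
proof -
  obtain K1 where K1: "K1 \<ge> 0" "\<And>u v. u \<in> Hs s \<Longrightarrow> v \<in> Hs s \<Longrightarrow> B u u \<le> R\<^sup>2 \<Longrightarrow> integrable lborel (\<lambda>x. pw u x * \<bar>v x\<bar>)"
    "\<And>u v. u \<in> Hs s \<Longrightarrow> v \<in> Hs s \<Longrightarrow> B u u \<le> R\<^sup>2 \<Longrightarrow> (\<integral>x. pw u x * \<bar>v x\<bar> \<partial>lborel) \<le> K1 * nrm v"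
    using dual_bound[of "R\<^sup>2"] by auto
  obtain K2 where K2: "K2 \<ge> 0" "\<And>u v. u \<in> Hs s \<Longrightarrow> v \<in> Hs s \<Longrightarrow> B u u \<le> 1 \<Longrightarrow> integrable lborel (\<lambda>x. pw u x * \<bar>v x\<bar>)"
    "\<And>u v. u \<in> Hs s \<Longrightarrow> v \<in> Hs s \<Longrightarrow> B u u \<le> 1 \<Longrightarrow> (\<integral>x. pw u x * \<bar>v x\<bar> \<partial>lborel) \<le> K2 * nrm v"
    using dual_bound[of 1] by auto
  \<comment> \<open>Half of \<epsilon> goes to the part of critical growth, measured by
    \<open>K1\<close> for \<open>u\<close> and \<open>K2\<close> for \<open>h\<close>; the summand 1
    avoids division by 0.\<close>
  define e where "e = \<epsilon> / 2 / (K1 + K2 + 1)"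
  have K: "K1 + K2 + 1 > 0" using K1 K2 by simp
  have e: "e > 0" using \<epsilon> K by (simp add: e_def)
  have eK: "e * (K1 + K2) \<le> \<epsilon> / 2"
  proof -
    have "e * (K1 + K2) \<le> e * (K1 + K2 + 1)" using e by simp
    also have "\<dots> = \<epsilon> / 2" unfolding e_def using K by (metis less_irrefl nonzero_eq_divide_eq)
    finally show ?thesis .
  qed
  obtain C where C: "C \<ge> 0" "\<And>x t h \<theta>. \<bar>\<theta>\<bar> \<le> \<bar>h\<bar> \<Longrightarrow> \<bar>f x (t + \<theta>) - f x t\<bar>
      \<le> e * ((\<bar>t\<bar> + \<bar>t\<bar> powr (q - 1)) + (\<bar>h\<bar> + \<bar>h\<bar> powr (q - 1))) + C * \<bar>h\<bar>" using f_increment[OF e] by blast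
  \<comment> \<open>At most 1 so that \<open>K2\<close> applies to \<open>h\<close>, and small
    enough that the linear part \<open>C * |h|\<close> uses only the other half of
    \<epsilon>.\<close>
  define \<tau> where "\<tau> = min 1 (\<epsilon> * \<alpha> / (4 * (C + 1)))"
  have \<tau>: "\<tau> > 0" "\<tau> \<le> 1" using \<epsilon> \<alpha> C by (auto simp: \<tau>_def)
  have \<tau>C: "C * (2 * \<tau> / \<alpha>) \<le> \<epsilon> / 2"
  proof -
    have "C * \<tau> \<le> (C + 1) * (\<epsilon> * \<alpha> / (4 * (C + 1)))"
      using C(1) \<tau> by (intro mult_mono) (auto simp: \<tau>_def)
    also have "\<dots> = \<epsilon> * \<alpha> / 4" using C(1) by (simp add: field_simps)
    finally show ?thesis using \<alpha> by (simp add: field_simps)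
  qed
  show ?thesis
  proof (intro exI[of _ \<tau>] conjI ballI impI \<tau>(1))
    fix u h v :: "'a \<Rightarrow> real" assume u: "u \<in> Hs s" and h: "h \<in> Hs s" and v: "v \<in> Hs s"
      and uR: "nrm u \<le> R" and hn: "nrm h \<le> \<tau>"
    have "(nrm u)\<^sup>2 \<le> R\<^sup>2" using uR u by (intro power_mono) auto
    hence uB: "B u u \<le> R\<^sup>2" using u by (simp add: nrm_sq)
    have "(nrm h)\<^sup>2 \<le> 1\<^sup>2" using hn \<tau> h by (intro power_mono) auto
    hence hB: "B h h \<le> 1" using h by (simp add: nrm_sq)
    have i3: "integrable lborel (\<lambda>x. \<bar>h x\<bar> * \<bar>v x\<bar>)"
      using integrable_abs[OF integrable_Hs(1)[OF h v]] by (simp add: abs_mult)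
    define g where "g x = e * (pw u x * \<bar>v x\<bar> + pw h x * \<bar>v x\<bar>) + C * (\<bar>h x\<bar> * \<bar>v x\<bar>)" for x
    have ig: "integrable lborel g" unfolding g_def
      by (intro Bochner_Integration.integrable_add integrable_mult_right K1(2) K2(2) u h v uB hB i3)
    have "(\<integral>x. g x \<partial>lborel) = e * ((\<integral>x. pw u x * \<bar>v x\<bar> \<partial>lborel) + (\<integral>x. pw h x * \<bar>v x\<bar> \<partial>lborel)) + C * (\<integral>x. \<bar>h x\<bar> * \<bar>v x\<bar> \<partial>lborel)"
      unfolding g_def using K1(2)[OF u v uB] K2(2)[OF h v hB] i3
      by (subst Bochner_Integration.integral_add) (auto simp: Bochner_Integration.integral_add)
    also have "\<dots> \<le> e * (K1 * nrm v + K2 * nrm v) + C * (2 * \<tau> / \<alpha> * nrm v)"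
      using e C(1) by (intro add_mono mult_left_mono K1(3) K2(3) u h v uB hB product_bound \<tau>(1) hn) auto
    also have "\<dots> = (e * (K1 + K2) + C * (2 * \<tau> / \<alpha>)) * nrm v" by (simp add: algebra_simps)
    also have "\<dots> \<le> (\<epsilon> / 2 + \<epsilon> / 2) * nrm v" using eK \<tau>C v by (intro mult_right_mono add_mono) auto
    finally have gi: "(\<integral>x. g x \<partial>lborel) \<le> \<epsilon> * nrm v" by simp
    have "\<bar>f x (u x + \<theta>) - f x (u x)\<bar> * \<bar>v x\<bar> \<le> g x" if "\<bar>\<theta>\<bar> \<le> \<bar>h x\<bar>" for x \<theta>
      using mult_right_mono[OF C(2)[OF that, of x "u x"], of "\<bar>v x\<bar>"] unfolding g_def
      by (simp add: distrib_right distrib_left mult.assoc)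
    thus "\<exists>g. integrable lborel g \<and> (\<forall>x \<theta>. \<bar>\<theta>\<bar> \<le> \<bar>h x\<bar> \<longrightarrow> \<bar>f x (u x + \<theta>) - f x (u x)\<bar> * \<bar>v x\<bar> \<le> g x)
        \<and> (\<integral>x. g x \<partial>lborel) \<le> \<epsilon> * nrm v" using ig gi by blast
  qed
qed

text \<open>The remainder is \<open>1/2 * B v v\<close> minus an integral controlled by
  \<open>f_osc\<close> at the mean-value point; the quadratic term is at most
  \<open>\<epsilon> / 2 * nrm v\<close> as soon as \<open>nrm v \<le> \<epsilon>\<close>.\<close>

lemma J_unif_diff:
  assumes \<epsilon>: "\<epsilon> > 0"
  shows "\<exists>\<tau>>0. \<forall>u\<in>Hs s. \<forall>v\<in>Hs s. nrm u \<le> R \<longrightarrow> nrm v \<le> \<tau> \<longrightarrow> \<bar>J (u + v) - J u - DJ u v\<bar> \<le> \<epsilon> * nrm v"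
proof -
  obtain \<tau> where \<tau>: "\<tau> > 0" "\<And>u h v. u \<in> Hs s \<Longrightarrow> h \<in> Hs s \<Longrightarrow> v \<in> Hs s \<Longrightarrow> nrm u \<le> max 0 R \<Longrightarrow> nrm h \<le> \<tau> \<Longrightarrow>
     (\<exists>g. integrable lborel g \<and> (\<forall>x \<theta>. \<bar>\<theta>\<bar> \<le> \<bar>h x\<bar> \<longrightarrow> \<bar>f x (u x + \<theta>) - f x (u x)\<bar> * \<bar>v x\<bar> \<le> g x)
        \<and> (\<integral>x. g x \<partial>lborel) \<le> \<epsilon> / 2 * nrm v)"
    using f_osc[of "max 0 R" "\<epsilon> / 2"] \<epsilon> by auto
  show ?thesis
  proof (intro exI[of _ "min \<tau> \<epsilon>"] conjI ballI impI)
    show "min \<tau> \<epsilon> > 0" using \<tau> \<epsilon> by simp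
    fix u v :: "'a \<Rightarrow> real" assume u: "u \<in> Hs s" and v: "v \<in> Hs s" and uR: "nrm u \<le> R" and vn: "nrm v \<le> min \<tau> \<epsilon>"
    note [measurable] = Hs_measurable[OF u] Hs_measurable[OF v]
    have uv: "u + v \<in> Hs s" using u v by simp
    obtain g where ig: "integrable lborel g" and g: "\<And>x \<theta>. \<bar>\<theta>\<bar> \<le> \<bar>v x\<bar> \<Longrightarrow> \<bar>f x (u x + \<theta>) - f x (u x)\<bar> * \<bar>v x\<bar> \<le> g x"
      and gi: "(\<integral>x. g x \<partial>lborel) \<le> \<epsilon> / 2 * nrm v" using \<tau>(2)[OF u v v order_trans[OF uR max.cobounded2]] vn by auto
    define k where "k x = F x (u x + v x) - F x (u x) - f x (u x) * v x" for x
    have kg: "\<bar>k x\<bar> \<le> g x" for x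
    proof -
      obtain \<theta> where \<theta>: "\<bar>\<theta>\<bar> \<le> \<bar>v x\<bar>" "F x (u x + v x) - F x (u x) = v x * f x (u x + \<theta>)" using F_mvt by blast
      have "k x = (f x (u x + \<theta>) - f x (u x)) * v x" unfolding k_def \<theta>(2) by (simp add: algebra_simps)
      thus ?thesis using g[OF \<theta>(1)] by (simp add: abs_mult)
    qed
    have ik: "integrable lborel k" unfolding k_def
      using integrable_F[OF uv] integrable_F[OF u] integrable_fuv[OF u v] by simp
    have "J (u + v) - J u - DJ u v = 1/2 * B v v - (\<integral>x. k x \<partial>lborel)"
      unfolding k_def using integrable_F[OF uv] integrable_F[OF u] integrable_fuv[OF u v] u v sym[of u v]
      by (simp add: J_eq[OF uv] J_eq[OF u] DJ_eq bilin algebra_simps)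
    moreover have "\<bar>\<integral>x. k x \<partial>lborel\<bar> \<le> \<epsilon> / 2 * nrm v"
    proof -
      have "\<bar>\<integral>x. k x \<partial>lborel\<bar> \<le> (\<integral>x. \<bar>k x\<bar> \<partial>lborel)" by simp
      also have "\<dots> \<le> (\<integral>x. g x \<partial>lborel)" by (rule integral_mono) (use ik ig kg in auto)
      finally show ?thesis using gi by simp
    qed
    moreover have "0 \<le> 1/2 * B v v" "1/2 * B v v \<le> \<epsilon> / 2 * nrm v"
    proof -
      show "0 \<le> 1/2 * B v v" using B_nonneg[OF v] by simp
      have "nrm v * nrm v \<le> \<epsilon> * nrm v" using vn v by (intro mult_right_mono) auto
      thus "1/2 * B v v \<le> \<epsilon> / 2 * nrm v" using nrm_sq[OF v] by (simp add: power2_eq_square)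
    qed
    ultimately show "\<bar>J (u + v) - J u - DJ u v\<bar> \<le> \<epsilon> * nrm v" by linarith
  qed
qed

lemma DJ_linear:
  assumes u: "u \<in> Hs s" and v: "v \<in> Hs s"
  shows "w \<in> Hs s \<Longrightarrow> DJ u (v + w) = DJ u v + DJ u w" "DJ u (c *\<^sub>R v) = c * DJ u v"
proof -
  assume w: "w \<in> Hs s"
  show "DJ u (v + w) = DJ u v + DJ u w"
    using integrable_fuv[OF u v] integrable_fuv[OF u w] u v w by (simp add: DJ_eq bilin algebra_simps)
next
  have "(\<integral>x. f x (u x) * (c *\<^sub>R v) x \<partial>lborel) = (\<integral>x. c * (f x (u x) * v x) \<partial>lborel)"
    by (rule Bochner_Integration.integral_cong) auto
  thus "DJ u (c *\<^sub>R v) = c * DJ u v" using u v by (simp add: DJ_eq bilin algebra_simps)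
qed

text \<open>The gradient of \<open>J\<close>. The representing vector is determined only up to null
  vectors, hence the choice.\<close>

definition W :: "('a \<Rightarrow> real) \<Rightarrow> 'a \<Rightarrow> real" where
  "W u = (SOME w. w \<in> Hs s \<and> (\<forall>v\<in>Hs s. DJ u v = B w v))"

lemma W:
  assumes u: "u \<in> Hs s"
  shows "W u \<in> Hs s" "v \<in> Hs s \<Longrightarrow> DJ u v = B (W u) v"
proof -
  obtain K where K: "K \<ge> 0" "\<And>v. v \<in> Hs s \<Longrightarrow> \<bar>\<integral>x. f x (u x) * v x \<partial>lborel\<bar> \<le> K * nrm v"
    using f_dual[OF B_nonneg[OF u]] u by auto
  have "\<exists>w\<in>Hs s. \<forall>v\<in>Hs s. DJ u v = B w v"
  proof (rule riesz[of _ "nrm u + K"])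
    fix v :: "'a \<Rightarrow> real" assume v: "v \<in> Hs s"
    show "\<bar>DJ u v\<bar> \<le> (nrm u + K) * nrm v"
      using cauchy_schwarz[OF u v] K(2)[OF v] unfolding DJ_eq distrib_right by linarith
  qed (use DJ_linear[OF u] in auto)
  hence "\<exists>w. w \<in> Hs s \<and> (\<forall>v\<in>Hs s. DJ u v = B w v)" by blast
  from someI_ex[OF this, folded W_def]
  show "W u \<in> Hs s" "v \<in> Hs s \<Longrightarrow> DJ u v = B (W u) v" by auto
qed

text \<open>The difference z of the two gradients is tested against itself: \<open>(nrm z)^2\<close>
  is the difference of the derivatives in direction z, which is at most
  \<open>\<epsilon> * nrm z\<close>.\<close>

lemma W_cont:
  assumes u: "u \<in> Hs s" and \<epsilon>: "\<epsilon> > 0"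
  shows "\<exists>\<tau>>0. \<forall>h\<in>Hs s. nrm h \<le> \<tau> \<longrightarrow> nrm (W (u + h) - W u) \<le> \<epsilon>"
proof -
  obtain \<tau> where \<tau>: "\<tau> > 0" "\<And>h v. h \<in> Hs s \<Longrightarrow> v \<in> Hs s \<Longrightarrow> nrm h \<le> \<tau> \<Longrightarrow>
     (\<exists>g. integrable lborel g \<and> (\<forall>x \<theta>. \<bar>\<theta>\<bar> \<le> \<bar>h x\<bar> \<longrightarrow> \<bar>f x (u x + \<theta>) - f x (u x)\<bar> * \<bar>v x\<bar> \<le> g x)
        \<and> (\<integral>x. g x \<partial>lborel) \<le> \<epsilon> / 2 * nrm v)"
    using f_osc[of "nrm u" "\<epsilon> / 2"] \<epsilon> u by auto
  show ?thesis
  proof (intro exI[of _ "min \<tau> (\<epsilon> / 2)"] conjI ballI impI)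
    show "min \<tau> (\<epsilon> / 2) > 0" using \<tau> \<epsilon> by simp
    fix h :: "'a \<Rightarrow> real" assume h: "h \<in> Hs s" and hn: "nrm h \<le> min \<tau> (\<epsilon> / 2)"
    have uh: "u + h \<in> Hs s" using u h by simp
    define z where "z = W (u + h) - W u"
    have z: "z \<in> Hs s" unfolding z_def using W(1)[OF u] W(1)[OF uh] by simp
    obtain g where ig: "integrable lborel g" and g: "\<And>x \<theta>. \<bar>\<theta>\<bar> \<le> \<bar>h x\<bar> \<Longrightarrow> \<bar>f x (u x + \<theta>) - f x (u x)\<bar> * \<bar>z x\<bar> \<le> g x"
      and gi: "(\<integral>x. g x \<partial>lborel) \<le> \<epsilon> / 2 * nrm z" using \<tau>(2)[OF h z] hn by auto
    define k where "k x = f x (u x + h x) * z x - f x (u x) * z x" for x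
    have kg: "\<bar>k x\<bar> \<le> g x" for x
      using g[of "h x" x] unfolding k_def by (simp add: left_diff_distrib[symmetric] abs_mult)
    have ik: "integrable lborel k" unfolding k_def
      using integrable_fuv[OF uh z] integrable_fuv[OF u z] by simp
    have "(nrm z)\<^sup>2 = B (W (u + h)) z - B (W u) z"
      using W(1)[OF u] W(1)[OF uh] z by (simp add: nrm_sq) (simp add: z_def bilin)
    also have "\<dots> = DJ (u + h) z - DJ u z" using W(2)[OF u z] W(2)[OF uh z] by simp
    also have "\<dots> = B h z - (\<integral>x. k x \<partial>lborel)"
      unfolding k_def using integrable_fuv[OF uh z] integrable_fuv[OF u z] u h z by (simp add: DJ_eq bilin)
    also have "\<dots> \<le> nrm h * nrm z + \<epsilon> / 2 * nrm z"
    proof -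
      have "\<bar>\<integral>x. k x \<partial>lborel\<bar> \<le> (\<integral>x. \<bar>k x\<bar> \<partial>lborel)" by simp
      also have "\<dots> \<le> (\<integral>x. g x \<partial>lborel)" by (rule integral_mono) (use ik ig kg in auto)
      finally show ?thesis using gi cauchy_schwarz[OF h z] by linarith
    qed
    also have "\<dots> \<le> \<epsilon> * nrm z"
    proof -
      have "nrm h * nrm z \<le> \<epsilon> / 2 * nrm z" using hn z by (intro mult_right_mono) auto
      thus ?thesis by linarith
    qed
    finally have le: "nrm z * nrm z \<le> \<epsilon> * nrm z" by (simp add: power2_eq_square)
    show "nrm (W (u + h) - W u) \<le> \<epsilon>"
    proof (cases "nrm z = 0")
      case False
      hence "nrm z > 0" using nrm_ge_0[OF z] by simp
      thus ?thesis using le by (simp add: z_def mult_le_cancel_right)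
    qed (use \<epsilon> in \<open>simp add: z_def\<close>)
  qed
qed

text \<open>Lets an interior maximum of the energy along a ray be read as a zero of the derivative
  in the radial direction.\<close>

lemma J_ray:
  assumes u: "u \<in> Hs s"
  shows "((\<lambda>t. J (t *\<^sub>R u)) has_real_derivative DJ (t *\<^sub>R u) u) (at t)"
  unfolding DERIV_def
proof (rule LIM_I)
  fix e :: real assume e: "e > 0"
  define n where "n = nrm u + 1"
  have n: "n > 0" "nrm u < n" "nrm u \<ge> 0" using u by (auto simp: n_def add_nonneg_pos)
  obtain \<tau> where \<tau>: "\<tau> > 0" "\<And>v w. v \<in> Hs s \<Longrightarrow> w \<in> Hs s \<Longrightarrow> nrm v \<le> nrm (t *\<^sub>R u) \<Longrightarrow> nrm w \<le> \<tau> \<Longrightarrow> \<bar>J (v + w) - J v - DJ v w\<bar> \<le> e / n * nrm w"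
    using J_unif_diff[of "e / n" "nrm (t *\<^sub>R u)"] e n by auto
  show "\<exists>r>0. \<forall>h. h \<noteq> 0 \<and> norm (h - 0) < r \<longrightarrow> norm ((J ((t + h) *\<^sub>R u) - J (t *\<^sub>R u)) / h - DJ (t *\<^sub>R u) u) < e"
  proof (intro exI[of _ "\<tau> / n"] conjI allI impI)
    show "\<tau> / n > 0" using \<tau> n by simp
    fix h :: real assume h: "h \<noteq> 0 \<and> norm (h - 0) < \<tau> / n"
    have "\<bar>h\<bar> * nrm u \<le> \<bar>h\<bar> * n" using n by (intro mult_left_mono) auto
    also have "\<dots> \<le> \<tau>" using h n by (simp add: field_simps)
    finally have hn: "nrm (h *\<^sub>R u) \<le> \<tau>" using u by (simp add: nrm_scale)
    have "\<bar>J (t *\<^sub>R u + h *\<^sub>R u) - J (t *\<^sub>R u) - DJ (t *\<^sub>R u) (h *\<^sub>R u)\<bar> \<le> e / n * nrm (h *\<^sub>R u)"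
      using u hn by (intro \<tau>(2)) auto
    hence "\<bar>J ((t + h) *\<^sub>R u) - J (t *\<^sub>R u) - h * DJ (t *\<^sub>R u) u\<bar> \<le> \<bar>h\<bar> * (e / n * nrm u)"
      using u DJ_linear(2)[of "t *\<^sub>R u" u h] by (simp add: scaleR_add_left nrm_scale mult_ac)
    also have "\<dots> < \<bar>h\<bar> * (e / n * n)" using h e n by (intro mult_strict_left_mono) auto
    also have "\<dots> = \<bar>h\<bar> * e" using n by simp
    finally have "\<bar>J ((t + h) *\<^sub>R u) - J (t *\<^sub>R u) - h * DJ (t *\<^sub>R u) u\<bar> / \<bar>h\<bar> < e" using h by (simp add: field_simps)
    moreover have "(J ((t + h) *\<^sub>R u) - J (t *\<^sub>R u)) / h - DJ (t *\<^sub>R u) u = (J ((t + h) *\<^sub>R u) - J (t *\<^sub>R u) - h * DJ (t *\<^sub>R u) u) / h"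
      using h by (simp add: field_simps)
    ultimately show "norm ((J ((t + h) *\<^sub>R u) - J (t *\<^sub>R u)) / h - DJ (t *\<^sub>R u) u) < e"
      by (simp add: abs_divide)
  qed
qed

section \<open>Invariance under the lattice and passage to the limit\<close>

lemma F_per: "k \<in> int_lattice \<Longrightarrow> F (x + k) t = F x t"
  by (simp add: primF_def f_per)

lemma DJ_shift:
  assumes k: "k \<in> int_lattice" and u: "u \<in> Hs s" and v: "v \<in> Hs s"
  shows "DJ (shift k u) (shift k v) = DJ u v"
proof -
  note [measurable] = Hs_measurable[OF u] Hs_measurable[OF v]
  have "(\<integral>x. f x (shift k u x) * shift k v x \<partial>lborel) = (\<integral>x. f (x + k) (u (x + k)) * v (x + k) \<partial>lborel)"
    using f_per[OF k] by (simp add: shift_def)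
  also have "\<dots> = (\<integral>x. f x (u x) * v x \<partial>lborel)"
    by (rule lborel_integral_shift(1)[of "\<lambda>x. f x (u x) * v x"]) measurable
  finally show ?thesis unfolding DJ_eq by (simp add: B_shift[OF k u v])
qed

lemma J_shift:
  assumes k: "k \<in> int_lattice" and u: "u \<in> Hs s"
  shows "J (shift k u) = J u"
proof -
  note [measurable] = Hs_measurable[OF u]
  have "(\<integral>x. F x (shift k u x) \<partial>lborel) = (\<integral>x. F (x + k) (u (x + k)) \<partial>lborel)"
    using F_per[OF k] by (simp add: shift_def)
  also have "\<dots> = (\<integral>x. F x (u x) \<partial>lborel)"
    by (rule lborel_integral_shift(1)[of "\<lambda>x. F x (u x)"]) measurable
  finally show ?thesis by (simp add: J_eq[OF u] J_eq[OF shift_Hs[OF u]] B_shift[OF k u u])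
qed

text \<open>Takes the place of weak convergence. In each of the three integrals Young's inequality
  puts an \<epsilon> on the varying function, whose norms are bounded, and a large constant on the
  fixed \<open>v\<close>, which provides the integrable majorant.\<close>

lemma DJ_tendsto:
  assumes X: "\<And>n. X n \<in> Hs s" and C: "\<And>n. B (X n) (X n) \<le> C" and u: "u \<in> Hs s"
    and lim: "AE x in lborel. (\<lambda>n. X n x) \<longlonglongrightarrow> u x" and v: "v \<in> Hs s"
  shows "(\<lambda>n. DJ (X n) v) \<longlonglongrightarrow> DJ u v"
proof -
  note [measurable] = Hs_measurable[OF X] Hs_measurable[OF u] Hs_measurable[OF v]
  define Y where "Y n = X n - u" for n
  have Y: "Y n \<in> Hs s" for n unfolding Y_def using X u by simp
  note [measurable] = Hs_measurable[OF Y]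
  \<comment> \<open>A common bound for the forms of the differences \<open>X n - u\<close>, by the
    triangle inequality.\<close>
  define D where "D = (sqrt C + nrm u)\<^sup>2"
  have YD: "B (Y n) (Y n) \<le> D" for n
  proof -
    have "nrm (Y n) \<le> nrm (X n) + nrm u"
      unfolding Y_def using nrm_triangle[of "X n" "- u"] X u by (simp add: nrm_minus)
    also have "nrm (X n) \<le> sqrt C" unfolding nrm_def using C by simp
    finally have "(nrm (Y n))\<^sup>2 \<le> D" unfolding D_def using Y by (intro power_mono) auto
    thus ?thesis using Y by (simp add: nrm_sq)
  qed
  have 1: "(\<lambda>n. \<integral>z. \<bar>dquot s (Y n) z * dquot s v z\<bar> \<partial>(lborel \<Otimes>\<^sub>M lborel)) \<longlonglongrightarrow> 0"
  proof (rule AE_tendsto_imp_integral_tendsto_0(2)[where k = "\<lambda>n z. (dquot s (Y n) z)\<^sup>2" and C = D])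
    show "AE z in lborel \<Otimes>\<^sub>M lborel. (\<lambda>n. dquot s (Y n) z * dquot s v z) \<longlonglongrightarrow> 0"
      using dquot_tendsto[OF lim, of s]
    proof eventually_elim
      case (elim z)
      have "(\<lambda>n. (dquot s (X n) z - dquot s u z) * dquot s v z) \<longlonglongrightarrow> (dquot s u z - dquot s u z) * dquot s v z"
        by (intro tendsto_intros elim)
      thus ?case by (simp add: Y_def dquot_linear)
    qed
    show "(\<integral>z. (dquot s (Y n) z)\<^sup>2 \<partial>(lborel \<Otimes>\<^sub>M lborel)) \<le> D" for n using dquot_le_B[OF Y, of n] YD[of n] by linarith
    fix \<epsilon> :: real assume "\<epsilon> > 0"
    show "\<exists>\<Phi>. integrable (lborel \<Otimes>\<^sub>M lborel) \<Phi> \<and> (\<forall>n z. \<bar>dquot s (Y n) z * dquot s v z\<bar> \<le> \<Phi> z + \<epsilon> * (dquot s (Y n) z)\<^sup>2)"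
    proof (intro exI[of _ "\<lambda>z. 1 / \<epsilon> * (dquot s v z)\<^sup>2"] conjI allI)
      show "integrable (lborel \<Otimes>\<^sub>M lborel) (\<lambda>z. 1 / \<epsilon> * (dquot s v z)\<^sup>2)" using integrable_Hs(6)[OF v v] by simp
      show "\<bar>dquot s (Y n) z * dquot s v z\<bar> \<le> 1 / \<epsilon> * (dquot s v z)\<^sup>2 + \<epsilon> * (dquot s (Y n) z)\<^sup>2" for n z
        using young_square[OF \<open>\<epsilon> > 0\<close>, of "dquot s (Y n) z" "dquot s v z"] by linarith
    qed
  qed (simp_all add: integrable_Hs(6)[OF Y Y])
  have 2: "(\<lambda>n. \<integral>x. \<bar>V x * Y n x * v x\<bar> \<partial>lborel) \<longlonglongrightarrow> 0"
  proof (rule AE_tendsto_imp_integral_tendsto_0(2)[where k = "\<lambda>n x. (Y n x)\<^sup>2" and C = "D / \<alpha>"])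
    show "AE x in lborel. (\<lambda>n. V x * Y n x * v x) \<longlonglongrightarrow> 0"
      using lim
    proof eventually_elim
      case (elim x)
      have "(\<lambda>n. V x * (X n x - u x) * v x) \<longlonglongrightarrow> V x * (u x - u x) * v x"
        by (intro tendsto_intros elim)
      thus ?case by (simp add: Y_def)
    qed
    show "(\<integral>x. (Y n x)\<^sup>2 \<partial>lborel) \<le> D / \<alpha>" for n by (rule square_bound[OF Y YD])
    fix \<epsilon> :: real assume e: "\<epsilon> > 0"
    show "\<exists>\<Phi>. integrable lborel \<Phi> \<and> (\<forall>n x. \<bar>V x * Y n x * v x\<bar> \<le> \<Phi> x + \<epsilon> * (Y n x)\<^sup>2)"
    proof (intro exI[of _ "\<lambda>x. \<beta> * (\<beta> / \<epsilon> * (v x)\<^sup>2)"] conjI allI)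
      show "integrable lborel (\<lambda>x. \<beta> * (\<beta> / \<epsilon> * (v x)\<^sup>2))" using integrable_Hs(4)[OF v v] by simp
      fix n x
      have "\<epsilon> / \<beta> > 0" using e \<beta>_pos by simp
      from young_square[OF this, of "Y n x" "v x"]
      have "\<bar>Y n x * v x\<bar> \<le> \<epsilon> / \<beta> * (Y n x)\<^sup>2 + \<beta> / \<epsilon> * (v x)\<^sup>2" by simp
      hence "\<beta> * \<bar>Y n x * v x\<bar> \<le> \<beta> * (\<epsilon> / \<beta> * (Y n x)\<^sup>2 + \<beta> / \<epsilon> * (v x)\<^sup>2)" using \<beta>_pos by simp
      also have "\<dots> = \<beta> * (\<beta> / \<epsilon> * (v x)\<^sup>2) + \<epsilon> * (Y n x)\<^sup>2" using \<beta>_pos by (simp add: algebra_simps)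
      finally have "\<beta> * \<bar>Y n x * v x\<bar> \<le> \<beta> * (\<beta> / \<epsilon> * (v x)\<^sup>2) + \<epsilon> * (Y n x)\<^sup>2" .
      moreover have "\<bar>V x * Y n x * v x\<bar> \<le> \<beta> * \<bar>Y n x * v x\<bar>"
        using V_le[of x] V_pos[of x] by (simp add: abs_mult mult.assoc mult_right_mono)
      ultimately show "\<bar>V x * Y n x * v x\<bar> \<le> \<beta> * (\<beta> / \<epsilon> * (v x)\<^sup>2) + \<epsilon> * (Y n x)\<^sup>2" by linarith
    qed
  qed (simp_all add: integrable_Hs(4)[OF Y Y])
  obtain M where M: "M > 0" and fM: "\<And>x t. \<bar>f x t\<bar> \<le> M * (\<bar>t\<bar> + \<bar>t\<bar> powr (q - 1))"
    using f_linear_growth by blast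
  have 3: "(\<lambda>n. \<integral>x. \<bar>(f x (X n x) - f x (u x)) * v x\<bar> \<partial>lborel) \<longlonglongrightarrow> 0"
  proof (rule AE_tendsto_imp_integral_tendsto_0(2)[where k = "\<lambda>n x. (X n x)\<^sup>2 + \<bar>X n x\<bar> powr q" and C = "C / \<alpha> + Sob * C powr (q / 2)"])
    show "(\<lambda>x. (f x (X n x) - f x (u x)) * v x) \<in> borel_measurable lborel" for n by measurable
    show "AE x in lborel. (\<lambda>n. (f x (X n x) - f x (u x)) * v x) \<longlonglongrightarrow> 0"
      using lim
    proof eventually_elim
      case (elim x)
      have "isCont (f x) (u x)" using f_cont_t[of UNIV x] by (simp add: continuous_on_eq_continuous_at)
      hence "(\<lambda>n. f x (X n x)) \<longlonglongrightarrow> f x (u x)" using elim by (rule isCont_tendsto_compose)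
      hence "(\<lambda>n. (f x (X n x) - f x (u x)) * v x) \<longlonglongrightarrow> (f x (u x) - f x (u x)) * v x" by (intro tendsto_intros)
      thus ?case by simp
    qed
    show "integrable lborel (\<lambda>x. (X n x)\<^sup>2 + \<bar>X n x\<bar> powr q)" for n
      using integrable_Hs(4)[OF X X, of n] Sob(2)[OF X, of n] by simp
    show "(\<integral>x. (X n x)\<^sup>2 + \<bar>X n x\<bar> powr q \<partial>lborel) \<le> C / \<alpha> + Sob * C powr (q / 2)" for n
      using integrable_Hs(4)[OF X X, of n] Sob(2)[OF X, of n] square_bound[OF X C, of n] powr_q_bound[OF X C, of n] by simp
    fix \<epsilon> :: real assume e: "\<epsilon> > 0"
    define d where "d = \<epsilon> / M"
    have d: "d > 0" using e M by (simp add: d_def)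
    define \<Phi> where "\<Phi> x = M * (1 / d * (v x)\<^sup>2 + (1 / d) powr (q - 1) * \<bar>v x\<bar> powr q) + \<bar>f x (u x) * v x\<bar>" for x
    show "\<exists>\<Phi>. integrable lborel \<Phi> \<and> (\<forall>n x. \<bar>(f x (X n x) - f x (u x)) * v x\<bar> \<le> \<Phi> x + \<epsilon> * ((X n x)\<^sup>2 + \<bar>X n x\<bar> powr q))"
    proof (intro exI[of _ \<Phi>] conjI allI)
      show "integrable lborel \<Phi>" unfolding \<Phi>_def
        using integrable_Hs(4)[OF v v] Sob(2)[OF v] integrable_fuv[OF u v] by simp
      fix n x
      let ?a = "\<bar>X n x\<bar>" and ?b = "\<bar>v x\<bar>"
      have y1: "?a * ?b \<le> d * (X n x)\<^sup>2 + 1 / d * (v x)\<^sup>2" using young_square[OF d, of "X n x" "v x"] by (simp add: abs_mult)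
      have y2: "?a powr (q - 1) * ?b \<le> d * ?a powr q + (1 / d) powr (q - 1) * ?b powr q"
        using q_gt_2 d by (intro young_powr) auto
      have "\<bar>f x (X n x) * v x\<bar> \<le> M * ((?a + ?a powr (q - 1)) * ?b)"
        using mult_right_mono[OF fM[of x "X n x"], of ?b] by (simp add: abs_mult mult.assoc)
      also have "\<dots> \<le> M * (d * ((X n x)\<^sup>2 + ?a powr q) + (1 / d * (v x)\<^sup>2 + (1 / d) powr (q - 1) * ?b powr q))"
        using y1 y2 M by (intro mult_left_mono) (auto simp: distrib_right distrib_left)
      also have "\<dots> = \<epsilon> * ((X n x)\<^sup>2 + ?a powr q) + M * (1 / d * (v x)\<^sup>2 + (1 / d) powr (q - 1) * ?b powr q)"
        using M by (simp add: d_def distrib_left mult.assoc[symmetric])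
      finally have "\<bar>f x (X n x) * v x\<bar> \<le> \<epsilon> * ((X n x)\<^sup>2 + ?a powr q) + M * (1 / d * (v x)\<^sup>2 + (1 / d) powr (q - 1) * ?b powr q)" .
      moreover have "\<bar>(f x (X n x) - f x (u x)) * v x\<bar> \<le> \<bar>f x (X n x) * v x\<bar> + \<bar>f x (u x) * v x\<bar>"
        by (simp add: left_diff_distrib)
      ultimately show "\<bar>(f x (X n x) - f x (u x)) * v x\<bar> \<le> \<Phi> x + \<epsilon> * ((X n x)\<^sup>2 + \<bar>X n x\<bar> powr q)"
        unfolding \<Phi>_def by linarith
    qed
  qed simp
  have l1: "(\<lambda>n. \<integral>z. dquot s (Y n) z * dquot s v z \<partial>(lborel \<Otimes>\<^sub>M lborel)) \<longlonglongrightarrow> 0"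
    by (rule Lim_null_comparison[OF _ 1]) auto
  have l2: "(\<lambda>n. \<integral>x. V x * Y n x * v x \<partial>lborel) \<longlonglongrightarrow> 0"
    by (rule Lim_null_comparison[OF _ 2]) auto
  have l3: "(\<lambda>n. \<integral>x. (f x (X n x) - f x (u x)) * v x \<partial>lborel) \<longlonglongrightarrow> 0"
    by (rule Lim_null_comparison[OF _ 3]) auto
  have "DJ (X n) v - DJ u v = (\<integral>z. dquot s (Y n) z * dquot s v z \<partial>(lborel \<Otimes>\<^sub>M lborel)) + (\<integral>x. V x * Y n x * v x \<partial>lborel)
      - (\<integral>x. (f x (X n x) - f x (u x)) * v x \<partial>lborel)" for n
  proof -
    have "B (X n) v - B u v = B (Y n) v" unfolding Y_def using X u v by (simp add: bilin)
    moreover have "(\<integral>x. (f x (X n x) - f x (u x)) * v x \<partial>lborel) = (\<integral>x. f x (X n x) * v x \<partial>lborel) - (\<integral>x. f x (u x) * v x \<partial>lborel)"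
      using integrable_fuv[OF X v, of n] integrable_fuv[OF u v] by (simp add: left_diff_distrib)
    ultimately show ?thesis unfolding DJ_eq by (simp add: B_def gform_dquot)
  qed
  moreover have "(\<lambda>n. (\<integral>z. dquot s (Y n) z * dquot s v z \<partial>(lborel \<Otimes>\<^sub>M lborel)) + (\<integral>x. V x * Y n x * v x \<partial>lborel)
      - (\<integral>x. (f x (X n x) - f x (u x)) * v x \<partial>lborel)) \<longlonglongrightarrow> 0 + 0 - 0"
    by (intro tendsto_diff tendsto_add l1 l2 l3)
  ultimately have "(\<lambda>n. DJ (X n) v - DJ u v) \<longlonglongrightarrow> 0" by simp
  thus ?thesis by (simp add: LIM_zero_iff)
qed

end

subsection \<open>Existence of a ground state\<close>

context schroedinger
begin

text \<open>Where the limit \<open>v\<close> is nonzero,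
  \<open>F x (\<rho> n * w n x) / (\<rho> n)^2\<close> is \<open>(w n x)^2\<close> times the
  quotient in (f3) and tends to infinity. If its integrals stayed below \<open>K\<close>, Fatou's
  lemma would make the lower limit finite almost everywhere, so \<open>v\<close> would
  vanish.\<close>

lemma superquadratic:
  assumes w: "\<And>n. w n \<in> Hs s" and lim: "AE x in lborel. (\<lambda>n. w n x) \<longlonglongrightarrow> v x" and nt: "nontrivial v"
    and \<rho>: "filterlim \<rho> at_top sequentially" "\<And>n. \<rho> n > 0"
  shows "\<exists>n. K * (\<rho> n)\<^sup>2 < (\<integral>x. F x (\<rho> n * w n x) \<partial>lborel)"
proof (rule ccontr)
  assume "\<not> ?thesis"
  hence le: "(\<integral>x. F x (\<rho> n * w n x) \<partial>lborel) \<le> K * (\<rho> n)\<^sup>2" for n by (simp add: not_less)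
  define h where "h n x = F x (\<rho> n * w n x) / (\<rho> n)\<^sup>2" for n x
  have iF: "integrable lborel (\<lambda>x. F x (\<rho> n * w n x))" for n
    using integrable_F[of "\<rho> n *\<^sub>R w n"] w by simp
  have ih: "integrable lborel (h n)" for n unfolding h_def using iF by simp
  have [measurable]: "h n \<in> borel_measurable lborel" for n using ih by auto
  have h0: "h n x \<ge> 0" for n x by (simp add: h_def F_nonneg)
  have hK: "(\<integral>x. h n x \<partial>lborel) \<le> K" for n
    unfolding h_def using le[of n] \<rho>(2)[of n] iF[of n] by (simp add: field_simps)
  have "(\<integral>\<^sup>+x. liminf (\<lambda>n. ennreal (h n x)) \<partial>lborel) \<le> liminf (\<lambda>n. \<integral>\<^sup>+x. ennreal (h n x) \<partial>lborel)"
    by (rule nn_integral_liminf) measurable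
  also have "\<dots> = liminf (\<lambda>n. ennreal (\<integral>x. h n x \<partial>lborel))" using ih h0 by (simp add: nn_integral_eq_integral)
  also have "\<dots> \<le> ennreal K" using hK by (intro Liminf_le) (auto intro!: always_eventually ennreal_leI)
  finally have "(\<integral>\<^sup>+x. liminf (\<lambda>n. ennreal (h n x)) \<partial>lborel) \<noteq> \<infinity>" by (auto simp: top_unique)
  hence fin: "AE x in lborel. liminf (\<lambda>n. ennreal (h n x)) \<noteq> \<infinity>"
    by (intro nn_integral_PInf_AE) measurable
  have "AE x in lborel. v x = 0"
    using fin lim
  proof eventually_elim
    case (elim x)
    show "v x = 0"
    proof (rule ccontr)
      assume v: "v x \<noteq> 0"
      have "filterlim (\<lambda>n. \<bar>w n x\<bar> * \<rho> n) at_top sequentially"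
        by (rule filterlim_tendsto_pos_mult_at_top[OF tendsto_rabs[OF elim(2)] _ \<rho>(1)]) (use v in simp)
      hence "filterlim (\<lambda>n. norm (\<rho> n * w n x)) at_top sequentially"
        using \<rho>(2) by (simp add: abs_mult less_imp_le mult.commute)
      hence "filterlim (\<lambda>n. \<rho> n * w n x) at_infinity sequentially" by (rule filterlim_norm_at_top_imp_at_infinity)
      hence "filterlim (\<lambda>n. F x (\<rho> n * w n x) / (\<rho> n * w n x)\<^sup>2) at_top sequentially"
        by (rule filterlim_compose[OF f_super])
      hence "filterlim (\<lambda>n. (w n x)\<^sup>2 * (F x (\<rho> n * w n x) / (\<rho> n * w n x)\<^sup>2)) at_top sequentially"
        by (rule filterlim_tendsto_pos_mult_at_top[OF tendsto_power[OF elim(2)], rotated]) (use v in simp)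
      moreover have "(w n x)\<^sup>2 * (F x (\<rho> n * w n x) / (\<rho> n * w n x)\<^sup>2) = h n x" for n
        unfolding h_def using \<rho>(2)[of n] by (cases "w n x = 0") (auto simp: power_mult_distrib)
      ultimately have "filterlim (\<lambda>n. h n x) at_top sequentially" by simp
      hence "(\<lambda>n. ennreal (h n x)) \<longlonglongrightarrow> \<infinity>" by (simp add: ennreal_tendsto_top_eq_at_top)
      hence "liminf (\<lambda>n. ennreal (h n x)) = \<infinity>" by (intro lim_imp_Liminf) auto
      thus False using elim(1) by simp
    qed
  qed
  thus False using nt by (simp add: nontrivial_def)
qed

lemma min_le_powr_p: "min (t\<^sup>2) (\<bar>t\<bar> powr q) \<le> \<bar>t\<bar> powr p"
proof (cases "\<bar>t\<bar> \<le> 1")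
  case True
  hence "\<bar>t\<bar> powr q \<le> \<bar>t\<bar> powr p" using p_less_q by (cases "t = 0") (auto intro!: powr_mono')
  thus ?thesis by (rule min.coboundedI2)
next
  case False
  hence "\<bar>t\<bar> powr 2 \<le> \<bar>t\<bar> powr p" using p_gt_2 by (intro powr_mono) auto
  hence "t\<^sup>2 \<le> \<bar>t\<bar> powr p" by (simp add: abs_powr_two del: powr_numeral)
  thus ?thesis by (rule min.coboundedI1)
qed

text \<open>In \<open>fF_growth\<close> the \<epsilon>-part meets bounded norms, and the minimum in
  the remainder is at most \<open>|t| powr p\<close>, whose integral tends to 0.\<close>

lemma vanishing_nonlinearity:
  assumes X: "\<And>n. X n \<in> Hs s" and C: "\<And>n. B (X n) (X n) \<le> C"
    and van: "(\<lambda>n. \<integral>x. \<bar>X n x\<bar> powr p \<partial>lborel) \<longlonglongrightarrow> 0" and e: "e > 0"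
  shows "\<forall>\<^sub>F n in sequentially. \<bar>\<integral>x. f x (X n x) * X n x \<partial>lborel\<bar> < e \<and> \<bar>\<integral>x. F x (X n x) \<partial>lborel\<bar> < e"
proof -
  have C0: "C \<ge> 0" using B_nonneg[OF X[of 0]] C[of 0] by linarith
  define D where "D = C / \<alpha> + Sob * C powr (q / 2)"
  have D: "D \<ge> 0" unfolding D_def using C0 \<alpha> Sob(1) by simp
  define \<epsilon> where "\<epsilon> = e / 2 / (D + 1)"
  have \<epsilon>: "\<epsilon> > 0" using e D by (simp add: \<epsilon>_def)
  have \<epsilon>D: "\<epsilon> * D \<le> e / 2"
  proof -
    have "\<epsilon> * D \<le> \<epsilon> * (D + 1)" using \<epsilon> by simp
    also have "\<dots> = e / 2" unfolding \<epsilon>_def using D by (metis add_nonneg_pos less_irrefl nonzero_eq_divide_eq zero_less_one)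
    finally show ?thesis .
  qed
  obtain K where K: "K \<ge> 0" "\<And>x t. \<bar>f x t * t\<bar> \<le> \<epsilon> * (t\<^sup>2 + \<bar>t\<bar> powr q) + K * min (t\<^sup>2) (\<bar>t\<bar> powr q)"
      "\<And>x t. \<bar>F x t\<bar> \<le> \<epsilon> * (t\<^sup>2 + \<bar>t\<bar> powr q) + K * min (t\<^sup>2) (\<bar>t\<bar> powr q)"
    using fF_growth[OF \<epsilon>] by blast
  have bound: "\<bar>\<integral>x. k x \<partial>lborel\<bar> \<le> e / 2 + K * (\<integral>x. \<bar>X n x\<bar> powr p \<partial>lborel)"
    if ik: "integrable lborel k" and k: "\<And>x. \<bar>k x\<bar> \<le> \<epsilon> * ((X n x)\<^sup>2 + \<bar>X n x\<bar> powr q) + K * min ((X n x)\<^sup>2) (\<bar>X n x\<bar> powr q)" for k n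
  proof -
    have "\<bar>\<integral>x. k x \<partial>lborel\<bar> \<le> (\<integral>x. \<bar>k x\<bar> \<partial>lborel)" by simp
    also have "\<dots> \<le> (\<integral>x. \<epsilon> * ((X n x)\<^sup>2 + \<bar>X n x\<bar> powr q) + K * \<bar>X n x\<bar> powr p \<partial>lborel)"
    proof (rule integral_mono)
      show "integrable lborel (\<lambda>x. \<epsilon> * ((X n x)\<^sup>2 + \<bar>X n x\<bar> powr q) + K * \<bar>X n x\<bar> powr p)"
        using integrable_Hs(4)[OF X X, of n] Sob(2)[OF X, of n] integrable_powr_p[OF X, of n] by simp
      show "\<bar>k x\<bar> \<le> \<epsilon> * ((X n x)\<^sup>2 + \<bar>X n x\<bar> powr q) + K * \<bar>X n x\<bar> powr p" for x
        by (rule order_trans[OF k]) (intro add_left_mono mult_left_mono min_le_powr_p K(1))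
    qed (use ik in simp)
    also have "\<dots> = \<epsilon> * ((\<integral>x. (X n x)\<^sup>2 \<partial>lborel) + (\<integral>x. \<bar>X n x\<bar> powr q \<partial>lborel)) + K * (\<integral>x. \<bar>X n x\<bar> powr p \<partial>lborel)"
      using integrable_Hs(4)[OF X X, of n] Sob(2)[OF X, of n] integrable_powr_p[OF X, of n] by simp
    also have "\<dots> \<le> \<epsilon> * D + K * (\<integral>x. \<bar>X n x\<bar> powr p \<partial>lborel)"
      unfolding D_def using \<epsilon> by (intro add_right_mono mult_left_mono add_mono square_bound[OF X C] powr_q_bound[OF X C]) auto
    finally show ?thesis using \<epsilon>D by linarith
  qed
  have "(\<lambda>n. K * (\<integral>x. \<bar>X n x\<bar> powr p \<partial>lborel)) \<longlonglongrightarrow> K * 0" by (intro tendsto_intros van)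
  hence "\<forall>\<^sub>F n in sequentially. K * (\<integral>x. \<bar>X n x\<bar> powr p \<partial>lborel) < e / 2" using e by (intro order_tendstoD(2)) auto
  thus ?thesis
  proof eventually_elim
    case (elim n)
    have "\<bar>\<integral>x. f x (X n x) * X n x \<partial>lborel\<bar> \<le> e / 2 + K * (\<integral>x. \<bar>X n x\<bar> powr p \<partial>lborel)"
      by (rule bound[OF integrable_fuv[OF X X] K(2)])
    moreover have "\<bar>\<integral>x. F x (X n x) \<partial>lborel\<bar> \<le> e / 2 + K * (\<integral>x. \<bar>X n x\<bar> powr p \<partial>lborel)"
      by (rule bound[OF integrable_F[OF X] K(3)])
    ultimately show ?case using elim by linarith
  qed
qed

lemma nonlinearity_near_zero:
  obtains K where "K > 0" "\<And>u. u \<in> Hs s \<Longrightarrow> \<bar>\<integral>x. f x (u x) * u x \<partial>lborel\<bar> \<le> 1/4 * B u u + K * (B u u) powr (q / 2)"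
    "\<And>u. u \<in> Hs s \<Longrightarrow> \<bar>\<integral>x. F x (u x) \<partial>lborel\<bar> \<le> 1/4 * B u u + K * (B u u) powr (q / 2)"
proof -
  \<comment> \<open>Chosen so that \<epsilon> times the L2 part is at most a quarter of
    \<open>B u u\<close>, by \<open>V \<ge> \<alpha>\<close>.\<close>
  define \<epsilon> where "\<epsilon> = \<alpha> / 4"
  have \<epsilon>: "\<epsilon> > 0" using \<alpha> by (simp add: \<epsilon>_def)
  obtain C where C: "C \<ge> 0" "\<And>x t. \<bar>f x t * t\<bar> \<le> \<epsilon> * (t\<^sup>2 + \<bar>t\<bar> powr q) + C * min (t\<^sup>2) (\<bar>t\<bar> powr q)"
      "\<And>x t. \<bar>F x t\<bar> \<le> \<epsilon> * (t\<^sup>2 + \<bar>t\<bar> powr q) + C * min (t\<^sup>2) (\<bar>t\<bar> powr q)"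
    using fF_growth[OF \<epsilon>] by blast
  define K where "K = (\<epsilon> + C) * Sob"
  have K: "K > 0" using \<epsilon> C Sob(1) by (simp add: K_def)
  have bound: "\<bar>\<integral>x. k x \<partial>lborel\<bar> \<le> 1/4 * B u u + K * (B u u) powr (q / 2)"
    if u: "u \<in> Hs s" and ik: "integrable lborel k" and k: "\<And>x. \<bar>k x\<bar> \<le> \<epsilon> * ((u x)\<^sup>2 + \<bar>u x\<bar> powr q) + C * min ((u x)\<^sup>2) (\<bar>u x\<bar> powr q)" for k u
  proof -
    have "\<bar>\<integral>x. k x \<partial>lborel\<bar> \<le> (\<integral>x. \<bar>k x\<bar> \<partial>lborel)" by simp
    also have "\<dots> \<le> (\<integral>x. \<epsilon> * (u x)\<^sup>2 + (\<epsilon> + C) * \<bar>u x\<bar> powr q \<partial>lborel)"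
    proof (rule integral_mono)
      show "integrable lborel (\<lambda>x. \<epsilon> * (u x)\<^sup>2 + (\<epsilon> + C) * \<bar>u x\<bar> powr q)"
        using integrable_Hs(4)[OF u u] Sob(2)[OF u] by simp
      fix x
      have "C * min ((u x)\<^sup>2) (\<bar>u x\<bar> powr q) \<le> C * \<bar>u x\<bar> powr q" using C(1) by (intro mult_left_mono) auto
      hence "\<epsilon> * ((u x)\<^sup>2 + \<bar>u x\<bar> powr q) + C * min ((u x)\<^sup>2) (\<bar>u x\<bar> powr q) \<le> \<epsilon> * ((u x)\<^sup>2 + \<bar>u x\<bar> powr q) + C * \<bar>u x\<bar> powr q"
        by (rule add_left_mono)
      from order_trans[OF k this] show "\<bar>k x\<bar> \<le> \<epsilon> * (u x)\<^sup>2 + (\<epsilon> + C) * \<bar>u x\<bar> powr q"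
        by (simp add: distrib_left distrib_right)
    qed (use ik in simp)
    also have "\<dots> = \<epsilon> * (\<integral>x. (u x)\<^sup>2 \<partial>lborel) + (\<epsilon> + C) * (\<integral>x. \<bar>u x\<bar> powr q \<partial>lborel)"
      using integrable_Hs(4)[OF u u] Sob(2)[OF u] by simp
    also have "\<dots> \<le> \<epsilon> * (B u u / \<alpha>) + (\<epsilon> + C) * (Sob * (B u u) powr (q / 2))"
      using \<epsilon> C(1) by (intro add_mono mult_left_mono square_le_B[OF u] Sob(3)[OF u]) auto
    also have "\<dots> = 1/4 * B u u + K * (B u u) powr (q / 2)" using \<alpha> by (simp add: \<epsilon>_def K_def)
    finally show ?thesis .
  qed
  show ?thesis
    by (rule that[OF K]) (rule bound[OF _ integrable_fuv C(2)] bound[OF _ integrable_F C(3)]; assumption)+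
qed

text \<open>The radius satisfies \<open>K * r powr (q - 2) = 1/8\<close>, whence
  \<open>J u \<ge> r^2 / 2 - r^2 / 4 - r^2 / 8 = r^2 / 8\<close> on the sphere.\<close>

lemma mountain_pass_geometry: "\<exists>r>0. \<exists>a>0. \<forall>u\<in>Hs s. nrm u = r \<longrightarrow> a \<le> J u"
proof -
  obtain K where K: "K > 0" "\<And>u. u \<in> Hs s \<Longrightarrow> \<bar>\<integral>x. F x (u x) \<partial>lborel\<bar> \<le> 1/4 * B u u + K * (B u u) powr (q / 2)"
    using nonlinearity_near_zero by metis
  define r where "r = (1 / (8 * K)) powr (1 / (q - 2))"
  have r: "r > 0" "r powr (q - 2) = 1 / (8 * K)" using K(1) q_gt_2 by (auto simp: r_def powr_powr)
  have "r\<^sup>2 / 8 \<le> J u" if u: "u \<in> Hs s" and n: "nrm u = r" for u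
  proof -
    have Bu: "B u u = r\<^sup>2" using nrm_sq[OF u] n by simp
    have "(r\<^sup>2) powr (q / 2) = (r powr 2) powr (q / 2)" using r by simp
    also have "\<dots> = r powr q" by (simp add: powr_powr del: powr_numeral)
    also have "\<dots> = r powr (q - 2) * r powr 2" by (simp flip: powr_add del: powr_numeral)
    also have "\<dots> = r\<^sup>2 / (8 * K)" using r by simp
    finally have "K * (B u u) powr (q / 2) = r\<^sup>2 / 8" unfolding Bu using K(1) by simp
    thus ?thesis using K(2)[OF u] unfolding J_eq[OF u] Bu by linarith
  qed
  thus ?thesis using r(1) by (intro exI[of _ r] conjI exI[of _ "r\<^sup>2 / 8"]) auto
qed

section \<open>Bounds for critical points and Cerami sequences\<close>

lemma nontrivial_B_pos:
  assumes u: "u \<in> Hs s" and nt: "nontrivial u" shows "0 < B u u"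
proof (rule ccontr)
  assume "\<not> 0 < B u u"
  hence "(\<integral>x. (u x)\<^sup>2 \<partial>lborel) = 0"
    using square_le_B[OF u] B_nonneg[OF u] \<alpha> by (simp add: antisym)
  hence "AE x in lborel. (u x)\<^sup>2 = 0"
    using integral_nonneg_eq_0_iff_AE[OF integrable_Hs(4)[OF u u]] by simp
  hence "AE x in lborel. u x = 0" by simp
  thus False using nt by (simp add: nontrivial_def)
qed

text \<open>For form below c, chosen by \<open>K * c powr (q/2 - 1) = 1/2\<close>, the identity
  \<open>B u u = \<integral> f x u u\<close> would give \<open>B u u \<le> 3/4 * B u u\<close>. It
  keeps a sequence of nontrivial critical points from vanishing.\<close>

lemma critical_lower_bound:
  "\<exists>c>0. \<forall>u\<in>Hs s. nontrivial u \<longrightarrow> DJ u u = 0 \<longrightarrow> c \<le> B u u"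
proof -
  obtain K where K: "K > 0" "\<And>u. u \<in> Hs s \<Longrightarrow> \<bar>\<integral>x. f x (u x) * u x \<partial>lborel\<bar> \<le> 1/4 * B u u + K * (B u u) powr (q / 2)"
    using nonlinearity_near_zero by metis
  define c where "c = (1 / (2 * K)) powr (1 / (q / 2 - 1))"
  have e: "q / 2 - 1 > 0" using q_gt_2 by simp
  have c: "c > 0" "c powr (q / 2 - 1) = 1 / (2 * K)" using K(1) e by (auto simp: c_def powr_powr)
  have "c \<le> B u u" if u: "u \<in> Hs s" and nt: "nontrivial u" and D: "DJ u u = 0" for u
  proof (rule ccontr)
    assume "\<not> c \<le> B u u"
    hence lt: "B u u < c" by simp
    have pos: "0 < B u u" by (rule nontrivial_B_pos[OF u nt])
    have "(B u u) powr (q / 2) = (B u u) powr (q / 2 - 1) * B u u" using pos by (simp add: powr_diff)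
    also have "\<dots> \<le> 1 / (2 * K) * B u u"
      unfolding c(2)[symmetric] using lt pos e by (intro mult_right_mono powr_mono2) auto
    finally have "K * (B u u) powr (q / 2) \<le> 1/2 * B u u" using K(1) by (simp add: field_simps)
    moreover have "B u u = (\<integral>x. f x (u x) * u x \<partial>lborel)" using D by (simp add: DJ_eq)
    ultimately show False using K(2)[OF u] pos by linarith
  qed
  thus ?thesis using c(1) by blast
qed

lemma J_zero: "J 0 = 0"
  by (subst J_eq) simp_all

text \<open>Only a lower bound on \<open>DJ (X n) (X n)\<close> is asked, so Cerami sequences and
  sequences of critical points both qualify. With \<open>J \<le> b\<close> it gives
  \<open>\<integral> G \<le> 2 * b + 1\<close>, the quantity that (f4) compares along rays.
  Nonvanishing contradicts \<open>0 \<le> J\<close>.\<close>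

lemma energy_bounded_imp_bounded:
  assumes X: "\<And>n::nat. X n \<in> Hs s" and J: "\<And>n. 0 \<le> J (X n)" "\<And>n. J (X n) \<le> b" and D: "\<And>n. DJ (X n) (X n) \<ge> - 1"
  shows "\<exists>C. \<forall>n. B (X n) (X n) \<le> C"
proof (rule ccontr)
  assume "\<not> ?thesis"
  hence unb: "\<exists>n. C < B (X n) (X n)" for C by (meson not_le)
  have "\<exists>n. real (Suc k) \<le> nrm (X n)" for k
  proof -
    obtain n where "(real (Suc k))\<^sup>2 < B (X n) (X n)" using unb by blast
    hence "sqrt ((real (Suc k))\<^sup>2) \<le> nrm (X n)" unfolding nrm_def by (intro real_sqrt_le_mono) simp
    thus ?thesis by (intro exI[of _ n]) simp
  qed
  then obtain \<iota> where \<iota>: "\<And>k. real (Suc k) \<le> nrm (X (\<iota> k))" by metis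
  define Y where "Y k = X (\<iota> k)" for k
  have Y: "Y k \<in> Hs s" for k by (simp add: Y_def X)
  have Yn: "real (Suc k) \<le> nrm (Y k)" for k unfolding Y_def by (rule \<iota>)
  have Yp: "nrm (Y k) > 0" for k using Yn[of k] by simp
  define w where "w k = (1 / nrm (Y k)) *\<^sub>R Y k" for k
  have w: "w k \<in> Hs s" for k unfolding w_def using Y by simp
  have wn: "nrm (w k) = 1" for k unfolding w_def using Y[of k] Yp[of k] by (simp add: nrm_scale)
  have wB: "B (w k) (w k) = 1" for k using nrm_sq[OF w[of k]] wn[of k] by simp
  have b0: "b \<ge> 0" using J(1)[of 0] J(2)[of 0] by linarith
  have "(\<lambda>n. \<integral>x. \<bar>w n x\<bar> powr p \<partial>lborel) \<longlonglongrightarrow> 0 \<or>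
    (\<exists>r k u. strict_mono (r::nat\<Rightarrow>nat) \<and> (\<forall>n. k n \<in> int_lattice) \<and> u \<in> Hs s \<and> nontrivial u \<and>
      (AE x in lborel. (\<lambda>n. shift (k n) (w (r n)) x) \<longlonglongrightarrow> u x))"
    by (rule lions_alternative[of w 1, OF w]) (simp add: wB)
  thus False
  proof
    assume van: "(\<lambda>n. \<integral>x. \<bar>w n x\<bar> powr p \<partial>lborel) \<longlonglongrightarrow> 0"
    \<comment> \<open>The level reached on the rays is \<open>Q / 4\<close>. It exceeds
      \<open>b\<close>, so the maximum is not at the end point, and \<open>Q / 2\<close> exceeds
      \<open>lam * (2 * b + 1)\<close>, the bound that (f4) imposes on twice the maximum.\<close>
    define Q where "Q = 4 * (lam * (2 * b + 1) + b + 1)"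
    define R where "R = sqrt Q"
    have l: "0 < lam * (2 * b + 1)" using lam b0 by (intro mult_pos_pos) auto
    have Q: "Q > 0" using l b0 by (simp add: Q_def)
    have R: "R > 0" "R\<^sup>2 = Q" using Q by (auto simp: R_def)
    have RwH: "R *\<^sub>R w n \<in> Hs s" for n using w by simp
    have RwB: "B (R *\<^sub>R w n) (R *\<^sub>R w n) = Q" for n
      using w[of n] wB[of n] R by (simp add: bilin power2_eq_square)
    have "(\<lambda>n. R powr p * (\<integral>x. \<bar>w n x\<bar> powr p \<partial>lborel)) \<longlonglongrightarrow> R powr p * 0" by (intro tendsto_intros van)
    moreover have "(\<integral>x. \<bar>(R *\<^sub>R w n) x\<bar> powr p \<partial>lborel) = R powr p * (\<integral>x. \<bar>w n x\<bar> powr p \<partial>lborel)" for n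
      using R(1) by (simp add: abs_mult powr_mult)
    ultimately have Rvan: "(\<lambda>n. \<integral>x. \<bar>(R *\<^sub>R w n) x\<bar> powr p \<partial>lborel) \<longlonglongrightarrow> 0" by simp
    have "\<forall>\<^sub>F n in sequentially. \<bar>\<integral>x. f x ((R *\<^sub>R w n) x) * (R *\<^sub>R w n) x \<partial>lborel\<bar> < Q / 4 \<and> \<bar>\<integral>x. F x ((R *\<^sub>R w n) x) \<partial>lborel\<bar> < Q / 4"
    proof (rule vanishing_nonlinearity[of "\<lambda>n. R *\<^sub>R w n" Q, OF RwH _ Rvan])
      show "B (R *\<^sub>R w n) (R *\<^sub>R w n) \<le> Q" for n by (simp only: RwB)
    qed (use Q in simp)
    moreover obtain n0 :: nat where n0: "R \<le> real n0" using real_arch_simple by blast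
    ultimately obtain n where n: "n \<ge> n0" "\<bar>\<integral>x. F x ((R *\<^sub>R w n) x) \<partial>lborel\<bar> < Q / 4"
      by (metis (mono_tags, lifting) eventually_sequentially nle_le)
    have JR: "J (R *\<^sub>R w n) \<ge> Q / 4" using n(2) unfolding J_eq[OF RwH] RwB by linarith
    define t0 where "t0 = R / nrm (Y n)"
    have "R \<le> nrm (Y n)" using n0 n(1) Yn[of n] by simp
    hence t0: "0 \<le> t0" "t0 \<le> 1" using R Yp[of n] by (auto simp: t0_def)
    have t0Y: "t0 *\<^sub>R Y n = R *\<^sub>R w n" unfolding w_def t0_def by simp
    define j where "j t = J (t *\<^sub>R Y n)" for t
    have jd: "(j has_real_derivative DJ (t *\<^sub>R Y n) (Y n)) (at t)" for t
      unfolding j_def by (rule J_ray[OF Y])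
    have "continuous_on {0..1} j" by (meson jd DERIV_isCont continuous_at_imp_continuous_on)
    then obtain t1 where t1: "t1 \<in> {0..1}" "\<And>t. t \<in> {0..1} \<Longrightarrow> j t \<le> j t1"
      using continuous_attains_sup[of "{0..1::real}" j] by auto
    have j1: "j t1 \<ge> Q / 4" using t1(2)[of t0] t0 JR by (simp add: j_def t0Y)
    have "j 0 = 0" by (simp add: j_def J_zero)
    hence "t1 \<noteq> 0" using j1 Q by auto
    moreover have "j 1 \<le> b" using J(2) by (simp add: j_def Y_def)
    have "b < Q / 4" using l by (simp add: Q_def)
    hence "t1 \<noteq> 1" using j1 \<open>j 1 \<le> b\<close> by auto
    \<comment> \<open>Both ends of the segment lie below \<open>Q / 4\<close>, so the maximum is
      interior and the radial derivative vanishes there.\<close>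
    ultimately have t1': "0 < t1" "t1 < 1" using t1(1) by auto
    have D0: "DJ (t1 *\<^sub>R Y n) (Y n) = 0"
    proof (rule DERIV_local_max[OF jd])
      show "0 < min t1 (1 - t1)" using t1' by simp
      show "\<forall>y. \<bar>t1 - y\<bar> < min t1 (1 - t1) \<longrightarrow> j y \<le> j t1" using t1(2) by (auto simp: abs_less_iff)
    qed
    have tY: "t1 *\<^sub>R Y n \<in> Hs s" using Y by simp
    \<comment> \<open>Since the radial derivative is 0, twice the maximum is the integral of
      \<open>G\<close> at \<open>t1 *\<^sub>R Y n\<close>; (f4) with \<theta> = \<open>t1\<close>
      compares it with the end point \<open>Y n\<close>.\<close>
    have "2 * j t1 = (\<integral>x. G x ((t1 *\<^sub>R Y n) x) \<partial>lborel)"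
      unfolding G_identity[OF tY] using DJ_linear(2)[OF tY Y, of t1 n] D0 by (simp add: j_def)
    also have "\<dots> \<le> (\<integral>x. lam * G x (Y n x) \<partial>lborel)"
    proof (rule integral_mono)
      show "integrable lborel (\<lambda>x. G x ((t1 *\<^sub>R Y n) x))" by (rule integrable_G[OF tY])
      show "integrable lborel (\<lambda>x. lam * G x (Y n x))" using integrable_G[OF Y] by simp
      show "G x ((t1 *\<^sub>R Y n) x) \<le> lam * G x (Y n x)" for x using G_scale_le t1' by simp
    qed
    also have "\<dots> = lam * (2 * J (Y n) - DJ (Y n) (Y n))" by (simp add: G_identity[OF Y])
    also have "\<dots> \<le> lam * (2 * b + 1)"
    proof (rule mult_left_mono)
      show "2 * J (Y n) - DJ (Y n) (Y n) \<le> 2 * b + 1" using J(2)[of "\<iota> n"] D[of "\<iota> n"] by (simp add: Y_def)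
    qed (use lam in simp)
    finally have "2 * (Q / 4) \<le> lam * (2 * b + 1)" using j1 by linarith
    thus False using l b0 by (simp add: Q_def)
  next
    assume "\<exists>r k u. strict_mono (r::nat\<Rightarrow>nat) \<and> (\<forall>n. k n \<in> int_lattice) \<and> u \<in> Hs s \<and> nontrivial u \<and>
      (AE x in lborel. (\<lambda>n. shift (k n) (w (r n)) x) \<longlonglongrightarrow> u x)"
    then obtain r k u where r: "strict_mono (r::nat\<Rightarrow>nat)" and k0: "\<forall>n. k n \<in> int_lattice" and u: "u \<in> Hs s" "nontrivial u"
      and lim: "AE x in lborel. (\<lambda>n. shift (k n) (w (r n)) x) \<longlonglongrightarrow> u x" by (elim exE conjE)
    from k0 have k: "k n \<in> int_lattice" for n by blast
    define \<rho> where "\<rho> n = nrm (Y (r n))" for n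
    have "real n \<le> \<rho> n" for n using Yn[of "r n"] seq_suble[OF r, of n] unfolding \<rho>_def by simp
    hence "filterlim \<rho> at_top sequentially"
      by (intro filterlim_at_top_mono[OF filterlim_real_sequentially]) (auto intro!: always_eventually)
    moreover have "\<rho> n > 0" for n unfolding \<rho>_def by (rule Yp)
    ultimately obtain n where n: "1/2 * (\<rho> n)\<^sup>2 < (\<integral>x. F x (\<rho> n * shift (k n) (w (r n)) x) \<partial>lborel)"
      using superquadratic[of "\<lambda>n. shift (k n) (w (r n))" u \<rho> "1/2", OF shift_Hs[OF w] lim u(2)] by blast
    \<comment> \<open>Multiplying the translated normalised function by \<rho> gives back a
      translate of \<open>Y\<close>, whose energy is that of \<open>Y\<close> and would be
      negative.\<close>
    define Z where "Z = shift (k n) (Y (r n))"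
    have Z: "Z \<in> Hs s" unfolding Z_def by (rule shift_Hs[OF Y])
    have "\<rho> n * shift (k n) (w (r n)) x = Z x" for x
      unfolding Z_def \<rho>_def w_def using Yp[of "r n"] by (simp add: shift_def)
    hence "1/2 * (\<rho> n)\<^sup>2 < (\<integral>x. F x (Z x) \<partial>lborel)" using n by simp
    moreover have "B Z Z = (\<rho> n)\<^sup>2" unfolding Z_def \<rho>_def B_shift[OF k Y Y] nrm_sq[OF Y] ..
    ultimately have "J Z < 0" by (simp add: J_eq[OF Z])
    moreover have "J Z = J (Y (r n))" unfolding Z_def by (rule J_shift[OF k Y])
    ultimately show False using J(1)[of "\<iota> (r n)"] by (simp add: Y_def)
  qed
qed

text \<open>Vanishing is excluded because \<open>B (X n) (X n)\<close> is the sum of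
  \<open>DJ (X n) (X n)\<close> and the nonlinear integral, both of which would tend to 0, against
  the lower bound \<open>c\<close>. The bound on the derivative is invariant under lattice
  translations and passes to the limit by \<open>DJ_tendsto\<close>.\<close>

lemma critical_limit:
  assumes X: "\<And>n. X n \<in> Hs s" and C: "\<And>n. B (X n) (X n) \<le> C"
    and \<delta>: "\<delta> \<longlonglongrightarrow> 0" "\<And>n v. v \<in> Hs s \<Longrightarrow> \<bar>DJ (X n) v\<bar> \<le> \<delta> n * nrm v"
    and c: "c > 0" "\<And>n. c \<le> B (X n) (X n)"
  shows "\<exists>r k u. strict_mono (r::nat\<Rightarrow>nat) \<and> (\<forall>n. k n \<in> int_lattice) \<and> u \<in> Hs s \<and> nontrivial u \<and> crit_point s V f u \<and>
      (AE x in lborel. (\<lambda>n. shift (k n) (X (r n)) x) \<longlonglongrightarrow> u x)"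
proof -
  have nv: "\<not> (\<lambda>n. \<integral>x. \<bar>X n x\<bar> powr p \<partial>lborel) \<longlonglongrightarrow> 0"
  proof
    assume van: "(\<lambda>n. \<integral>x. \<bar>X n x\<bar> powr p \<partial>lborel) \<longlonglongrightarrow> 0"
    have "(\<lambda>n. \<bar>\<delta> n\<bar> * sqrt C) \<longlonglongrightarrow> \<bar>0\<bar> * sqrt C" by (intro tendsto_intros \<delta>(1))
    hence "\<forall>\<^sub>F n in sequentially. \<bar>\<delta> n\<bar> * sqrt C < c / 2" using c by (intro order_tendstoD(2)) auto
    moreover have "\<forall>\<^sub>F n in sequentially. \<bar>\<integral>x. f x (X n x) * X n x \<partial>lborel\<bar> < c / 2 \<and> \<bar>\<integral>x. F x (X n x) \<partial>lborel\<bar> < c / 2"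
      using c by (intro vanishing_nonlinearity[OF X C van]) auto
    ultimately have "\<forall>\<^sub>F n in sequentially. False"
    proof eventually_elim
      case (elim n)
      have "\<bar>DJ (X n) (X n)\<bar> \<le> \<delta> n * nrm (X n)" by (rule \<delta>(2)[OF X])
      also have "\<dots> \<le> \<bar>\<delta> n\<bar> * nrm (X n)" using X by (intro mult_right_mono) auto
      also have "\<dots> \<le> \<bar>\<delta> n\<bar> * sqrt C" unfolding nrm_def using C by (intro mult_left_mono) auto
      finally have "\<bar>DJ (X n) (X n)\<bar> < c / 2" using elim by linarith
      thus False using elim c(2)[of n] unfolding DJ_eq by linarith
    qed
    thus False by simp
  qed
  have "\<exists>r k u. strict_mono (r::nat\<Rightarrow>nat) \<and> (\<forall>n. k n \<in> int_lattice) \<and> u \<in> Hs s \<and> nontrivial u \<and>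
      (AE x in lborel. (\<lambda>n. shift (k n) (X (r n)) x) \<longlonglongrightarrow> u x)"
    by (rule disjE[OF lions_alternative[of X C, OF X C]], erule notE[OF nv], assumption)
  then obtain r k u where r: "strict_mono (r::nat\<Rightarrow>nat)" and k0: "\<forall>n. k n \<in> int_lattice"
    and u: "u \<in> Hs s" "nontrivial u" and lim: "AE x in lborel. (\<lambda>n. shift (k n) (X (r n)) x) \<longlonglongrightarrow> u x"
    by (elim exE conjE)
  from k0 have k: "k n \<in> int_lattice" for n by blast
  have "DJ u v = 0" if v: "v \<in> Hs s" for v
  proof -
    have "(\<lambda>n. DJ (shift (k n) (X (r n))) v) \<longlonglongrightarrow> DJ u v"
      by (rule DJ_tendsto[where C = C]) (use shift_Hs[OF X] B_shift[OF k X X] C u lim v in auto)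
    moreover have "(\<lambda>n. DJ (shift (k n) (X (r n))) v) \<longlonglongrightarrow> 0"
    proof (rule Lim_null_comparison)
      have "\<bar>DJ (shift (k n) (X (r n))) v\<bar> \<le> \<delta> (r n) * nrm v" for n
      proof -
        \<comment> \<open>The test function is translated back; its norm is unchanged, so the
          estimate for \<open>X (r n)\<close> applies.\<close>
        define v' where "v' = shift (- k n) v"
        have v': "v' \<in> Hs s" unfolding v'_def by (rule shift_Hs[OF v])
        have vv: "v = shift (k n) v'" unfolding v'_def shift_shift ..
        have "DJ (shift (k n) (X (r n))) v = DJ (X (r n)) v'" by (subst vv) (rule DJ_shift[OF k X v'])
        moreover have "nrm v = nrm v'" unfolding nrm_def by (subst (1 2) vv) (simp only: B_shift[OF k v' v'])
        ultimately show ?thesis using \<delta>(2)[OF v', of "r n"] by simp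
      qed
      thus "\<forall>\<^sub>F n in sequentially. norm (DJ (shift (k n) (X (r n))) v) \<le> \<delta> (r n) * nrm v" by simp
      have "(\<lambda>n. \<delta> (r n)) \<longlonglongrightarrow> 0" using LIMSEQ_subseq_LIMSEQ[OF \<delta>(1) r] by (simp add: o_def)
      from tendsto_mult_right[OF this, of "nrm v"] show "(\<lambda>n. \<delta> (r n) * nrm v) \<longlonglongrightarrow> 0" by simp
    qed
    ultimately show ?thesis by (rule LIMSEQ_unique)
  qed
  hence "crit_point s V f u" using u by (simp add: crit_point_def)
  thus ?thesis using r k u lim by blast
qed

text \<open>The far end point comes from \<open>superquadratic\<close> for the constant sequence
  \<phi>, and the upper level \<open>b\<close> is the maximum of the energy on the segment. The
  mountain pass theorem is applied with tolerances 1 / (n + 1).\<close>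

lemma exists_critical_point: "\<exists>u. u \<in> Hs s \<and> nontrivial u \<and> crit_point s V f u"
proof -
  obtain r a where r: "r > 0" and a: "a > 0" "\<And>u. u \<in> Hs s \<Longrightarrow> nrm u = r \<Longrightarrow> a \<le> J u"
    using mountain_pass_geometry by blast
  define \<phi> :: "'a \<Rightarrow> real" where "\<phi> x = max 0 (1 - norm x)" for x
  have \<phi>: "\<phi> \<in> Hs s" "nontrivial \<phi>" unfolding \<phi>_def using bump_Hs[OF s, where 'a = 'a] by auto
  have \<phi>B: "B \<phi> \<phi> > 0" by (rule nontrivial_B_pos[OF \<phi>])
  have \<phi>n: "nrm \<phi> > 0" using \<phi>B by (simp add: nrm_def)
  obtain m0 :: nat where m0: "r / nrm \<phi> < real m0" using reals_Archimedean2 by blast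
  \<comment> \<open>Starting at \<open>m0 + 1\<close> puts every multiple
    \<open>\<rho> n *\<^sub>R \<phi>\<close> outside the sphere of radius \<open>r\<close>, so
    whichever n \<open>superquadratic\<close> returns is admissible.\<close>
  define \<rho> where "\<rho> n = real (n + m0 + 1)" for n
  have \<rho>: "\<rho> n > 0" "\<rho> n > r / nrm \<phi>" for n using m0 by (auto simp: \<rho>_def)
  have "filterlim \<rho> at_top sequentially"
    by (rule filterlim_at_top_mono[OF filterlim_real_sequentially]) (auto simp: \<rho>_def)
  then obtain n where n: "1/2 * B \<phi> \<phi> * (\<rho> n)\<^sup>2 < (\<integral>x. F x (\<rho> n * \<phi> x) \<partial>lborel)"
    using superquadratic[of "\<lambda>n. \<phi>" \<phi> \<rho> "1/2 * B \<phi> \<phi>"] \<phi> \<rho>(1) by auto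
  define e where "e = \<rho> n *\<^sub>R \<phi>"
  have e: "e \<in> Hs s" using \<phi> by (simp add: e_def)
  have "B e e = (\<rho> n)\<^sup>2 * B \<phi> \<phi>" unfolding e_def using \<phi> by (simp add: bilin power2_eq_square)
  hence eJ: "J e \<le> 0" unfolding J_eq[OF e] using n by (simp add: e_def mult.commute)
  have en: "nrm e > r" unfolding e_def using \<phi> \<rho>[of n] \<phi>n by (simp add: nrm_scale field_simps)
  have "continuous_on {0..1} (\<lambda>t. J (t *\<^sub>R e))"
    by (intro continuous_at_imp_continuous_on ballI DERIV_isCont[OF J_ray[OF e]])
  then obtain t1 where t1: "\<forall>t\<in>{0..1}. J (t *\<^sub>R e) \<le> J (t1 *\<^sub>R e)"
    using continuous_attains_sup[of "{0..1::real}" "\<lambda>t. J (t *\<^sub>R e)"] by auto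
  define b where "b = J (t1 *\<^sub>R e)"
  have b: "J (t *\<^sub>R e) \<le> b" if "0 \<le> t" "t \<le> 1" for t using t1 that by (simp add: b_def)
  have "\<exists>u\<in>Hs s. a / 2 \<le> J u \<and> J u \<le> b \<and> nrm (W u) < 1 / real (Suc n) \<and> \<bar>B (W u) u\<bar> < 1 / real (Suc n)" for n
  proof (rule mountain_pass)
    show "\<exists>\<tau>>0. \<forall>u\<in>Hs s. \<forall>v\<in>Hs s. nrm u \<le> R \<longrightarrow> nrm v \<le> \<tau> \<longrightarrow> \<bar>J (u + v) - J u - B (W u) v\<bar> \<le> \<epsilon> * nrm v" if "\<epsilon> > 0" for R \<epsilon>
      using J_unif_diff[OF that, of R] W(2) by auto
  qed (use W(1) W_cont J_zero e eJ en r a b in auto)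
  then obtain X where X: "\<And>n. X n \<in> Hs s" "\<And>n. a / 2 \<le> J (X n)" "\<And>n. J (X n) \<le> b"
    "\<And>n. nrm (W (X n)) < 1 / real (Suc n)" "\<And>n. \<bar>B (W (X n)) (X n)\<bar> < 1 / real (Suc n)" by metis
  have D: "DJ (X n) (X n) \<ge> - 1" for n
  proof -
    have "1 / real (Suc n) \<le> 1" by simp
    thus ?thesis using X(5)[of n] W(2)[OF X(1) X(1), of n n] by linarith
  qed
  have J0: "0 \<le> J (X n)" for n using X(2)[of n] a by linarith
  obtain C where C: "\<And>n. B (X n) (X n) \<le> C" using energy_bounded_imp_bounded[of X b, OF X(1) J0 X(3) D] by blast
  have "\<exists>r k u. strict_mono (r::nat\<Rightarrow>nat) \<and> (\<forall>n. k n \<in> int_lattice) \<and> u \<in> Hs s \<and> nontrivial u \<and> crit_point s V f u \<and>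
      (AE x in lborel. (\<lambda>n. shift (k n) (X (r n)) x) \<longlonglongrightarrow> u x)"
  proof (rule critical_limit[where \<delta> = "\<lambda>n. inverse (real (Suc n))", OF X(1) C LIMSEQ_inverse_real_of_nat])
    fix n and v :: "'a \<Rightarrow> real" assume v: "v \<in> Hs s"
    have "\<bar>DJ (X n) v\<bar> \<le> nrm (W (X n)) * nrm v"
      unfolding W(2)[OF X(1) v] by (rule cauchy_schwarz[OF W(1)[OF X(1)] v])
    also have "\<dots> \<le> inverse (real (Suc n)) * nrm v"
      using X(4)[of n] v by (intro mult_right_mono) (auto simp: inverse_eq_divide)
    finally show "\<bar>DJ (X n) v\<bar> \<le> inverse (real (Suc n)) * nrm v" .
  next
    fix n
    \<comment> \<open>As the integral of \<open>F\<close> is nonnegative,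
      \<open>B (X n) (X n) \<ge> 2 * J (X n) \<ge> a\<close>; this is the lower bound that excludes
      vanishing.\<close>
    have "0 \<le> (\<integral>x. F x (X n x) \<partial>lborel)" by (simp add: F_nonneg)
    thus "a \<le> B (X n) (X n)" using X(2)[of n] unfolding J_eq[OF X(1)] by linarith
  qed (rule a(1))
  thus ?thesis by blast
qed

theorem ground_state:
  "\<exists>u. u \<in> Hs s \<and> nontrivial u \<and> crit_point s V f u
     \<and> J u = Inf {J v | v. v \<in> Hs s \<and> nontrivial v \<and> crit_point s V f v}
     \<and> (\<forall>v. v \<in> Hs s \<and> nontrivial v \<and> crit_point s V f v \<longrightarrow> J u \<le> J v)"
proof -
  define S where "S = {J v | v. v \<in> Hs s \<and> nontrivial v \<and> crit_point s V f v}"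
  have crit: "DJ v v = 0" "0 \<le> J v" "J v = 1/2 * (\<integral>x. G x (v x) \<partial>lborel)" if "v \<in> Hs s" "crit_point s V f v" for v
  proof -
    show "DJ v v = 0" using that by (simp add: crit_point_def)
    thus "J v = 1/2 * (\<integral>x. G x (v x) \<partial>lborel)" using G_identity[OF that(1)] by simp
    moreover have "0 \<le> (\<integral>x. G x (v x) \<partial>lborel)" by (simp add: G_nonneg)
    ultimately show "0 \<le> J v" by linarith
  qed
  have ne: "S \<noteq> {}" using exists_critical_point by (auto simp: S_def)
  have bdd: "bdd_below S" using crit(2) by (auto simp: S_def intro!: bdd_belowI[of _ 0])
  define m where "m = Inf S"
  have "\<exists>v. v \<in> Hs s \<and> nontrivial v \<and> crit_point s V f v \<and> J v < m + inverse (real (Suc n))" for n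
  proof -
    have "Inf S < m + inverse (real (Suc n))" by (simp add: m_def)
    from cInf_lessD[OF ne this] show ?thesis by (auto simp: S_def)
  qed
  then obtain X where X: "\<And>n. X n \<in> Hs s" "\<And>n. nontrivial (X n)" "\<And>n. crit_point s V f (X n)"
    "\<And>n. J (X n) < m + inverse (real (Suc n))" by metis
  have Jb: "J (X n) \<le> m + 1" for n
  proof -
    have "inverse (real (Suc n)) \<le> 1" by (simp add: inverse_eq_divide)
    thus ?thesis using X(4)[of n] by linarith
  qed
  obtain C where C: "\<And>n. B (X n) (X n) \<le> C"
    using energy_bounded_imp_bounded[of X "m + 1", OF X(1) crit(2)[OF X(1) X(3)] Jb] crit(1)[OF X(1) X(3)] by auto
  obtain c where c: "c > 0" "\<And>u. u \<in> Hs s \<Longrightarrow> nontrivial u \<Longrightarrow> DJ u u = 0 \<Longrightarrow> c \<le> B u u"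
    using critical_lower_bound by blast
  have "\<exists>r k u. strict_mono (r::nat\<Rightarrow>nat) \<and> (\<forall>n. k n \<in> int_lattice) \<and> u \<in> Hs s \<and> nontrivial u \<and> crit_point s V f u \<and>
      (AE x in lborel. (\<lambda>n. shift (k n) (X (r n)) x) \<longlonglongrightarrow> u x)"
  proof (rule critical_limit[where \<delta> = "\<lambda>n. 0", OF X(1) C])
    show "\<bar>DJ (X n) v\<bar> \<le> 0 * nrm v" if "v \<in> Hs s" for n v using X(3)[of n] that by (simp add: crit_point_def)
    show "c \<le> B (X n) (X n)" for n by (rule c(2)[OF X(1) X(2) crit(1)[OF X(1) X(3)]])
  qed (use c in auto)
  then obtain r k u where r: "strict_mono (r::nat\<Rightarrow>nat)" and k0: "\<forall>n. k n \<in> int_lattice" and u: "u \<in> Hs s" "nontrivial u" "crit_point s V f u"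
    and lim: "AE x in lborel. (\<lambda>n. shift (k n) (X (r n)) x) \<longlonglongrightarrow> u x" by (elim exE conjE)
  from k0 have k: "k n \<in> int_lattice" for n by blast
  have Ju: "J u \<le> m + inverse (real (Suc N))" for N
  proof -
    define E where "E = m + inverse (real (Suc N))"
    \<comment> \<open>The tail from \<open>N\<close> on: there \<open>r (n + N) \<ge> N\<close>, so
      every energy is at most \<open>E\<close>. Fatou's lemma bounds the energy of \<open>u\<close>
      by \<open>E\<close>, and \<open>N\<close> is arbitrary.\<close>
    define Z where "Z n = shift (k (n + N)) (X (r (n + N)))" for n
    have Z: "Z n \<in> Hs s" for n unfolding Z_def by (rule shift_Hs[OF X(1)])
    have ZG: "(\<integral>x. G x (Z n x) \<partial>lborel) \<le> 2 * E" for n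
    proof -
      have "DJ (Z n) (Z n) = 0" unfolding Z_def DJ_shift[OF k X(1) X(1)] by (rule crit(1)[OF X(1) X(3)])
      moreover have "J (Z n) = J (X (r (n + N)))" unfolding Z_def by (rule J_shift[OF k X(1)])
      moreover have "J (X (r (n + N))) \<le> E"
      proof -
        have "N \<le> r (n + N)" using seq_suble[OF r, of "n + N"] by simp
        hence "inverse (real (Suc (r (n + N)))) \<le> inverse (real (Suc N))" by (intro le_imp_inverse_le) auto
        thus ?thesis using X(4)[of "r (n + N)"] unfolding E_def by linarith
      qed
      ultimately show ?thesis unfolding G_identity[OF Z] by simp
    qed
    have "(\<integral>\<^sup>+x. ennreal (G x (u x)) \<partial>lborel) \<le> ennreal (2 * E)"
    proof (rule nn_integral_AE_limit_le[where h = "\<lambda>n x. G x (Z n x)"])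
      show "AE x in lborel. (\<lambda>n. G x (Z n x)) \<longlonglongrightarrow> G x (u x)"
        using lim
      proof eventually_elim
        case (elim x)
        have l: "(\<lambda>n. Z n x) \<longlonglongrightarrow> u x" unfolding Z_def using LIMSEQ_ignore_initial_segment[OF elim, of N] .
        have "isCont (f x) (u x)" using f_cont_t[of UNIV x] by (simp add: continuous_on_eq_continuous_at)
        hence lf: "(\<lambda>n. f x (Z n x)) \<longlonglongrightarrow> f x (u x)" using l by (rule isCont_tendsto_compose)
        have "isCont (F x) (u x)" by (rule DERIV_isCont[OF F_deriv])
        hence lF: "(\<lambda>n. F x (Z n x)) \<longlonglongrightarrow> F x (u x)" using l by (rule isCont_tendsto_compose)
        show ?case unfolding G_def by (intro tendsto_intros l lf lF)
      qed
    qed (use ZG integrable_G[OF Z] G_nonneg in auto)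
    hence "ennreal (\<integral>x. G x (u x) \<partial>lborel) \<le> ennreal (2 * E)"
      using integrable_G[OF u(1)] G_nonneg by (simp add: nn_integral_eq_integral)
    moreover have "0 \<le> 2 * E" 
    proof -
      have "0 \<le> (\<integral>x. G x (Z 0 x) \<partial>lborel)" by (simp add: G_nonneg)
      thus ?thesis using ZG[of 0] by linarith
    qed
    ultimately have "(\<integral>x. G x (u x) \<partial>lborel) \<le> 2 * E" by (simp add: ennreal_le_iff)
    thus ?thesis unfolding crit(3)[OF u(1,3)] E_def by simp
  qed
  have "J u \<le> m"
  proof (rule LIMSEQ_le_const)
    show "(\<lambda>N. m + inverse (real (Suc N))) \<longlonglongrightarrow> m" by (rule LIMSEQ_inverse_real_of_nat_add)
    show "\<exists>N. \<forall>n\<ge>N. J u \<le> m + inverse (real (Suc n))" using Ju by blast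
  qed
  moreover have low: "m \<le> J v" if "v \<in> Hs s" "nontrivial v" "crit_point s V f v" for v
    unfolding m_def using bdd that by (intro cInf_lower) (auto simp: S_def)
  ultimately have eq: "J u = m" using low[OF u] by (intro antisym)
  show ?thesis
  proof (intro exI[of _ u] conjI u allI impI)
    show "J u = Inf {J v | v. v \<in> Hs s \<and> nontrivial v \<and> crit_point s V f v}"
      using eq unfolding m_def S_def .
    show "J u \<le> J v" if "v \<in> Hs s \<and> nontrivial v \<and> crit_point s V f v" for v using low that unfolding eq by blast
  qed
qed

end

theorem theorem1p1:
  fixes s :: real and V :: "'a::euclidean_space \<Rightarrow> real" and f :: "'a \<Rightarrow> real \<Rightarrow> real"
    and \<alpha> \<beta> lam :: real
  assumes s: "0 < s" "s < 1"
    and N: "real DIM('a) > 2 * s"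
    and V1: "continuous_on UNIV V" "0 < \<alpha>" "\<And>x. \<alpha> \<le> V x" "\<And>x. V x \<le> \<beta>"
    and V2: "\<And>x k. k \<in> int_lattice \<Longrightarrow> V (x + k) = V x"
    and f1: "continuous_on UNIV (\<lambda>(x, t). f x t)"
      "\<And>x k t. k \<in> int_lattice \<Longrightarrow> f (x + k) t = f x t"
      "\<And>\<epsilon>. \<epsilon> > 0 \<Longrightarrow> \<exists>R. \<forall>x t. \<bar>t\<bar> \<ge> R \<longrightarrow>
            \<bar>f x t\<bar> \<le> \<epsilon> * \<bar>t\<bar> powr (crit_exp s DIM('a) - 1)"
    and f2: "\<And>\<epsilon>. \<epsilon> > 0 \<Longrightarrow> \<exists>\<delta>>0. \<forall>x t. \<bar>t\<bar> \<le> \<delta> \<longrightarrow> \<bar>f x t\<bar> \<le> \<epsilon> * \<bar>t\<bar>"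
    and f3: "\<And>x. filterlim (\<lambda>t. primF f x t / t\<^sup>2) at_top at_infinity"
    and f4: "lam \<ge> 1" "\<And>x t \<theta>. 0 \<le> \<theta> \<Longrightarrow> \<theta> \<le> 1 \<Longrightarrow>
            f x (\<theta> * t) * (\<theta> * t) - 2 * primF f x (\<theta> * t) \<le> lam * (f x t * t - 2 * primF f x t)"
  shows "\<exists>u. u \<in> Hs s \<and> nontrivial u \<and> crit_point s V f u
           \<and> energy s V f u = Inf {energy s V f v | v. v \<in> Hs s \<and> nontrivial v \<and> crit_point s V f v}
           \<and> (\<forall>v. v \<in> Hs s \<and> nontrivial v \<and> crit_point s V f v \<longrightarrow> energy s V f u \<le> energy s V f v)"
proof -
  interpret schroedinger s V \<alpha> \<beta> "crit_exp s DIM('a)" "2 + 4 * s / real DIM('a)" f lam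
    by unfold_locales (fact s N V1 V2 f1 f2 f3 f4 refl)+
  show ?thesis by (rule ground_state)
qed

end
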